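(* Let $\Omega\subset\mathbb{C}^n$ be a bounded domain whose Bergman kernel function is Nash algebraic, equipped with its Bergman metric $\omega_\Omega$, and let $(\mathbb{C}^N_\kappa,\omega_{\mathbb{C}^N_\kappa})$, $0\le\kappa\le N$, be an indefinite complex Euclidean space. Then $(\Omega,\omega_\Omega)$ and $(\mathbb{C}^N_\kappa,\omega_{\mathbb{C}^N_\kappa})$ do not have common complex submanifolds.
   Context: The indefinite complex Euclidean space $\mathbb{C}^N_\kappa$ is $\mathbb{C}^N$ with the indefinite Kähler metric $\omega_{\mathbb{C}^N_\kappa}=4\sqrt{-1}\,\partial\overline\partial\bigl(\sum_{i=\kappa+1}^{N}|z_i|^2-\sum_{j=1}^{\kappa}|z_j|^2\bigr)$. For a bounded domain $\Omega\subset\mathbb{C}^n$ with Bergman kernel $K(z,\overline w)$, the Bergman metric is $\omega_\Omega=\sqrt{-1}\,\partial\overline\partial\log K(z,\overline z)$. The Bergman kernel is Nash algebraic if $K(z,\overline w)$, viewed as a holomorphic function of the independent variables $x=(z,\overline w)\in\mathbb{C}^{2n}$, satisfies $P(x,K(x))\equiv0$ for some non-zero polynomial $P(x,y)$ in $(x,y)\in\mathbb{C}^{2n}\times\mathbb{C}$. Two complex manifolds $(M_1,\omega_{M_1})$, $(M_2,\omega_{M_2})$ with (possibly indefinite) Kähler metrics have a common complex submanifold if a positive-dimensional complex submanifold of $M_1$ with the induced metric is biholomorphically isometric to a complex submanifold of $M_2$ with the induced metric; equivalently (locally), there are a connected complex manifold $D$ of positive dimension and holomorphic immersions $F:D\to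 M_1$, $L:D\to M_2$ with $F^*\omega_{M_1}=L^*\omega_{M_2}$. *)

theory Defs
  imports "HOL-Analysis.Analysis" "HOL-Library.Poly_Mapping"
begin

section \<open>Holomorphic maps of several variables\<close>

text \<open>Differentiable with complex linear derivative at every point of \<open>U\<close>; used for open \<open>U\<close> only.\<close>

definition holo_on :: "(complex^'n \<Rightarrow> complex) \<Rightarrow> (complex^'n) set \<Rightarrow> bool" where
  "holo_on f U \<longleftrightarrow>
     (\<forall>z\<in>U. \<exists>f'. (f has_derivative f') (at z) \<and> (\<forall>c v. f' (c *s v) = c * f' v))"

definition holo_map_on :: "(complex^'n \<Rightarrow> complex^'m) \<Rightarrow> (complex^'n) set \<Rightarrow> bool" where
  "holo_map_on F U \<longleftrightarrow> (\<forall>i. holo_on (\<lambda>z. F z $ i) U)"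

section \<open>Kaehler forms given by a potential\<close>

definition partial_deriv :: "complex^'n \<Rightarrow> (complex^'n \<Rightarrow> complex) \<Rightarrow> complex^'n \<Rightarrow> complex" where
  "partial_deriv e f z = vector_derivative (\<lambda>t::real. f (z + t *\<^sub>R e)) (at 0)"

text \<open>The Wirtinger operators: if \<open>x\<^sub>i\<close> and \<open>y\<^sub>i\<close> are the real and imaginary parts of \<open>z\<^sub>i\<close>, then
  \<open>d_z i = (\<partial>/\<partial>x\<^sub>i - \<i> \<partial>/\<partial>y\<^sub>i)/2\<close> and \<open>d_zbar i = (\<partial>/\<partial>x\<^sub>i + \<i> \<partial>/\<partial>y\<^sub>i)/2\<close>.\<close>

definition d_z :: "'n \<Rightarrow> (complex^'n \<Rightarrow> complex) \<Rightarrow> complex^'n \<Rightarrow> complex" where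
  "d_z i f z = (partial_deriv (axis i 1) f z - \<i> * partial_deriv (axis i \<i>) f z) / 2"

definition d_zbar :: "'n \<Rightarrow> (complex^'n \<Rightarrow> complex) \<Rightarrow> complex^'n \<Rightarrow> complex" where
  "d_zbar i f z = (partial_deriv (axis i 1) f z + \<i> * partial_deriv (axis i \<i>) f z) / 2"

text \<open>A differential 2-form on (an open subset of) \<open>\<complex>\<^sup>n\<close> is a function of a point and two real tangent
  vectors, the latter being elements of \<open>\<complex>\<^sup>n\<close>. The form \<open>i_ddbar \<phi>\<close> is
  \<open>\<i> \<Sum>\<^sub>i\<^sub>,\<^sub>j (d_z i (d_zbar j \<phi>)) dz\<^sub>i \<and> d(cnj z\<^sub>j)\<close>, and
  \<open>(dz\<^sub>i \<and> d(cnj z\<^sub>j))(u, v) = u\<^sub>i * cnj v\<^sub>j - v\<^sub>i * cnj u\<^sub>j\<close>.\<close>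

type_synonym 'n two_form = "complex^'n \<Rightarrow> complex^'n \<Rightarrow> complex^'n \<Rightarrow> complex"

definition i_ddbar :: "(complex^'n \<Rightarrow> complex) \<Rightarrow> 'n two_form" where
  "i_ddbar \<phi> z u v =
     \<i> * (\<Sum>i\<in>UNIV. \<Sum>j\<in>UNIV. d_z i (d_zbar j \<phi>) z * (u $ i * cnj (v $ j) - v $ i * cnj (u $ j)))"

text \<open>The index type is linearly ordered, so that its first \<open>\<kappa>\<close> elements make sense.\<close>

definition first_indices :: "nat \<Rightarrow> ('N::{finite,linorder}) set" where
  "first_indices \<kappa> = {i. card {j. j < i} < \<kappa>}"

definition indef_euclidean_form :: "nat \<Rightarrow> ('N::{finite,linorder}) two_form" where
  "indef_euclidean_form \<kappa> z u v =
     4 * i_ddbar (\<lambda>z. complex_of_real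
       ((\<Sum>i\<in>- first_indices \<kappa>. (cmod (z $ i))\<^sup>2) - (\<Sum>j\<in>first_indices \<kappa>. (cmod (z $ j))\<^sup>2))) z u v"

section \<open>Bergman kernel and Bergman metric\<close>

definition bergman_space :: "(complex^'n) set \<Rightarrow> (complex^'n \<Rightarrow> complex) set" where
  "bergman_space \<Omega> = {f. holo_on f \<Omega> \<and> set_integrable lborel \<Omega> (\<lambda>z. (cmod (f z))\<^sup>2)}"

text \<open>\<open>K z w\<close> stands for \<open>K(z, cnj w)\<close>. The reproducing property determines \<open>K\<close> on \<open>\<Omega> \<times> \<Omega>\<close>.\<close>

definition is_bergman_kernel :: "(complex^'n) set \<Rightarrow> (complex^'n \<Rightarrow> complex^'n \<Rightarrow> complex) \<Rightarrow> bool" where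
  "is_bergman_kernel \<Omega> K \<longleftrightarrow>
     (\<forall>w\<in>\<Omega>. (\<lambda>z. K z w) \<in> bergman_space \<Omega> \<and>
        (\<forall>f\<in>bergman_space \<Omega>. f w = (LINT z:\<Omega>|lborel. f z * cnj (K z w))))"

text \<open>On \<open>\<Omega>\<close>, the value \<open>K z z\<close> is a positive real number.\<close>

definition bergman_form :: "(complex^'n \<Rightarrow> complex^'n \<Rightarrow> complex) \<Rightarrow> 'n two_form" where
  "bergman_form K = i_ddbar (\<lambda>z. complex_of_real (ln (Re (K z z))))"

section \<open>Nash algebraic functions\<close>

text \<open>Polynomials in the variables \<open>'v\<close> are finitely supported functions from monomials
  (exponent vectors) to coefficients.\<close>

definition poly_eval :: "('v \<Rightarrow> complex) \<Rightarrow> (('v \<Rightarrow>\<^sub>0 nat) \<Rightarrow>\<^sub>0 complex) \<Rightarrow> complex" where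
  "poly_eval a P =
     (\<Sum>m\<in>Poly_Mapping.keys P. Poly_Mapping.lookup P m *
        (\<Prod>v\<in>Poly_Mapping.keys m. a v ^ Poly_Mapping.lookup m v))"

text \<open>The variable \<open>Some i\<close> of \<open>P\<close> stands for \<open>x\<^sub>i\<close>, and \<open>None\<close> stands for \<open>y\<close>.\<close>

definition nash_algebraic_on :: "(complex^'m) set \<Rightarrow> (complex^'m \<Rightarrow> complex) \<Rightarrow> bool" where
  "nash_algebraic_on U f \<longleftrightarrow>
     (\<exists>P :: ('m option \<Rightarrow>\<^sub>0 nat) \<Rightarrow>\<^sub>0 complex. P \<noteq> 0 \<and>
        (\<forall>x\<in>U. poly_eval (case_option (f x) (\<lambda>i. x $ i)) P = 0))"

text \<open>A point \<open>x = (z, cnj w)\<close> of \<open>\<complex>\<^sup>2\<^sup>n\<close> is indexed by the sum type \<open>'n + 'n\<close>.\<close>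

definition fst_part :: "complex^('n::finite + 'n) \<Rightarrow> complex^'n" where
  "fst_part x = (\<chi> i. x $ Inl i)"

definition cnj_snd_part :: "complex^('n::finite + 'n) \<Rightarrow> complex^'n" where
  "cnj_snd_part x = (\<chi> i. cnj (x $ Inr i))"

definition nash_algebraic_kernel ::
  "(complex^'n) set \<Rightarrow> (complex^'n \<Rightarrow> complex^'n \<Rightarrow> complex) \<Rightarrow> bool" where
  "nash_algebraic_kernel \<Omega> K \<longleftrightarrow>
     nash_algebraic_on {x. fst_part x \<in> \<Omega> \<and> cnj_snd_part x \<in> \<Omega>}
       (\<lambda>x. K (fst_part x) (cnj_snd_part x))"

section \<open>Common complex submanifolds\<close>

type_synonym ('a, 'd) atlas = "('a set \<times> ('a \<Rightarrow> complex^'d)) set"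

text \<open>A connected complex manifold of dimension \<open>CARD('d)\<close>, which is positive.\<close>

definition connected_complex_manifold :: "'a topology \<Rightarrow> ('a, 'd::finite) atlas \<Rightarrow> bool" where
  "connected_complex_manifold X A \<longleftrightarrow>
     topspace X \<noteq> {} \<and> connected_space X \<and> Hausdorff_space X \<and>
     second_countable X \<and>
     (\<Union>(U, \<phi>)\<in>A. U) = topspace X \<and>
     (\<forall>(U, \<phi>)\<in>A. openin X U \<and> open (\<phi> ` U) \<and>
        homeomorphic_map (subtopology X U) (top_of_set (\<phi> ` U)) \<phi>) \<and>
     (\<forall>(U, \<phi>)\<in>A. \<forall>(V, \<psi>)\<in>A. holo_map_on (\<lambda>x. \<psi> (inv_into U \<phi> x)) (\<phi> ` (U \<inter> V)))"

definition holo_immersion ::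
  "('a, 'd::finite) atlas \<Rightarrow> ('a \<Rightarrow> complex^'n) \<Rightarrow> bool" where
  "holo_immersion A F \<longleftrightarrow>
     (\<forall>(U, \<phi>)\<in>A. holo_map_on (\<lambda>x. F (inv_into U \<phi> x)) (\<phi> ` U) \<and>
        (\<forall>x\<in>\<phi> ` U. inj (frechet_derivative (\<lambda>x. F (inv_into U \<phi> x)) (at x))))"

definition pullback :: "(complex^'d \<Rightarrow> complex^'n) \<Rightarrow> 'n two_form \<Rightarrow> 'd two_form" where
  "pullback G \<omega> x u v =
     \<omega> (G x) (frechet_derivative G (at x) u) (frechet_derivative G (at x) v)"

text \<open>\<open>(M\<^sub>1, \<omega>\<^sub>1)\<close> and \<open>(M\<^sub>2, \<omega>\<^sub>2)\<close> are open subsets of complex vector spaces with 2-forms. The equation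
  \<open>F\<^sup>*\<omega>\<^sub>1 = L\<^sup>*\<omega>\<^sub>2\<close> on the manifold \<open>(X, A)\<close> is stated in every chart.\<close>

definition isometrically_immersed_in_both ::
  "'a topology \<Rightarrow> ('a, 'd::finite) atlas \<Rightarrow>
   (complex^'n) set \<Rightarrow> 'n two_form \<Rightarrow> (complex^'m) set \<Rightarrow> 'm two_form \<Rightarrow> bool" where
  "isometrically_immersed_in_both X A M1 \<omega>1 M2 \<omega>2 \<longleftrightarrow>
     (\<exists>F L. F ` topspace X \<subseteq> M1 \<and> holo_immersion A F \<and>
            L ` topspace X \<subseteq> M2 \<and> holo_immersion A L \<and>
            (\<forall>(U, \<phi>)\<in>A. \<forall>x\<in>\<phi> ` U. \<forall>u v.
               pullback (\<lambda>y. F (inv_into U \<phi> y)) \<omega>1 x u v = pullback (\<lambda>y. L (inv_into U \<phi> y)) \<omega>2 x u v))"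

end

theory Submission
  imports Defs "HOL-Complex_Analysis.Complex_Analysis"
begin

text \<open>
  A common submanifold contains a common curve, so let \<open>f\<close> be a curve in \<open>\<Omega>\<close> and \<open>l\<close> a curve in
  \<open>\<complex>\<^sup>N\<close> inducing the same metric. Polarising the equality of the metrics and integrating it twice
  gives a formula
  \<open>K(f t, f(cnj s)) = C(s) exp(\<Sum>\<^sub>i l\<^sub>i(t) c\<^sub>i(s) + h(t))\<close>
  with a holomorphic curve \<open>c\<close>, namely \<open>c\<^sub>i(s) = \<plusminus>4 cnj (l\<^sub>i(cnj s))\<close>
  (\<open>kernel_along_isometric_curve\<close>). The exponent has finite rank, which conflicts with the
  algebraicity of \<open>K\<close> as follows.

  For fixed \<open>s\<close> the left-hand side is algebraic over the ring \<open>\<complex>[f\<^sub>1, \<dots>, f\<^sub>n]\<close>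
  (\<open>kernel_germ_algebraic\<close>). So is every exponential \<open>exp(\<Sum>\<^sub>i l\<^sub>i(t) v\<^sub>i)\<close> whose vector \<open>v\<close> is a sum
  of differences of points of \<open>c\<close>, because quotients and products of algebraic elements are
  algebraic and the factor \<open>exp(h(t))\<close> cancels in quotients. Sums of increments of \<open>c\<close> fill a
  neighbourhood of \<open>0\<close> in the span of its velocities (\<open>curve_increments_fill_span\<close>). Hence there is a
  vector \<open>v\<close> such that, with \<open>x(t) = \<Sum>\<^sub>i l\<^sub>i(t) v\<^sub>i\<close>, all functions \<open>exp(\<tau> x(t))\<close> with small complex
  \<open>\<tau>\<close> are algebraic over \<open>\<complex>[f\<^sub>1, \<dots>, f\<^sub>n]\<close>. If \<open>x\<close> is not constant, this is impossible: the ring has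
  countable dimension over \<open>\<complex>\<close>, while the exponentials form an uncountable family with no
  relation for generic \<open>\<tau>\<close> (\<open>exponentials_not_all_algebraic\<close>).

  If \<open>x\<close> is constant for every velocity \<open>v\<close> of \<open>c\<close>, then \<open>K(f t, f(cnj s))\<close> is a product of a function
  of \<open>t\<close> and a function of \<open>s\<close>. Then the Cauchy--Schwarz inequality for the functions \<open>K(\<cdot>, f t)\<close> is
  an equality, and since the constants and the coordinates of a bounded domain are in the Bergman
  space, \<open>f\<close> is constant (\<open>cauchy_schwarz_equality\<close>). This contradicts that \<open>f\<close> is immersed.

  The calculus of \<open>K\<close> needs joint regularity in both variables, which reduces to local boundedness.
  Here too algebraicity helps: away from the zeros of the leading coefficient of its equation \<open>K\<close> is
  bounded by the coefficients, and the maximum principle extends the bound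
  (\<open>kernel_locally_bounded\<close>).\<close>

no_notation fps_nth (infixl \<open>$\<close> 75)

section \<open>Algebraic elements over a subring of an integral domain\<close>

definition is_subring :: "'a::comm_ring_1 set \<Rightarrow> bool" where
  "is_subring S \<longleftrightarrow> 1 \<in> S \<and> (\<forall>x\<in>S. \<forall>y\<in>S. x - y \<in> S \<and> x * y \<in> S)"

lemma is_subring_closed:
  assumes "is_subring S"
  shows "1 \<in> S" "0 \<in> S" "x \<in> S \<Longrightarrow> y \<in> S \<Longrightarrow> x - y \<in> S" "x \<in> S \<Longrightarrow> y \<in> S \<Longrightarrow> x * y \<in> S"
    "x \<in> S \<Longrightarrow> - x \<in> S" "x \<in> S \<Longrightarrow> y \<in> S \<Longrightarrow> x + y \<in> S" "x \<in> S \<Longrightarrow> x ^ n \<in> S"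
proof -
  show 1: "1 \<in> S" and d: "\<And>x y. x \<in> S \<Longrightarrow> y \<in> S \<Longrightarrow> x - y \<in> S"
    and m: "\<And>x y. x \<in> S \<Longrightarrow> y \<in> S \<Longrightarrow> x * y \<in> S"
    using assms by (auto simp: is_subring_def)
  show 0: "0 \<in> S" using d[OF 1 1] by simp
  show n: "\<And>x. x \<in> S \<Longrightarrow> - x \<in> S" using d[OF 0] by simp
  show "x \<in> S \<Longrightarrow> y \<in> S \<Longrightarrow> x + y \<in> S" using d[OF _ n] by fastforce
  show "x \<in> S \<Longrightarrow> x ^ n \<in> S" by (induction n) (auto simp: 1 m)
qed

lemma is_subring_sum:
  assumes "is_subring S" "\<And>i. i \<in> A \<Longrightarrow> f i \<in> S"
  shows "sum f A \<in> S"
  using assms(2) by (induction A rule: infinite_finite_induct) (auto simp: is_subring_closed[OF assms(1)])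

text \<open>Gaussian elimination without division: one pivot step removes one coordinate and one vector.\<close>

lemma linear_dependence_over_subring:
  fixes v :: "'k \<Rightarrow> 'j \<Rightarrow> 'a::idom"
  assumes S: "is_subring S" and J: "finite J" and K: "finite K" "card J < card K"
    and v: "\<And>k j. k \<in> K \<Longrightarrow> j \<in> J \<Longrightarrow> v k j \<in> S"
  shows "\<exists>c. (\<forall>k\<in>K. c k \<in> S) \<and> (\<exists>k\<in>K. c k \<noteq> 0) \<and> (\<forall>j\<in>J. (\<Sum>k\<in>K. c k * v k j) = 0)"
  using J K v
proof (induction J arbitrary: K v rule: finite_induct)
  case empty
  then obtain k where "k \<in> K" by fastforce
  then show ?case by (intro exI[of _ "\<lambda>_. 1"]) (auto simp: is_subring_closed[OF S])
next
  case (insert j0 J)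
  show ?case
  proof (cases "\<forall>k\<in>K. v k j0 = 0")
    case True
    have "card J < card K" using insert by simp
    then obtain c where "\<forall>k\<in>K. c k \<in> S" "\<exists>k\<in>K. c k \<noteq> 0" "\<forall>j\<in>J. (\<Sum>k\<in>K. c k * v k j) = 0"
      using insert.IH[of K v] insert.prems by auto
    with True show ?thesis by (intro exI[of _ c]) auto
  next
    case False
    then obtain k0 where k0: "k0 \<in> K" "v k0 j0 \<noteq> 0" by auto
    define K' where "K' = K - {k0}"
    define p where "p = v k0 j0"
    define v' where "v' k j = p * v k j - v k j0 * v k0 j" for k j
    have K': "finite K'" "card J < card K'" "K = insert k0 K'" "k0 \<notin> K'"
      using insert.prems insert.hyps k0 by (auto simp: K'_def)
    have "v' k j \<in> S" if "k \<in> K'" "j \<in> J" for k j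
      using that k0 insert.prems(3) unfolding v'_def p_def K'_def
      by (auto intro!: is_subring_closed[OF S])
    then obtain c where c: "\<forall>k\<in>K'. c k \<in> S" "\<exists>k\<in>K'. c k \<noteq> 0"
        "\<forall>j\<in>J. (\<Sum>k\<in>K'. c k * v' k j) = 0"
      using insert.IH[of K' v'] K' by auto
    define d where "d k = (if k = k0 then - (\<Sum>k\<in>K'. c k * v k j0) else p * c k)" for k
    have split: "(\<Sum>k\<in>K. d k * v k j) = (\<Sum>k\<in>K'. p * c k * v k j) - (\<Sum>k\<in>K'. c k * v k j0) * v k0 j" for j
    proof -
      have "(\<Sum>k\<in>K'. d k * v k j) = (\<Sum>k\<in>K'. p * c k * v k j)"
        using K'(4) by (intro sum.cong) (auto simp: d_def)
      then show ?thesis using K' by (simp add: d_def)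
    qed
    have "(\<Sum>k\<in>K. d k * v k j) = 0" if "j \<in> insert j0 J" for j
    proof (cases "j = j0")
      case True
      then show ?thesis unfolding split by (simp add: p_def sum_distrib_left sum_distrib_right mult_ac)
    next
      case False
      then have "(\<Sum>k\<in>K'. c k * v' k j) = 0" using that c by auto
      then show ?thesis unfolding split
        by (simp add: v'_def algebra_simps sum_subtractf sum_distrib_left sum_distrib_right)
    qed
    moreover have "d k \<in> S" if "k \<in> K" for k
      using that c(1) K' insert.prems(3) k0 unfolding d_def p_def
      by (auto intro!: is_subring_closed[OF S] is_subring_sum[OF S])
    moreover have "\<exists>k\<in>K. d k \<noteq> 0"
      using c(2) k0(2) K'(3,4) unfolding d_def p_def by auto
    ultimately show ?thesis by blast
  qed
qed

definition algebraic_over :: "'a::idom set \<Rightarrow> 'a \<Rightarrow> bool" where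
  "algebraic_over S x \<longleftrightarrow>
     (\<exists>(d::nat) c. (\<forall>j\<le>d. c j \<in> S) \<and> (\<exists>j\<le>d. c j \<noteq> 0) \<and> (\<Sum>j\<le>d. c j * x ^ j) = 0)"

lemma algebraic_overE_lead:
  assumes "algebraic_over S x"
  obtains d c where "\<And>j. j \<le> d \<Longrightarrow> c j \<in> S" "c d \<noteq> 0" "(\<Sum>j\<le>d. c j * x ^ j) = 0"
proof -
  obtain d c where dc: "\<forall>j\<le>d. c j \<in> S" "\<exists>j\<le>d. c j \<noteq> 0" "(\<Sum>j\<le>d. c j * x ^ j) = 0"
    using assms unfolding algebraic_over_def by blast
  define m where "m = Max {j. j \<le> d \<and> c j \<noteq> 0}"
  have fin: "finite {j. j \<le> d \<and> c j \<noteq> 0}" by simp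
  have m: "m \<le> d" "c m \<noteq> 0" using Max_in[OF fin] dc(2) unfolding m_def by auto
  have z: "c j = 0" if "m < j" "j \<le> d" for j
    using Max_ge[OF fin, of j] that unfolding m_def by fastforce
  have "(\<Sum>j\<le>m. c j * x ^ j) = (\<Sum>j\<le>d. c j * x ^ j)"
    using m z by (intro sum.mono_neutral_left) auto
  with dc m show ?thesis by (intro that[of m c]) auto
qed

text \<open>Multiplying by the leading coefficient makes every power of \<open>x\<close> a combination of the first
  \<open>a\<close> ones.\<close>

lemma power_reduction:
  fixes x :: "'a::idom"
  assumes S: "is_subring S" and c: "\<And>j. j \<le> a \<Longrightarrow> c j \<in> S" "(\<Sum>j\<le>a. c j * x ^ j) = 0"
    and a: "0 < a"
  shows "\<exists>u. (\<forall>i<a. u i \<in> S) \<and> c a ^ k * x ^ k = (\<Sum>i<a. u i * x ^ i)"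
proof (induction k)
  case 0
  show ?case using a
    by (intro exI[of _ "\<lambda>i. if i = 0 then 1 else 0"])
       (auto simp: is_subring_closed[OF S] if_distrib if_distribR sum.delta cong: if_cong)
next
  case (Suc k)
  then obtain u where u: "\<forall>i<a. u i \<in> S" "c a ^ k * x ^ k = (\<Sum>i<a. u i * x ^ i)" by blast
  obtain b where b: "a = Suc b" using a by (cases a) auto
  define w where "w i = c a * (if i = 0 then 0 else u (i - 1)) - u b * c i" for i
  have top: "c a * x ^ a = - (\<Sum>i<a. c i * x ^ i)"
    using c(2) by (simp add: lessThan_Suc_atMost[symmetric] add_eq_0_iff)
  have "c a ^ Suc k * x ^ Suc k = c a * x * (\<Sum>i<a. u i * x ^ i)"
    using u(2) by (simp add: mult_ac)
  also have "\<dots> = c a * (\<Sum>i<b. u i * x ^ Suc i) + u b * (c a * x ^ a)"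
    by (simp add: b algebra_simps sum_distrib_left)
  also have "(\<Sum>i<b. u i * x ^ Suc i) = (\<Sum>i<a. (if i = 0 then 0 else u (i - 1)) * x ^ i)"
    by (simp add: b sum.lessThan_Suc_shift del: sum.lessThan_Suc)
  also have "c a * \<dots> + u b * (c a * x ^ a) = (\<Sum>i<a. w i * x ^ i)"
    unfolding top by (simp add: w_def algebra_simps sum_subtractf sum_distrib_left)
  finally have "c a ^ Suc k * x ^ Suc k = (\<Sum>i<a. w i * x ^ i)" .
  moreover have "\<forall>i<a. w i \<in> S"
    using u(1) c(1) b by (auto simp: w_def intro!: is_subring_closed[OF S])
  ultimately show ?case by blast
qed

text \<open>The powers of \<open>x * y\<close>, multiplied by powers of the leading coefficients, all lie in the module
  spanned by the \<open>a * b\<close> products \<open>x ^ i * y ^ j\<close>, so that \<open>a * b + 1\<close> of them are dependent.\<close>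

lemma algebraic_over_mult:
  assumes S: "is_subring S" and "algebraic_over S x" "algebraic_over S y"
  shows "algebraic_over S (x * y)"
proof -
  obtain a p where p: "\<And>j. j \<le> a \<Longrightarrow> p j \<in> S" "p a \<noteq> 0" "(\<Sum>j\<le>a. p j * x ^ j) = 0"
    using algebraic_overE_lead[OF assms(2)] by blast
  obtain b q where q: "\<And>j. j \<le> b \<Longrightarrow> q j \<in> S" "q b \<noteq> 0" "(\<Sum>j\<le>b. q j * y ^ j) = 0"
    using algebraic_overE_lead[OF assms(3)] by blast
  have "0 < a" "0 < b" using p(2,3) q(2,3) by (auto intro!: gr0I)
  have "\<forall>k. \<exists>u. (\<forall>i<a. u i \<in> S) \<and> p a ^ k * x ^ k = (\<Sum>i<a. u i * x ^ i)"
    using power_reduction[OF S, of a p x] p \<open>0 < a\<close> by blast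
  then obtain u where u: "\<And>k i. i < a \<Longrightarrow> u k i \<in> S" "\<And>k. p a ^ k * x ^ k = (\<Sum>i<a. u k i * x ^ i)"
    by metis
  have "\<forall>k. \<exists>v. (\<forall>i<b. v i \<in> S) \<and> q b ^ k * y ^ k = (\<Sum>i<b. v i * y ^ i)"
    using power_reduction[OF S, of b q y] q \<open>0 < b\<close> by blast
  then obtain v where v: "\<And>k i. i < b \<Longrightarrow> v k i \<in> S" "\<And>k. q b ^ k * y ^ k = (\<Sum>i<b. v k i * y ^ i)"
    by metis
  define J where "J = {..<a} \<times> {..<b}"
  have "\<exists>c. (\<forall>k\<in>{..a * b}. c k \<in> S) \<and> (\<exists>k\<in>{..a * b}. c k \<noteq> 0) \<and>
      (\<forall>j\<in>J. (\<Sum>k\<le>a * b. c k * (u k (fst j) * v k (snd j))) = 0)"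
    by (rule linear_dependence_over_subring[OF S])
       (auto simp: J_def intro!: u v is_subring_closed[OF S])
  then obtain c where c: "\<forall>k\<in>{..a * b}. c k \<in> S" "\<exists>k\<in>{..a * b}. c k \<noteq> 0"
      "\<forall>j\<in>J. (\<Sum>k\<le>a * b. c k * (u k (fst j) * v k (snd j))) = 0" by blast
  define e where "e k = c k * (p a * q b) ^ k" for k
  have "(\<Sum>k\<le>a * b. e k * (x * y) ^ k)
      = (\<Sum>k\<le>a * b. c k * ((p a ^ k * x ^ k) * (q b ^ k * y ^ k)))"
    by (simp add: e_def power_mult_distrib mult_ac)
  also have "\<dots> = (\<Sum>k\<le>a * b. c k * (\<Sum>j\<in>J. (u k (fst j) * v k (snd j)) * (x ^ fst j * y ^ snd j)))"
  proof (rule sum.cong)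
    fix k
    have "(p a ^ k * x ^ k) * (q b ^ k * y ^ k)
        = (\<Sum>j\<in>J. (u k (fst j) * x ^ fst j) * (v k (snd j) * y ^ snd j))"
      unfolding u(2) v(2) J_def sum_product sum.cartesian_product by (simp add: case_prod_unfold)
    then show "c k * ((p a ^ k * x ^ k) * (q b ^ k * y ^ k))
        = c k * (\<Sum>j\<in>J. (u k (fst j) * v k (snd j)) * (x ^ fst j * y ^ snd j))"
      by (simp add: mult_ac)
  qed simp
  also have "\<dots> = (\<Sum>j\<in>J. (\<Sum>k\<le>a * b. c k * (u k (fst j) * v k (snd j))) * (x ^ fst j * y ^ snd j))"
    unfolding sum_distrib_left sum_distrib_right by (subst sum.swap) (simp add: mult_ac)
  also have "\<dots> = 0" using c(3) by simp
  finally have "(\<Sum>k\<le>a * b. e k * (x * y) ^ k) = 0" .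
  moreover have "\<forall>k\<le>a * b. e k \<in> S"
    using c(1) p(1)[of a] q(1)[of b] by (auto simp: e_def intro!: is_subring_closed[OF S])
  moreover have "\<exists>k\<le>a * b. e k \<noteq> 0" using c(2) p(2) q(2) by (auto simp: e_def)
  ultimately show ?thesis unfolding algebraic_over_def by blast
qed

lemma algebraic_over_member:
  assumes S: "is_subring S" and "x \<in> S"
  shows "algebraic_over S x"
  unfolding algebraic_over_def
  by (rule exI[of _ 1], rule exI[of _ "\<lambda>j. if j = 0 then - x else 1"])
     (auto simp: is_subring_closed[OF S] assms)

lemma algebraic_over_prod:
  assumes S: "is_subring S" and "\<And>i. i \<in> I \<Longrightarrow> algebraic_over S (x i)"
  shows "algebraic_over S (\<Prod>i\<in>I. x i)"
  using assms(2)
  by (induction I rule: infinite_finite_induct)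
     (auto intro: algebraic_over_mult[OF S] algebraic_over_member[OF S] is_subring_closed[OF S])

lemma algebraic_over_inverse:
  assumes "algebraic_over S x" "x * y = 1"
  shows "algebraic_over S y"
proof -
  obtain d c where dc: "\<forall>j\<le>d. c j \<in> S" "\<exists>j\<le>d. c j \<noteq> 0" "(\<Sum>j\<le>d. c j * x ^ j) = 0"
    using assms(1) unfolding algebraic_over_def by blast
  have "(\<Sum>j\<le>d. c (d - j) * y ^ j) = (\<Sum>j\<le>d. c j * y ^ (d - j))"
    by (rule sum.reindex_bij_witness[of _ "\<lambda>j. d - j" "\<lambda>j. d - j"]) auto
  also have "\<dots> = (\<Sum>j\<le>d. c j * x ^ j) * y ^ d"
    unfolding sum_distrib_right
  proof (rule sum.cong)
    fix j assume "j \<in> {..d}"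
    then have "y ^ d = y ^ j * y ^ (d - j)" by (simp flip: power_add)
    then show "c j * y ^ (d - j) = c j * x ^ j * y ^ d"
      using assms(2) by (simp add: mult_ac flip: power_mult_distrib)
  qed simp
  finally have "(\<Sum>j\<le>d. c (d - j) * y ^ j) = 0" using dc(3) by simp
  moreover have "\<exists>j\<le>d. c (d - j) \<noteq> 0" using dc(2) by (metis diff_diff_cancel diff_le_self)
  ultimately show ?thesis unfolding algebraic_over_def using dc(1)
    by (intro exI[of _ d] exI[of _ "\<lambda>j. c (d - j)"]) auto
qed

lemma fps_const_sum: "(\<Sum>i\<in>I. fps_const (f i)) = fps_const (\<Sum>i\<in>I. f i)"
  by (induction I rule: infinite_finite_induct) (simp_all flip: fps_const_add)

section \<open>Families of exponentials are far from algebraic\<close>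

definition fam_span :: "('m \<Rightarrow> complex fps) \<Rightarrow> complex fps set" where
  "fam_span X = {y. \<exists>M c. finite M \<and> y = (\<Sum>m\<in>M. fps_const (c m) * X m)}"

lemma fam_spanI: "finite M \<Longrightarrow> (\<Sum>m\<in>M. fps_const (c m) * X m) \<in> fam_span X"
  unfolding fam_span_def by blast

lemma fam_span_common_support:
  assumes "finite Y" "Y \<subseteq> fam_span X"
  obtains M c where "finite M" "\<And>y. y \<in> Y \<Longrightarrow> y = (\<Sum>m\<in>M. fps_const (c y m) * X m)"
proof -
  have "\<forall>y\<in>Y. \<exists>M c. finite M \<and> y = (\<Sum>m\<in>M. fps_const (c m) * X m)"
    using assms(2) unfolding fam_span_def by blast
  then obtain N c where N: "\<And>y. y \<in> Y \<Longrightarrow> finite (N y)"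
      "\<And>y. y \<in> Y \<Longrightarrow> y = (\<Sum>m\<in>N y. fps_const (c y m) * X m)" by metis
  define M where "M = (\<Union>y\<in>Y. N y)"
  have M: "finite M" using N(1) assms(1) by (auto simp: M_def)
  have "y = (\<Sum>m\<in>M. fps_const (if m \<in> N y then c y m else 0) * X m)" if "y \<in> Y" for y
  proof -
    have "(\<Sum>m\<in>M. fps_const (if m \<in> N y then c y m else 0) * X m) = (\<Sum>m\<in>N y. fps_const (c y m) * X m)"
      using that M by (intro sum.mono_neutral_cong_right) (auto simp: M_def)
    then show ?thesis using N(2)[OF that] by simp
  qed
  then show ?thesis using that[of M "\<lambda>y m. if m \<in> N y then c y m else 0"] M by blast
qed

lemma fam_span_base: "X m \<in> fam_span X"
  using fam_spanI[of "{m}" "\<lambda>_. 1" X] by simp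

lemma fam_span_scale:
  assumes "y \<in> fam_span X" shows "fps_const a * y \<in> fam_span X"
proof -
  obtain M c where M: "finite M" "y = (\<Sum>m\<in>M. fps_const (c m) * X m)"
    using assms unfolding fam_span_def by blast
  have "fps_const a * y = (\<Sum>m\<in>M. fps_const (a * c m) * X m)"
    unfolding M(2) sum_distrib_left by (simp add: mult.assoc flip: fps_const_mult)
  then show ?thesis using fam_spanI[OF M(1), of "\<lambda>m. a * c m" X] by simp
qed

lemma fam_span_add:
  assumes "y \<in> fam_span X" "z \<in> fam_span X" shows "y + z \<in> fam_span X"
proof -
  obtain M c where M: "finite M" "\<And>w. w \<in> {y,z} \<Longrightarrow> w = (\<Sum>m\<in>M. fps_const (c w m) * X m)"
    using fam_span_common_support[of "{y,z}" X] assms by auto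
  have "y + z = (\<Sum>m\<in>M. fps_const (c y m) * X m) + (\<Sum>m\<in>M. fps_const (c z m) * X m)"
    using M(2)[of y] M(2)[of z] by simp
  also have "\<dots> = (\<Sum>m\<in>M. fps_const (c y m + c z m) * X m)"
    by (simp add: sum.distrib distrib_right flip: fps_const_add)
  finally show ?thesis using fam_spanI[OF M(1), of "\<lambda>m. c y m + c z m" X] by simp
qed

lemma fam_span_sum:
  assumes "\<And>i. i \<in> A \<Longrightarrow> f i \<in> fam_span X" shows "sum f A \<in> fam_span X"
proof -
  have "0 \<in> fam_span X" using fam_spanI[of "{}" _ X] by simp
  then show ?thesis using assms
    by (induction A rule: infinite_finite_induct) (auto intro: fam_span_add)
qed

lemma is_subring_fam_span:
  assumes one: "\<exists>u. X u = 1" and mult: "\<And>a b. \<exists>c. X a * X b = X c"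
  shows "is_subring (fam_span X)"
proof -
  have "y * z \<in> fam_span X" if y: "y \<in> fam_span X" and z: "z \<in> fam_span X" for y z
  proof -
    obtain M c where M: "y = (\<Sum>m\<in>M. fps_const (c m) * X m)"
      using y unfolding fam_span_def by blast
    obtain N d where N: "z = (\<Sum>m\<in>N. fps_const (d m) * X m)"
      using z unfolding fam_span_def by blast
    have "y * z = (\<Sum>m\<in>M. \<Sum>n\<in>N. fps_const (c m) * (fps_const (d n) * (X m * X n)))"
      unfolding M N sum_product by (intro sum.cong refl) (simp only: mult_ac)
    moreover have "X m * X n \<in> fam_span X" for m n using mult[of m n] fam_span_base by metis
    ultimately show ?thesis by (simp only:) (intro fam_span_sum fam_span_scale)
  qed
  moreover have "y - z \<in> fam_span X" if "y \<in> fam_span X" "z \<in> fam_span X" for y z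
    using fam_span_add[OF that(1) fam_span_scale[OF that(2), of "-1"]]
    by (simp flip: fps_const_neg)
  moreover have "1 \<in> fam_span X" using one fam_span_base by metis
  ultimately show ?thesis unfolding is_subring_def by blast
qed

text \<open>Among finitely many elements a maximal subfamily independent over \<open>E\<close> generates all others up to
  a common denominator \<open>e\<close>.\<close>

lemma maximal_independent_subfamily:
  fixes w :: "'i \<Rightarrow> 'a::idom"
  assumes E: "is_subring E" and "finite I"
  obtains B e where "B \<subseteq> I" "e \<in> E" "e \<noteq> 0"
    "\<And>y. (\<And>k. k \<in> B \<Longrightarrow> y k \<in> E) \<Longrightarrow> (\<Sum>k\<in>B. y k * w k) = 0 \<Longrightarrow> (\<And>k. k \<in> B \<Longrightarrow> y k = 0)"
    "\<And>i. i \<in> I \<Longrightarrow> \<exists>y. (\<forall>k\<in>B. y k \<in> E) \<and> e * w i = (\<Sum>k\<in>B. y k * w k)"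
proof -
  define ind where "ind B \<longleftrightarrow> (\<forall>y. (\<forall>k\<in>B. y k \<in> E) \<longrightarrow> (\<Sum>k\<in>B. y k * w k) = 0 \<longrightarrow> (\<forall>k\<in>B. y k = 0))" for B
  define gen where "gen B e j \<longleftrightarrow> (\<exists>y. (\<forall>k\<in>B. y k \<in> E) \<and> e * w j = (\<Sum>k\<in>B. y k * w k))" for B e j
  have "\<exists>B\<subseteq>I. \<exists>e\<in>E. e \<noteq> 0 \<and> ind B \<and> (\<forall>j\<in>I. gen B e j)"
    using assms(2)
  proof (induction I rule: finite_induct)
    case empty
    have "1 \<in> E" "ind {}" using is_subring_closed(1)[OF E] by (auto simp: ind_def)
    then show ?case by (intro exI[of _ "{}"] conjI bexI[of _ 1]) auto
  next
    case (insert i I)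
    then obtain B e where B: "B \<subseteq> I" "e \<in> E" "e \<noteq> 0" "ind B" "\<forall>j\<in>I. gen B e j"
      by blast
    have iB: "i \<notin> B" "finite B" using B(1) insert.hyps finite_subset by auto
    show ?case
    proof (cases "ind (insert i B)")
      case True
      have "gen (insert i B) e i"
      proof -
        have "(\<Sum>k\<in>B. (if k = i then e else 0) * w k) = 0" using iB by (intro sum.neutral) auto
        then show ?thesis unfolding gen_def using iB B(2)
          by (intro exI[of _ "\<lambda>k. if k = i then e else 0"]) (auto simp: is_subring_closed(2)[OF E])
      qed
      moreover have "gen (insert i B) e j" if "j \<in> I" for j
      proof -
        have "gen B e j" using B(5) that by simp
        then obtain y where y: "\<forall>k\<in>B. y k \<in> E" "e * w j = (\<Sum>k\<in>B. y k * w k)"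
          unfolding gen_def by (elim exE conjE) (rule that)
        have "(\<Sum>k\<in>B. (if k = i then 0 else y k) * w k) = (\<Sum>k\<in>B. y k * w k)"
          using iB by (intro sum.cong) auto
        then show ?thesis using y iB unfolding gen_def
          by (intro exI[of _ "\<lambda>k. if k = i then 0 else y k"]) (auto simp: is_subring_closed(2)[OF E])
      qed
      ultimately show ?thesis using True B(1-3)
        by (intro exI[of _ "insert i B"] conjI bexI[of _ e]) auto
    next
      case False
      then obtain z where z: "\<forall>k\<in>insert i B. z k \<in> E" "(\<Sum>k\<in>insert i B. z k * w k) = 0"
          "\<not> (\<forall>k\<in>insert i B. z k = 0)" unfolding ind_def by metis
      have rel: "z i * w i = - (\<Sum>k\<in>B. z k * w k)"
        using z(2) iB by (simp add: add_eq_0_iff2)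
      have zi: "z i \<noteq> 0"
      proof
        assume "z i = 0"
        then have "(\<Sum>k\<in>B. z k * w k) = 0" using rel by simp
        then have "\<forall>k\<in>B. z k = 0" using B(4) z(1) unfolding ind_def by simp
        with z(3) \<open>z i = 0\<close> show False by simp
      qed
      have "gen B (e * z i) i"
      proof -
        have "(e * z i) * w i = (\<Sum>k\<in>B. (- e * z k) * w k)"
          using rel by (simp add: mult.assoc sum_distrib_left sum_negf)
        moreover have "\<forall>k\<in>B. - e * z k \<in> E"
          using z(1) B(2) is_subring_closed(4,5)[OF E] by simp
        ultimately show ?thesis unfolding gen_def by (intro exI[of _ "\<lambda>k. - e * z k"]) simp
      qed
      moreover have "gen B (e * z i) j" if "j \<in> I" for j
      proof -
        have "gen B e j" using B(5) that by simp
        then obtain y where y: "\<forall>k\<in>B. y k \<in> E" "e * w j = (\<Sum>k\<in>B. y k * w k)"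
          unfolding gen_def by (elim exE conjE) (rule that)
        have "(e * z i) * w j = z i * (e * w j)" by (simp only: mult_ac)
        also have "\<dots> = (\<Sum>k\<in>B. (z i * y k) * w k)"
          unfolding y(2) sum_distrib_left by (simp only: mult_ac)
        finally show ?thesis using y(1) z(1) is_subring_closed(4)[OF E] unfolding gen_def
          by (intro exI[of _ "\<lambda>k. z i * y k"]) simp
      qed
      moreover have "e * z i \<in> E" "e * z i \<noteq> 0"
        using zi B(2,3) z(1) is_subring_closed(4)[OF E] by auto
      ultimately show ?thesis using B(1,4)
        by (intro exI[of _ B] conjI bexI[of _ "e * z i"]) auto
    qed
  qed
  then obtain B e where B: "B \<subseteq> I" "e \<in> E" "e \<noteq> 0" "ind B" "\<forall>j\<in>I. gen B e j" by blast
  show ?thesis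
  proof (rule that[OF B(1-3)])
    show "y k = 0" if "\<And>k. k \<in> B \<Longrightarrow> y k \<in> E" "(\<Sum>k\<in>B. y k * w k) = 0" "k \<in> B" for y k
      using B(4) that unfolding ind_def by simp
    show "\<exists>y. (\<forall>k\<in>B. y k \<in> E) \<and> e * w i = (\<Sum>k\<in>B. y k * w k)" if "i \<in> I" for i
      using B(5) that unfolding gen_def by simp
  qed
qed

text \<open>The power series \<open>X \<nu>\<close> plays the role of \<open>exp(\<nu>x)\<close> for a fixed non-constant \<open>x\<close> with
  \<open>x' = Y\<close>.\<close>

locale exponential_family =
  fixes X :: "complex \<Rightarrow> complex fps" and Y :: "complex fps"
  assumes X_add: "X (\<nu> + \<mu>) = X \<nu> * X \<mu>" and X_0: "X 0 = 1"
    and deriv: "fps_deriv (X \<nu>) = fps_const \<nu> * Y * X \<nu>" and Y: "Y \<noteq> 0"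
begin

lemma X_nonzero: "X \<nu> \<noteq> 0"
  using X_add[of \<nu> "-\<nu>"] X_0 by auto

lemma X_power: "X (of_nat k * \<nu>) = X \<nu> ^ k"
  by (induction k) (auto simp: X_0 X_add distrib_right)

text \<open>Differentiating a relation and subtracting a multiple of it removes one exponential.\<close>

lemma independent:
  assumes "finite P" "inj_on g P" "(\<Sum>p\<in>P. fps_const (a p) * X (g p)) = 0" "p \<in> P"
  shows "a p = 0"
  using assms
proof (induction P arbitrary: a p rule: finite_induct)
  case (insert r P)
  have rel: "(\<Sum>p\<in>insert r P. fps_const (a p) * X (g p)) = 0" using insert.prems by simp
  have "fps_deriv (\<Sum>p\<in>insert r P. fps_const (a p) * X (g p))
      = Y * (\<Sum>p\<in>insert r P. fps_const (a p * g p) * X (g p))"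
    by (simp add: fps_deriv_sum deriv sum_distrib_left mult_ac distrib_left flip: fps_const_mult)
  then have d: "(\<Sum>p\<in>insert r P. fps_const (a p * g p) * X (g p)) = 0"
    using rel Y by simp
  have "(\<Sum>p\<in>insert r P. fps_const (a p * (g p - g r)) * X (g p))
      = (\<Sum>p\<in>insert r P. fps_const (a p * g p) * X (g p))
        - fps_const (g r) * (\<Sum>p\<in>insert r P. fps_const (a p) * X (g p))"
    unfolding sum_distrib_left sum_subtractf[symmetric]
    by (rule sum.cong) (simp_all add: algebra_simps flip: fps_const_mult fps_const_sub)
  then have "(\<Sum>p\<in>insert r P. fps_const (a p * (g p - g r)) * X (g p)) = 0"
    using rel d by simp
  then have "(\<Sum>p\<in>P. fps_const (a p * (g p - g r)) * X (g p)) = 0"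
    using insert.hyps by simp
  then have "a q * (g q - g r) = 0" if "q \<in> P" for q
    using insert.IH[of "\<lambda>p. a p * (g p - g r)" q] insert.prems that by auto
  then have 0: "a q = 0" if "q \<in> P" for q
    using insert.prems(1) insert.hyps that by (auto simp: inj_on_def)
  then have "fps_const (a r) * X (g r) = 0" using rel insert.hyps by simp
  then have "a r = 0" using X_nonzero by simp
  with 0 insert.prems show ?case by auto
qed simp

lemma is_subring_exponentials: "is_subring (fam_span X)"
  by (rule is_subring_fam_span) (metis X_0 X_add)+

text \<open>Let \<open>w\<^sub>i\<close> be finitely many power series. Choose a maximal subfamily independent over the ring
  \<open>E\<close> of exponential sums and express all \<open>w\<^sub>i\<close> in it; only finitely many exponents \<open>\<Lambda>\<close> occur. If
  \<open>\<tau>\<close> is generic with respect to \<open>\<Lambda>\<close>, then \<open>exp(j\<tau>x)\<close> for different \<open>j\<close> cannot interact with these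
  exponents, and a relation for \<open>exp(\<tau>x)\<close> with coefficients in the span of the \<open>w\<^sub>i\<close> is trivial.\<close>

lemma generic_exponent_no_relation:
  assumes I: "finite I"
  obtains \<Lambda> where "finite \<Lambda>"
    "\<And>d \<tau> a. inj_on (\<lambda>(j, \<nu>). of_nat j * \<tau> + \<nu>) ({..d} \<times> \<Lambda>) \<Longrightarrow>
       (\<Sum>j\<le>d. (\<Sum>i\<in>I. fps_const (a j i) * w i) * X \<tau> ^ j) = 0 \<Longrightarrow>
       \<forall>j\<le>d. (\<Sum>i\<in>I. fps_const (a j i) * w i) = 0"
proof (rule maximal_independent_subfamily[OF is_subring_exponentials I, of w])
  let ?E = "fam_span X"
  fix B e
  assume B: "B \<subseteq> I" "e \<in> ?E" "e \<noteq> 0"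
    and ind: "\<And>y k. (\<And>k. k \<in> B \<Longrightarrow> y k \<in> ?E) \<Longrightarrow> (\<Sum>k\<in>B. y k * w k) = 0 \<Longrightarrow> k \<in> B \<Longrightarrow> y k = 0"
    and gen: "\<And>i. i \<in> I \<Longrightarrow> \<exists>y. (\<forall>k\<in>B. y k \<in> ?E) \<and> e * w i = (\<Sum>k\<in>B. y k * w k)"
  define y where "y i = (SOME y. (\<forall>k\<in>B. y k \<in> ?E) \<and> e * w i = (\<Sum>k\<in>B. y k * w k))" for i
  have "(\<forall>k\<in>B. y i k \<in> ?E) \<and> e * w i = (\<Sum>k\<in>B. y i k * w k)" if "i \<in> I" for i
    unfolding y_def by (fact someI_ex[OF gen[OF that]])
  then have y: "\<And>i k. i \<in> I \<Longrightarrow> k \<in> B \<Longrightarrow> y i k \<in> ?E"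
      "\<And>i. i \<in> I \<Longrightarrow> e * w i = (\<Sum>k\<in>B. y i k * w k)"
    by simp_all
  have fB: "finite B" using B(1) I finite_subset by auto
  have "(\<lambda>(i,k). y i k) ` (I \<times> B) \<subseteq> fam_span X" using y(1) by auto
  from fam_span_common_support[OF _ this] obtain \<Lambda> b where \<Lambda>: "finite \<Lambda>"
      and b: "\<And>z. z \<in> (\<lambda>(i,k). y i k) ` (I \<times> B) \<Longrightarrow> z = (\<Sum>\<nu>\<in>\<Lambda>. fps_const (b z \<nu>) * X \<nu>)"
    using fB I by blast
  have yb: "y i k = (\<Sum>\<nu>\<in>\<Lambda>. fps_const (b (y i k) \<nu>) * X \<nu>)" if "i \<in> I" "k \<in> B" for i k
    using b[of "y i k"] that by auto
  have trivial: "\<forall>j\<le>d. (\<Sum>i\<in>I. fps_const (a j i) * w i) = 0"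
    if inj: "inj_on (\<lambda>(j, \<nu>). of_nat j * \<tau> + \<nu>) ({..d} \<times> \<Lambda>)"
      and rel: "(\<Sum>j\<le>d. (\<Sum>i\<in>I. fps_const (a j i) * w i) * X \<tau> ^ j) = 0" for d \<tau> a
  proof -
    define Z where "Z j k = (\<Sum>i\<in>I. fps_const (a j i) * y i k)" for j k
    define \<beta> where "\<beta> j k \<nu> = (\<Sum>i\<in>I. a j i * b (y i k) \<nu>)" for j k \<nu>
    have Zb: "Z j k = (\<Sum>\<nu>\<in>\<Lambda>. fps_const (\<beta> j k \<nu>) * X \<nu>)" if "k \<in> B" for j k
    proof -
      have "Z j k = (\<Sum>i\<in>I. fps_const (a j i) * (\<Sum>\<nu>\<in>\<Lambda>. fps_const (b (y i k) \<nu>) * X \<nu>))"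
        unfolding Z_def using yb that by (intro sum.cong) auto
      also have "\<dots> = (\<Sum>\<nu>\<in>\<Lambda>. (\<Sum>i\<in>I. fps_const (a j i * b (y i k) \<nu>)) * X \<nu>)"
        unfolding sum_distrib_left sum_distrib_right
        by (subst sum.swap) (simp add: mult.assoc flip: fps_const_mult)
      also have "\<dots> = (\<Sum>\<nu>\<in>\<Lambda>. fps_const (\<beta> j k \<nu>) * X \<nu>)"
        unfolding \<beta>_def fps_const_sum ..
      finally show ?thesis .
    qed
    have ew: "e * (\<Sum>i\<in>I. fps_const (a j i) * w i) = (\<Sum>k\<in>B. Z j k * w k)" for j
    proof -
      have "e * (\<Sum>i\<in>I. fps_const (a j i) * w i) = (\<Sum>i\<in>I. fps_const (a j i) * (\<Sum>k\<in>B. y i k * w k))"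
        unfolding sum_distrib_left[of e]
      proof (rule sum.cong)
        fix i assume "i \<in> I"
        have "e * (fps_const (a j i) * w i) = fps_const (a j i) * (e * w i)" by (simp add: mult_ac)
        then show "e * (fps_const (a j i) * w i) = fps_const (a j i) * (\<Sum>k\<in>B. y i k * w k)"
          unfolding y(2)[OF \<open>i \<in> I\<close>] .
      qed simp
      also have "\<dots> = (\<Sum>k\<in>B. Z j k * w k)"
        unfolding Z_def sum_distrib_left sum_distrib_right by (subst sum.swap) (simp add: mult.assoc)
      finally show ?thesis .
    qed
    have "0 = e * (\<Sum>j\<le>d. (\<Sum>i\<in>I. fps_const (a j i) * w i) * X \<tau> ^ j)" using rel by simp
    also have "\<dots> = (\<Sum>j\<le>d. (\<Sum>k\<in>B. Z j k * w k) * X \<tau> ^ j)"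
      unfolding sum_distrib_left[of e _ "{..d}"] by (simp add: ew flip: mult.assoc)
    also have "\<dots> = (\<Sum>k\<in>B. (\<Sum>j\<le>d. Z j k * X \<tau> ^ j) * w k)"
      unfolding sum_distrib_right by (subst sum.swap) (simp add: mult_ac)
    finally have 0: "(\<Sum>k\<in>B. (\<Sum>j\<le>d. Z j k * X \<tau> ^ j) * w k) = 0" by simp
    have Xpow: "X \<tau> ^ j \<in> ?E" for j using X_power[of j \<tau>] fam_span_base by metis
    have "(\<Sum>j\<le>d. Z j k * X \<tau> ^ j) \<in> ?E" if "k \<in> B" for k
    proof -
      have "Z j k \<in> ?E" for j unfolding Zb[OF that] by (rule fam_spanI[OF \<Lambda>])
      then show ?thesis using Xpow
        by (intro fam_span_sum is_subring_closed(4)[OF is_subring_exponentials])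
    qed
    then have Z0: "(\<Sum>j\<le>d. Z j k * X \<tau> ^ j) = 0" if "k \<in> B" for k
      using ind[OF _ 0 that] by simp
    have "\<beta> j k \<nu> = 0" if k: "k \<in> B" and j: "j \<le> d" and \<nu>: "\<nu> \<in> \<Lambda>" for j k \<nu>
    proof -
      have "(\<Sum>p\<in>{..d} \<times> \<Lambda>. fps_const (\<beta> (fst p) k (snd p)) * X (of_nat (fst p) * \<tau> + snd p))
          = (\<Sum>j\<le>d. \<Sum>\<nu>\<in>\<Lambda>. fps_const (\<beta> j k \<nu>) * X (of_nat j * \<tau> + \<nu>))"
        unfolding sum.cartesian_product by (simp add: case_prod_unfold)
      also have "\<dots> = (\<Sum>j\<le>d. Z j k * X \<tau> ^ j)"
        unfolding Zb[OF k] sum_distrib_right X_add X_power by (simp only: mult_ac)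
      finally have "(\<Sum>p\<in>{..d} \<times> \<Lambda>. fps_const (\<beta> (fst p) k (snd p)) * X (of_nat (fst p) * \<tau> + snd p)) = 0"
        using Z0[OF k] by simp
      then show ?thesis
        using independent[of "{..d} \<times> \<Lambda>" "\<lambda>p. of_nat (fst p) * \<tau> + snd p"
            "\<lambda>p. \<beta> (fst p) k (snd p)" "(j, \<nu>)"] inj \<Lambda> j \<nu>
        by (simp add: case_prod_unfold)
    qed
    then have "Z j k = 0" if "k \<in> B" "j \<le> d" for j k using Zb[OF that(1)] that by simp
    then have "e * (\<Sum>i\<in>I. fps_const (a j i) * w i) = 0" if "j \<le> d" for j
      using ew[of j] that by simp
    then show ?thesis using B(3) by simp
  qed
  show ?thesis by (rule that[OF \<Lambda> trivial])
qed

text \<open>There are only countably many choices for the degree and for the finite set of \<open>W m\<close> occurring in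
  an equation, but uncountably many \<open>\<tau>\<close>. Hence infinitely many \<open>\<tau>\<close> share these data, and one of
  them is generic.\<close>

lemma exponentials_not_all_algebraic:
  fixes W :: "'m::countable \<Rightarrow> complex fps"
  assumes "0 < \<delta>"
  shows "\<exists>\<tau>. cmod \<tau> < \<delta> \<and> \<not> algebraic_over (fam_span W) (X \<tau>)"
proof (rule ccontr)
  assume "\<not> ?thesis"
  then have alg: "algebraic_over (fam_span W) (X \<tau>)" if "cmod \<tau> < \<delta>" for \<tau> using that by blast
  define rel where "rel d M \<tau> \<longleftrightarrow> (\<exists>a. (\<Sum>j\<le>d. (\<Sum>m\<in>M. fps_const (a j m) * W m) * X \<tau> ^ j) = 0 \<and>
      (\<exists>j\<le>d. (\<Sum>m\<in>M. fps_const (a j m) * W m) \<noteq> 0))" for d :: nat and M \<tau>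
  have ex: "\<exists>d M. finite M \<and> rel d M \<tau>" if \<tau>: "cmod \<tau> < \<delta>" for \<tau>
  proof -
    obtain d c where dc: "\<forall>j\<le>d. c j \<in> fam_span W" "\<exists>j\<le>d. c j \<noteq> 0" "(\<Sum>j\<le>d. c j * X \<tau> ^ j) = 0"
      using alg[OF \<tau>] unfolding algebraic_over_def by blast
    obtain M a where M: "finite M" "\<And>y. y \<in> c ` {..d} \<Longrightarrow> y = (\<Sum>m\<in>M. fps_const (a y m) * W m)"
      using fam_span_common_support[of "c ` {..d}" W] dc(1) by auto
    then have cj: "(\<Sum>m\<in>M. fps_const (a (c j) m) * W m) = c j" if "j \<le> d" for j using that by auto
    have "rel d M \<tau>" unfolding rel_def
      using dc cj by (intro exI[of _ "\<lambda>j. a (c j)"]) auto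
    then show ?thesis using M(1) by blast
  qed
  have "uncountable (of_real ` {0<..<\<delta>} :: complex set)"
    using assms uncountable_open_interval[of 0 \<delta>]
      countable_image_inj_eq[of "of_real :: real \<Rightarrow> complex" "{0<..<\<delta>}"] by (simp add: inj_on_def)
  moreover have "of_real ` {0<..<\<delta>} \<subseteq> (\<Union>p\<in>UNIV \<times> {M. finite M}. {\<tau>. rel (fst p) (snd p) \<tau>})"
    using ex by fastforce
  moreover have "countable (UNIV \<times> {M :: 'm set. finite M} :: (nat \<times> 'm set) set)"
    by (intro countable_SIGMA countable_Collect_finite) auto
  ultimately have "\<not> (\<forall>p\<in>UNIV \<times> {M. finite M}. countable {\<tau>. rel (fst p) (snd p) \<tau>})"
    using countable_UN[of "UNIV \<times> {M :: 'm set. finite M}" "\<lambda>p. {\<tau>. rel (fst p) (snd p) \<tau>}"]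
    by (meson countable_subset)
  then obtain d M where dM: "finite M" "uncountable {\<tau>. rel d M \<tau>}" by auto
  obtain \<Lambda> where \<Lambda>: "finite \<Lambda>"
    "\<And>d \<tau> a. inj_on (\<lambda>(j, \<nu>). of_nat j * \<tau> + \<nu>) ({..d} \<times> \<Lambda>) \<Longrightarrow>
       (\<Sum>j\<le>d. (\<Sum>m\<in>M. fps_const (a j m) * W m) * X \<tau> ^ j) = 0 \<Longrightarrow>
       \<forall>j\<le>d. (\<Sum>m\<in>M. fps_const (a j m) * W m) = 0"
    using generic_exponent_no_relation[OF dM(1), of W] by blast
  define bad where "bad = (\<lambda>(j, j', \<nu>, \<mu>). (\<mu> - \<nu>) / (of_nat j - of_nat j')) ` ({..d} \<times> {..d} \<times> \<Lambda> \<times> \<Lambda>)"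
  have "finite bad" unfolding bad_def using \<Lambda>(1) by auto
  then have "\<not> {\<tau>. rel d M \<tau>} \<subseteq> bad" using dM(2) countable_finite countable_subset by blast
  then obtain \<tau> where \<tau>: "rel d M \<tau>" "\<tau> \<notin> bad" by blast
  have "inj_on (\<lambda>(j, \<nu>). of_nat j * \<tau> + \<nu>) ({..d} \<times> \<Lambda>)"
  proof (rule inj_onI, clarsimp)
    fix j j' \<nu> \<mu>
    assume j: "j \<le> d" "j' \<le> d" "\<nu> \<in> \<Lambda>" "\<mu> \<in> \<Lambda>" and eq: "of_nat j * \<tau> + \<nu> = of_nat j' * \<tau> + \<mu>"
    have "j = j'"
    proof (rule ccontr)
      assume "j \<noteq> j'"
      then have "\<tau> = (\<mu> - \<nu>) / (of_nat j - of_nat j')" using eq by (simp add: field_simps)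
      then have "\<tau> \<in> bad" unfolding bad_def using j by force
      then show False using \<tau> by simp
    qed
    then show "j = j' \<and> \<nu> = \<mu>" using eq by simp
  qed
  then show False using \<Lambda>(2) \<tau>(1) unfolding rel_def by blast
qed

end

section \<open>Polynomial functions and specialisation of algebraic equations\<close>

inductive polyfun :: "(complex^'m \<Rightarrow> complex) \<Rightarrow> bool" where
  const: "polyfun (\<lambda>_. c)"
| coord: "polyfun (\<lambda>x. x $ i)"
| add: "polyfun p \<Longrightarrow> polyfun q \<Longrightarrow> polyfun (\<lambda>x. p x + q x)"
| mult: "polyfun p \<Longrightarrow> polyfun q \<Longrightarrow> polyfun (\<lambda>x. p x * q x)"

lemma polyfun_sum:
  assumes "\<And>i. i \<in> A \<Longrightarrow> polyfun (f i)" shows "polyfun (\<lambda>x. \<Sum>i\<in>A. f i x)"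
  using assms by (induction A rule: infinite_finite_induct) (auto intro: polyfun.intros)

lemma polyfun_power: "polyfun f \<Longrightarrow> polyfun (\<lambda>x. f x ^ n)"
  by (induction n) (auto intro: polyfun.intros)

lemma polyfun_prod:
  assumes "\<And>i. i \<in> A \<Longrightarrow> polyfun (f i)" shows "polyfun (\<lambda>x. \<Prod>i\<in>A. f i x)"
  using assms by (induction A rule: infinite_finite_induct) (auto intro: polyfun.intros)

lemma continuous_on_polyfun: "polyfun p \<Longrightarrow> continuous_on S p"
  by (induction rule: polyfun.induct) (auto intro!: continuous_intros)

lemma polyfun_along_line:
  assumes "polyfun p"
  shows "\<exists>m q. (\<forall>k. polyfun (q k)) \<and> (\<forall>k>m. \<forall>x. q k x = 0) \<and>
           (\<forall>x \<alpha>. p (x + \<alpha> *s v) = (\<Sum>k\<le>m. q k x * \<alpha> ^ k))"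
  using assms
proof (induction rule: polyfun.induct)
  case (const c)
  show ?case
    by (rule exI[of _ 0], rule exI[of _ "\<lambda>k x. if k = 0 then c else 0"]) (auto intro: polyfun.intros)
next
  case (coord i)
  have "polyfun (\<lambda>x. if k = 0 then x $ i else if k = 1 then v $ i else 0)" for k :: nat
    by (cases "k = 0") (auto intro: polyfun.intros)
  then show ?case
    by (intro exI[of _ 1] exI[of _ "\<lambda>k x. if k = 0 then x $ i else if k = 1 then v $ i else 0"]) auto
next
  case (add p r)
  obtain m q where q: "\<forall>k. polyfun (q k)" "\<forall>k>m. \<forall>x. q k x = 0"
      "\<forall>x \<alpha>. p (x + \<alpha> *s v) = (\<Sum>k\<le>m. q k x * \<alpha> ^ k)" using add.IH(1) by blast
  obtain n s where s: "\<forall>k. polyfun (s k)" "\<forall>k>n. \<forall>x. s k x = 0"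
      "\<forall>x \<alpha>. r (x + \<alpha> *s v) = (\<Sum>k\<le>n. s k x * \<alpha> ^ k)" using add.IH(2) by blast
  have "(\<Sum>k\<le>m. q k x * \<alpha> ^ k) = (\<Sum>k\<le>max m n. q k x * \<alpha> ^ k)" for x \<alpha>
    using q(2) by (intro sum.mono_neutral_left) auto
  moreover have "(\<Sum>k\<le>n. s k x * \<alpha> ^ k) = (\<Sum>k\<le>max m n. s k x * \<alpha> ^ k)" for x \<alpha>
    using s(2) by (intro sum.mono_neutral_left) auto
  ultimately show ?case
    using q s
    by (intro exI[of _ "max m n"] exI[of _ "\<lambda>k x. q k x + s k x"])
       (auto simp: distrib_right sum.distrib intro: polyfun.intros)
next
  case (mult p r)
  obtain m q where q: "\<forall>k. polyfun (q k)" "\<forall>k>m. \<forall>x. q k x = 0"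
      "\<forall>x \<alpha>. p (x + \<alpha> *s v) = (\<Sum>k\<le>m. q k x * \<alpha> ^ k)" using mult.IH(1) by blast
  obtain n s where s: "\<forall>k. polyfun (s k)" "\<forall>k>n. \<forall>x. s k x = 0"
      "\<forall>x \<alpha>. r (x + \<alpha> *s v) = (\<Sum>k\<le>n. s k x * \<alpha> ^ k)" using mult.IH(2) by blast
  have "q k x * s (l - k) x = 0" if "m + n < l" for k l x
    using q(2) s(2) that by (cases "m < k") auto
  then have "\<forall>l>m + n. \<forall>x. (\<Sum>k\<le>l. q k x * s (l - k) x) = 0"
    by (auto intro!: sum.neutral)
  moreover have "p (x + \<alpha> *s v) * r (x + \<alpha> *s v)
      = (\<Sum>l\<le>m + n. (\<Sum>k\<le>l. q k x * s (l - k) x) * \<alpha> ^ l)" for x \<alpha>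
    using q(2) s(2) unfolding q(3)[rule_format] s(3)[rule_format]
    by (intro polynomial_product) auto
  moreover have "polyfun (\<lambda>x. \<Sum>k\<le>l. q k x * s (l - k) x)" for l
    using q(1) s(1) by (intro polyfun_sum polyfun.mult) auto
  ultimately show ?case
    by (intro exI[of _ "m + n"] exI[of _ "\<lambda>l x. \<Sum>k\<le>l. q k x * s (l - k) x"]) simp
qed

text \<open>Distinct multiplicative functions are linearly independent (Dedekind).\<close>

lemma multiplicative_functions_independent:
  fixes h :: "'m \<Rightarrow> 'g::times \<Rightarrow> 'a::idom"
  assumes "finite M" "inj_on h M"
    and "\<And>m x y. m \<in> M \<Longrightarrow> h m (x * y) = h m x * h m y"
    and "\<And>m. m \<in> M \<Longrightarrow> \<exists>x. h m x \<noteq> 0"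
    and "\<And>x. (\<Sum>m\<in>M. a m * h m x) = 0" and "m \<in> M"
  shows "a m = 0"
  using assms
proof (induction M arbitrary: a m rule: finite_induct)
  case (insert r M)
  have "a q = 0" if q: "q \<in> M" for q
  proof -
    have "h q \<noteq> h r" using insert.prems(1) insert.hyps q by (auto simp: inj_on_def)
    then obtain y where y: "h q y \<noteq> h r y" by auto
    have "(\<Sum>m\<in>M. (a m * (h m y - h r y)) * h m x) = 0" for x
    proof -
      have "(\<Sum>m\<in>M. (a m * (h m y - h r y)) * h m x)
          = (\<Sum>m\<in>insert r M. (a m * (h m y - h r y)) * h m x)" using insert.hyps by simp
      also have "\<dots> = (\<Sum>m\<in>insert r M. a m * h m (x * y)) - h r y * (\<Sum>m\<in>insert r M. a m * h m x)"
        unfolding sum_distrib_left sum_subtractf[symmetric]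
        by (rule sum.cong) (simp_all add: insert.prems(2) algebra_simps)
      finally show ?thesis using insert.prems(4) by simp
    qed
    moreover have "inj_on h M" using insert.prems(1) by simp
    ultimately have "a q * (h q y - h r y) = 0"
      using insert.IH[of "\<lambda>m. a m * (h m y - h r y)" q] insert.prems(2,3) q by blast
    then show ?thesis using y by simp
  qed
  moreover obtain x where x: "h r x \<noteq> 0" using insert.prems(3) by blast
  moreover have "(\<Sum>m\<in>insert r M. a m * h m x) = 0" by (rule insert.prems(4))
  ultimately have "a r = 0" using insert.hyps by simp
  then show ?case using \<open>\<And>q. q \<in> M \<Longrightarrow> a q = 0\<close> insert.prems(5) by blast
qed simp

lemma monomial_functions_independent:
  fixes e :: "'k \<Rightarrow> 'm::finite \<Rightarrow> nat"
  assumes "finite M" "inj_on e M" "\<And>x::complex^'m. (\<Sum>k\<in>M. a k * (\<Prod>i\<in>UNIV. x $ i ^ e k i)) = 0" "k \<in> M"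
  shows "a k = (0::complex)"
proof (rule multiplicative_functions_independent[where h = "\<lambda>k (x::complex^'m). \<Prod>i\<in>UNIV. x $ i ^ e k i"])
  show "inj_on (\<lambda>k (x::complex^'m). \<Prod>i\<in>UNIV. x $ i ^ e k i) M"
  proof (rule inj_onI)
    fix k l assume kl: "k \<in> M" "l \<in> M"
      and eq: "(\<lambda>x::complex^'m. \<Prod>i\<in>UNIV. x $ i ^ e k i) = (\<lambda>x. \<Prod>i\<in>UNIV. x $ i ^ e l i)"
    have val: "(\<Prod>i\<in>UNIV. (\<chi> i. if i = i0 then 2 else (1::complex)) $ i ^ e k i) = 2 ^ e k i0"
      for i0 :: 'm and k
    proof -
      have "(\<Prod>i\<in>UNIV. (\<chi> i. if i = i0 then 2 else (1::complex)) $ i ^ e k i)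
          = (\<Prod>i\<in>UNIV. if i = i0 then 2 ^ e k i0 else (1::complex))"
        by (rule prod.cong) auto
      also have "\<dots> = 2 ^ e k i0" by simp
      finally show ?thesis .
    qed
    have "e k i0 = e l i0" for i0
    proof -
      have "(2::complex) ^ e k i0 = 2 ^ e l i0"
        using fun_cong[OF eq, of "\<chi> i. if i = i0 then 2 else 1"] unfolding val .
      then have "(2::real) ^ e k i0 = 2 ^ e l i0"
        by (metis norm_numeral norm_power)
      then show ?thesis by simp
    qed
    then have "e k = e l" by auto
    then show "k = l" using assms(2) kl by (auto simp: inj_on_def)
  qed
  show "\<exists>x::complex^'m. (\<Prod>i\<in>UNIV. x $ i ^ e k i) \<noteq> 0" for k
    by (rule exI[of _ "\<chi> i. 1"]) simp
qed (use assms in \<open>auto simp: power_mult_distrib prod.distrib\<close>)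

lemma nash_algebraic_coefficients:
  fixes f :: "complex^'m \<Rightarrow> complex"
  assumes "nash_algebraic_on U f"
  obtains d p where "\<And>j. polyfun (p j)" "\<exists>j\<le>d. \<exists>x. p j x \<noteq> 0"
    "\<And>x. x \<in> U \<Longrightarrow> (\<Sum>j\<le>d. p j x * f x ^ j) = 0"
proof -
  obtain P :: "('m option \<Rightarrow>\<^sub>0 nat) \<Rightarrow>\<^sub>0 complex" where P: "P \<noteq> 0"
      "\<And>x. x \<in> U \<Longrightarrow> poly_eval (case_option (f x) (\<lambda>i. x $ i)) P = 0"
    using assms unfolding nash_algebraic_on_def by blast
  let ?l = "\<lambda>m::'m option \<Rightarrow>\<^sub>0 nat. Poly_Mapping.lookup m"
  let ?K = "Poly_Mapping.keys P"
  define mon where "mon m x = (\<Prod>i\<in>UNIV. x $ i ^ ?l m (Some i))" for m and x :: "complex^'m"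
  define p where "p j x = (\<Sum>m | m \<in> ?K \<and> ?l m None = j. Poly_Mapping.lookup P m * mon m x)" for j x
  define d where "d = (\<Sum>m\<in>?K. ?l m None)"
  have le: "?l m None \<le> d" if "m \<in> ?K" for m
    unfolding d_def by (rule member_le_sum) (use that in auto)
  show ?thesis
  proof (rule that[of p d])
    show "polyfun (p j)" for j
      unfolding p_def mon_def by (intro polyfun_sum polyfun.intros polyfun_prod polyfun_power)
    obtain m0 where m0: "m0 \<in> ?K" using P(1) by fastforce
    have inj: "inj_on (\<lambda>m i. ?l m (Some i)) {m. m \<in> ?K \<and> ?l m None = ?l m0 None}"
    proof (rule inj_onI, clarsimp)
      fix m n assume "?l m None = ?l m0 None" "?l n None = ?l m0 None"
        and "(\<lambda>i. ?l m (Some i)) = (\<lambda>i. ?l n (Some i))"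
      then have "?l m v = ?l n v" for v by (cases v) (auto dest: fun_cong)
      then show "m = n" by (rule poly_mapping_eqI)
    qed
    have "\<exists>x. p (?l m0 None) x \<noteq> 0"
    proof (rule ccontr)
      assume "\<nexists>x. p (?l m0 None) x \<noteq> 0"
      then have "Poly_Mapping.lookup P m0 = 0"
        using monomial_functions_independent[OF _ inj, of "Poly_Mapping.lookup P" m0] m0
        unfolding p_def mon_def by simp
      then show False using m0 by (simp add: in_keys_iff)
    qed
    then show "\<exists>j\<le>d. \<exists>x. p j x \<noteq> 0" using le m0 by blast
    fix x assume x: "x \<in> U"
    define a where "a = case_option (f x) (\<lambda>i. x $ i)"
    have prd: "(\<Prod>v\<in>Poly_Mapping.keys m. a v ^ ?l m v) = f x ^ ?l m None * mon m x" for m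
    proof -
      have "(\<Prod>v\<in>Poly_Mapping.keys m. a v ^ ?l m v) = (\<Prod>v\<in>UNIV. a v ^ ?l m v)"
        by (rule prod.mono_neutral_left) (auto simp: in_keys_iff)
      also have "\<dots> = f x ^ ?l m None * mon m x"
        unfolding UNIV_option_conv mon_def
        by (subst prod.insert) (auto simp: a_def prod.reindex)
      finally show ?thesis .
    qed
    have "0 = (\<Sum>m\<in>?K. Poly_Mapping.lookup P m * (f x ^ ?l m None * mon m x))"
      using P(2)[OF x] unfolding poly_eval_def a_def[symmetric] prd by simp
    also have "\<dots> = (\<Sum>j\<le>d. \<Sum>m | m \<in> ?K \<and> ?l m None = j. Poly_Mapping.lookup P m * (f x ^ ?l m None * mon m x))"
      by (rule sum.group[symmetric]) (use le in auto)
    also have "\<dots> = (\<Sum>j\<le>d. p j x * f x ^ j)"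
      unfolding p_def sum_distrib_right by (intro sum.cong) (auto simp: mult_ac)
    finally show "(\<Sum>j\<le>d. p j x * f x ^ j) = 0" by simp
  qed
qed

text \<open>An algebraic equation can degenerate to \<open>0 = 0\<close> when some of its variables are specialised. The
  lowest-order coefficient in a perturbation parameter \<open>\<epsilon>\<close> still gives a non-trivial equation.\<close>

lemma lowest_order_equation:
  fixes c :: "nat \<Rightarrow> nat \<Rightarrow> 't \<Rightarrow> complex" and G :: "complex \<Rightarrow> 't \<Rightarrow> complex"
  assumes nz: "\<exists>j\<le>d. \<exists>k\<le>m. \<exists>t\<in>T'. c j k t \<noteq> 0" and sub: "T \<subseteq> T'"
    and rel: "\<And>t. t \<in> T \<Longrightarrow> \<forall>\<^sub>F \<epsilon> in at 0. (\<Sum>j\<le>d. (\<Sum>k\<le>m. c j k t * \<epsilon> ^ k) * G \<epsilon> t ^ j) = 0"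
    and cont: "\<And>t. t \<in> T \<Longrightarrow> ((\<lambda>\<epsilon>. G \<epsilon> t) \<longlongrightarrow> G 0 t) (at 0)"
  obtains k where "k \<le> m" "\<exists>j\<le>d. \<exists>t\<in>T'. c j k t \<noteq> 0"
    "\<And>t. t \<in> T \<Longrightarrow> (\<Sum>j\<le>d. c j k t * G 0 t ^ j) = 0"
proof -
  define Q where "Q k \<longleftrightarrow> k \<le> m \<and> (\<exists>j\<le>d. \<exists>t\<in>T'. c j k t \<noteq> 0)" for k
  define k where "k = (LEAST k. Q k)"
  have "\<exists>k. Q k" using nz unfolding Q_def by blast
  then have k: "Q k" unfolding k_def by (metis LeastI)
  have low: "c j i t = 0" if "i < k" "j \<le> d" "t \<in> T'" for i j t
  proof -
    have "\<not> Q i" using not_less_Least[of i Q] that(1) unfolding k_def by blast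
    moreover have "i \<le> m" using k that(1) unfolding Q_def by simp
    ultimately show ?thesis using that unfolding Q_def by blast
  qed
  show ?thesis
  proof (rule that[of k])
    show "k \<le> m" "\<exists>j\<le>d. \<exists>t\<in>T'. c j k t \<noteq> 0" using k by (auto simp: Q_def)
    fix t assume t: "t \<in> T"
    define H where "H \<epsilon> = (\<Sum>j\<le>d. (\<Sum>i\<le>m - k. c j (k + i) t * \<epsilon> ^ i) * G \<epsilon> t ^ j)" for \<epsilon>
    have fac: "(\<Sum>i\<le>m. c j i t * \<epsilon> ^ i) = \<epsilon> ^ k * (\<Sum>i\<le>m - k. c j (k + i) t * \<epsilon> ^ i)"
      if "j \<le> d" for j \<epsilon>
    proof -
      have "(\<Sum>i\<le>m. c j i t * \<epsilon> ^ i) = (\<Sum>i\<in>{k..m}. c j i t * \<epsilon> ^ i)"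
        using low that t sub by (intro sum.mono_neutral_right) (auto simp: not_le)
      also have "\<dots> = (\<Sum>i\<le>m - k. c j (k + i) t * \<epsilon> ^ (k + i))"
        using \<open>k \<le> m\<close> by (intro sum.reindex_bij_witness[of _ "\<lambda>i. k + i" "\<lambda>i. i - k"]) auto
      finally show ?thesis by (simp add: sum_distrib_left power_add mult_ac)
    qed
    have "(\<Sum>j\<le>d. (\<Sum>i\<le>m. c j i t * \<epsilon> ^ i) * G \<epsilon> t ^ j) = \<epsilon> ^ k * H \<epsilon>" for \<epsilon>
      unfolding H_def sum_distrib_left[of "\<epsilon> ^ k" _ "{..d}"] by (intro sum.cong refl) (simp add: fac)
    then have "\<forall>\<^sub>F \<epsilon> in at 0. \<epsilon> ^ k * H \<epsilon> = 0" using rel[OF t] by simp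
    then have "\<forall>\<^sub>F \<epsilon> in at 0. H \<epsilon> = 0"
      using eventually_neq_at_within[of 0 0 UNIV] by eventually_elim auto
    then have "(H \<longlongrightarrow> 0) (at 0)" by (rule tendsto_eventually)
    moreover have "(H \<longlongrightarrow> (\<Sum>j\<le>d. (\<Sum>i\<le>m - k. c j (k + i) t * 0 ^ i) * G 0 t ^ j)) (at 0)"
      unfolding H_def using cont[OF t] by (intro tendsto_intros)
    moreover have "(\<Sum>i\<le>m - k. c j (k + i) t * 0 ^ i) = c j k t" for j
    proof -
      have "(\<Sum>i\<le>m - k. c j (k + i) t * 0 ^ i) = (\<Sum>i\<in>{0}. c j (k + i) t * 0 ^ i)"
        by (rule sum.mono_neutral_right) auto
      then show ?thesis by simp
    qed
    ultimately show "(\<Sum>j\<le>d. c j k t * G 0 t ^ j) = 0"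
      using tendsto_unique[OF trivial_limit_at] by fastforce
  qed
qed

section \<open>Quantitative holomorphy in one and several variables\<close>

lemma norm_complex_smult: "norm (c *s (v :: complex^'n)) = cmod c * norm v"
  by (simp add: norm_vec_def norm_mult L2_set_right_distrib)

lemma has_derivative_from_quadratic_bound:
  fixes F :: "'a::real_normed_vector \<Rightarrow> 'b::real_normed_vector"
  assumes T: "bounded_linear T" and "0 < \<delta>"
    and bound: "\<And>v. norm v < \<delta> \<Longrightarrow> norm (F (p + v) - F p - T v) \<le> M * (norm v)\<^sup>2"
  shows "(F has_derivative T) (at p)"
  unfolding has_derivative_at_alt
proof (intro conjI allI impI T)
  fix e :: real assume "0 < e"
  define d where "d = min \<delta> (e / (\<bar>M\<bar> + 1))"
  have "0 < d" using \<open>0 < e\<close> \<open>0 < \<delta>\<close> by (simp add: d_def)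
  moreover have "norm (F y - F p - T (y - p)) \<le> e * norm (y - p)" if y: "norm (y - p) < d" for y
  proof -
    let ?n = "norm (y - p)"
    have "?n \<le> e / (\<bar>M\<bar> + 1)" using y by (simp add: d_def)
    then have "?n * (\<bar>M\<bar> + 1) \<le> e" by (simp add: field_simps)
    moreover have "M * ?n \<le> ?n * (\<bar>M\<bar> + 1)"
      by (subst mult.commute, rule mult_left_mono) auto
    ultimately have "M * ?n * ?n \<le> e * ?n" by (intro mult_right_mono) auto
    then show ?thesis using bound[of "y - p"] y by (simp add: d_def power2_eq_square mult.assoc)
  qed
  ultimately show "\<exists>d>0. \<forall>y. norm (y - p) < d \<longrightarrow> norm (F y - F p - T (y - p)) \<le> e * norm (y - p)"
    by blast
qed

lemma ball_subset_of_center: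
  assumes "dist z y + s \<le> r" shows "ball y s \<subseteq> ball z r"
  using assms dist_triangle[of z _ y] by (auto simp: dist_commute intro: le_less_trans) (smt (verit) dist_commute dist_triangle)

lemma cauchy_deriv_bound:
  assumes hol: "g holomorphic_on ball z r" and C: "\<And>w. w \<in> ball z r \<Longrightarrow> cmod (g w) \<le> C" and r: "0 < r"
  shows "cmod ((deriv ^^ n) g z) \<le> fact n * C / (r / 2) ^ n"
proof (rule Cauchy_inequality)
  show "g holomorphic_on ball z (r / 2)" using hol r by (auto elim: holomorphic_on_subset)
  show "continuous_on (cball z (r / 2)) g"
    using holomorphic_on_imp_continuous_on[OF hol] r by (auto elim!: continuous_on_subset)
  show "cmod (g x) \<le> C" if "cmod (z - x) = r / 2" for x
    using that r by (intro C) (simp add: dist_norm)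
qed (use r in simp)

lemma cauchy_deriv_bound_1:
  assumes "g holomorphic_on ball z r" "\<And>w. w \<in> ball z r \<Longrightarrow> cmod (g w) \<le> C" "0 < r"
  shows "cmod (deriv g z) \<le> 2 * C / r"
  using cauchy_deriv_bound[OF assms, of 1] by (simp add: field_simps)

lemma cauchy_difference_bound:
  assumes hol: "g holomorphic_on ball z r" and C: "\<And>w. w \<in> ball z r \<Longrightarrow> cmod (g w) \<le> C" and r: "0 < r"
    and x: "x \<in> ball z (r / 2)"
  shows "cmod (g x - g z) \<le> 4 * C / r * cmod (x - z)"
proof (rule field_differentiable_bound[where S = "ball z (r / 2)"])
  fix y assume y: "y \<in> ball z (r / 2)"
  have sub: "ball y (r / 2) \<subseteq> ball z r"
    using y by (intro ball_subset_of_center) auto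
  have "g field_differentiable at y"
    using hol y r by (intro holomorphic_on_imp_differentiable_at) auto
  then show "(g has_field_derivative deriv g y) (at y within ball z (r / 2))"
    using field_differentiable_derivI has_field_derivative_at_within by blast
  have "cmod (deriv g y) \<le> 2 * C / (r / 2)"
    using sub r by (intro cauchy_deriv_bound_1 C holomorphic_on_subset[OF hol]) auto
  then show "cmod (deriv g y) \<le> 4 * C / r" by simp
qed (use x r in auto)

lemma cauchy_second_order_bound:
  assumes hol: "g holomorphic_on ball z r" and C: "\<And>w. w \<in> ball z r \<Longrightarrow> cmod (g w) \<le> C" and r: "0 < r"
    and x: "x \<in> ball z (r / 2)"
  shows "cmod (g x - g z - deriv g z * (x - z)) \<le> 32 * C / r\<^sup>2 * (cmod (x - z))\<^sup>2"
proof -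
  have "cmod ((deriv ^^ 0) g x - (\<Sum>i\<le>1. (deriv ^^ i) g z * (x - z) ^ i / fact i))
      \<le> 32 * C / r\<^sup>2 * cmod (x - z) ^ Suc 1 / fact 1"
  proof (rule complex_Taylor[where S = "ball z (r / 2)" and f = "\<lambda>i. (deriv ^^ i) g"])
    fix y assume y: "y \<in> ball z (r / 2)"
    have yr: "y \<in> ball z r" using y r by auto
    show "((deriv ^^ i) g has_field_derivative (deriv ^^ Suc i) g y) (at y within ball z (r / 2))" for i
    proof -
      have "(deriv ^^ i) g holomorphic_on ball z r" by (intro holomorphic_higher_deriv hol) auto
      then have "(deriv ^^ i) g field_differentiable at y"
        using yr by (intro holomorphic_on_imp_differentiable_at) auto
      then show ?thesis using field_differentiable_derivI has_field_derivative_at_within by fastforce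
    qed
    have sub: "ball y (r / 2) \<subseteq> ball z r"
      using y by (intro ball_subset_of_center) auto
    have "cmod ((deriv ^^ 2) g y) \<le> fact 2 * C / (r / 2 / 2) ^ 2"
      using sub r by (intro cauchy_deriv_bound C holomorphic_on_subset[OF hol]) auto
    then show "cmod ((deriv ^^ Suc 1) g y) \<le> 32 * C / r\<^sup>2"
      by (simp add: numeral_2_eq_2 power2_eq_square field_simps)
  qed (use x r in auto)
  then show ?thesis by (simp add: numeral_2_eq_2 algebra_simps)
qed

text \<open>The difference between \<open>k\<close> and its linear part is controlled one variable at a time; the mixed
  term is handled by Cauchy's estimate for \<open>k \<alpha> \<beta> - k \<alpha> b\<close> as a function of \<open>\<alpha>\<close>.\<close>

lemma separately_holomorphic_has_derivative:
  assumes r: "0 < r"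
    and h1: "\<And>\<beta>. \<beta> \<in> ball b r \<Longrightarrow> (\<lambda>\<alpha>. k \<alpha> \<beta>) holomorphic_on ball a r"
    and h2: "\<And>\<alpha>. \<alpha> \<in> ball a r \<Longrightarrow> k \<alpha> holomorphic_on ball b r"
    and C: "\<And>\<alpha> \<beta>. \<alpha> \<in> ball a r \<Longrightarrow> \<beta> \<in> ball b r \<Longrightarrow> cmod (k \<alpha> \<beta>) \<le> C"
  shows "((\<lambda>p. k (fst p) (snd p)) has_derivative
           (\<lambda>p. deriv (\<lambda>\<alpha>. k \<alpha> b) a * fst p + deriv (k a) b * snd p)) (at (a, b))"
proof (rule has_derivative_from_quadratic_bound)
  show "bounded_linear (\<lambda>p. deriv (\<lambda>\<alpha>. k \<alpha> b) a * fst p + deriv (k a) b * snd p)"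
    by (intro bounded_linear_add bounded_linear_mult_right[THEN bounded_linear_compose]
        bounded_linear_fst bounded_linear_snd)
  show "0 < r / 2" using r by simp
  fix v :: "complex \<times> complex" assume v: "norm v < r / 2"
  obtain s t where st: "v = (s, t)" by force
  have ns: "cmod s \<le> norm v" "cmod t \<le> norm v"
    unfolding st using norm_fst_le[of s t] norm_snd_le[of t s] by auto
  have s: "a + s \<in> ball a (r / 2)" and t: "b + t \<in> ball b (r / 2)"
    using ns v by (auto simp: dist_norm)
  have tr: "b + t \<in> ball b r" using t r by auto
  define D where "D \<beta> = deriv (\<lambda>\<alpha>. k \<alpha> \<beta>) a" for \<beta>
  have 1: "cmod (k (a + s) (b + t) - k a (b + t) - D (b + t) * s) \<le> 32 * C / r\<^sup>2 * (cmod s)\<^sup>2"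
    using cauchy_second_order_bound[OF h1[OF tr] C[OF _ tr] r s] by (simp add: D_def)
  have 2: "cmod (k a (b + t) - k a b - deriv (k a) b * t) \<le> 32 * C / r\<^sup>2 * (cmod t)\<^sup>2"
    using cauchy_second_order_bound[OF h2 C r t, of a] r by simp
  have d: "(\<lambda>\<alpha>. k \<alpha> \<beta>) field_differentiable at a" if "\<beta> \<in> ball b r" for \<beta>
    using h1[OF that] r by (intro holomorphic_on_imp_differentiable_at) auto
  have "cmod (deriv (\<lambda>\<alpha>. k \<alpha> (b + t) - k \<alpha> b) a) \<le> 2 * (4 * C / r * cmod t) / r"
  proof (rule cauchy_deriv_bound_1[OF _ _ r])
    show "(\<lambda>\<alpha>. k \<alpha> (b + t) - k \<alpha> b) holomorphic_on ball a r"
      using h1[OF tr] h1[of b] r by (intro holomorphic_intros) auto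
    fix \<alpha> assume \<alpha>: "\<alpha> \<in> ball a r"
    show "cmod (k \<alpha> (b + t) - k \<alpha> b) \<le> 4 * C / r * cmod t"
      using cauchy_difference_bound[OF h2[OF \<alpha>] C[OF \<alpha>] r t] by simp
  qed
  moreover have "deriv (\<lambda>\<alpha>. k \<alpha> (b + t) - k \<alpha> b) a = D (b + t) - D b"
    unfolding D_def by (rule deriv_diff) (use d tr r in auto)
  ultimately have 3: "cmod ((D (b + t) - D b) * s) \<le> 8 * C / r\<^sup>2 * cmod t * cmod s"
    using mult_right_mono[OF _ norm_ge_zero[of s], of "cmod (D (b + t) - D b)" "8 * C / r\<^sup>2 * cmod t"]
    by (simp add: norm_mult power2_eq_square)
  have C0: "0 \<le> C" using C[of a b] r by (auto intro: order_trans[OF norm_ge_zero])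
  have "cmod (k (a + s) (b + t) - k a b - (D b * s + deriv (k a) b * t))
      = cmod ((k (a + s) (b + t) - k a (b + t) - D (b + t) * s) + (D (b + t) - D b) * s
          + (k a (b + t) - k a b - deriv (k a) b * t))"
    by (simp add: algebra_simps)
  also have "\<dots> \<le> 32 * C / r\<^sup>2 * (cmod s)\<^sup>2 + 8 * C / r\<^sup>2 * cmod t * cmod s + 32 * C / r\<^sup>2 * (cmod t)\<^sup>2"
    using 1 2 3 by (intro norm_triangle_mono)
  also have "\<dots> \<le> 32 * C / r\<^sup>2 * (norm v)\<^sup>2 + 8 * C / r\<^sup>2 * norm v * norm v + 32 * C / r\<^sup>2 * (norm v)\<^sup>2"
    using ns C0 by (intro add_mono mult_mono power_mono mult_nonneg_nonneg) auto
  also have "\<dots> = 72 * C / r\<^sup>2 * (norm v)\<^sup>2" by (simp add: power2_eq_square)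
  finally show "cmod (k (fst ((a, b) + v)) (snd ((a, b) + v)) - k (fst (a, b)) (snd (a, b))
        - (deriv (\<lambda>\<alpha>. k \<alpha> b) a * fst v + deriv (k a) b * snd v)) \<le> 72 * C / r\<^sup>2 * (norm v)\<^sup>2"
    by (simp add: st D_def)
qed

lemma separately_holomorphic_compose:
  assumes r: "0 < r"
    and h1: "\<And>\<beta>. \<beta> \<in> ball b r \<Longrightarrow> (\<lambda>\<alpha>. k \<alpha> \<beta>) holomorphic_on ball a r"
    and h2: "\<And>\<alpha>. \<alpha> \<in> ball a r \<Longrightarrow> k \<alpha> holomorphic_on ball b r"
    and C: "\<And>\<alpha> \<beta>. \<alpha> \<in> ball a r \<Longrightarrow> \<beta> \<in> ball b r \<Longrightarrow> cmod (k \<alpha> \<beta>) \<le> C"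
    and "(f has_derivative f') (at x within S)" "(g has_derivative g') (at x within S)"
    and ab: "f x = a" "g x = b"
  shows "((\<lambda>x. k (f x) (g x)) has_derivative
           (\<lambda>v. deriv (\<lambda>\<alpha>. k \<alpha> b) a * f' v + deriv (k a) b * g' v)) (at x within S)"
proof -
  have "((\<lambda>x. (f x, g x)) has_derivative (\<lambda>v. (f' v, g' v))) (at x within S)"
    using assms(5,6) by (rule has_derivative_Pair)
  moreover have "((\<lambda>p. k (fst p) (snd p)) has_derivative
      (\<lambda>p. deriv (\<lambda>\<alpha>. k \<alpha> b) a * fst p + deriv (k a) b * snd p)) (at (f x, g x))"
    unfolding ab by (rule separately_holomorphic_has_derivative[OF r h1 h2 C])
  ultimately show ?thesis using has_derivative_compose by fastforce
qed

text \<open>In the coordinates \<open>x = (\<alpha> + \<beta>)/2\<close>, \<open>y = (\<alpha> - \<beta>)/2\<i>\<close> the points \<open>(t, cnj t)\<close> are those with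
  real \<open>x\<close> and \<open>y\<close>, and the identity theorem applies to each of these variables in turn.\<close>

lemma polarisation:
  assumes r: "0 < r"
    and h1: "\<And>\<beta>. \<beta> \<in> ball 0 r \<Longrightarrow> (\<lambda>\<alpha>. k \<alpha> \<beta>) holomorphic_on ball 0 r"
    and h2: "\<And>\<alpha>. \<alpha> \<in> ball 0 r \<Longrightarrow> k \<alpha> holomorphic_on ball 0 r"
    and C: "\<And>\<alpha> \<beta>. \<alpha> \<in> ball 0 r \<Longrightarrow> \<beta> \<in> ball 0 r \<Longrightarrow> cmod (k \<alpha> \<beta>) \<le> C"
    and diag: "\<And>t. t \<in> ball 0 r \<Longrightarrow> k t (cnj t) = 0"
    and \<alpha>\<beta>: "\<alpha> \<in> ball 0 (r / 2)" "\<beta> \<in> ball 0 (r / 2)"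
  shows "k \<alpha> \<beta> = 0"
proof -
  define h where "h x y = k (x + \<i> * y) (x - \<i> * y)" for x y
  let ?B = "ball (0::complex) (r / 2)"
  have dom: "x + \<i> * y \<in> ball 0 r" "x - \<i> * y \<in> ball 0 r" if "x \<in> ?B" "y \<in> ?B" for x y
  proof -
    have "cmod x + cmod (\<i> * y) < r" using that by (simp add: norm_mult)
    then show "x + \<i> * y \<in> ball 0 r" "x - \<i> * y \<in> ball 0 r"
      using norm_triangle_ineq[of x "\<i> * y"] norm_triangle_ineq4[of x "\<i> * y"] by auto
  qed
  have diff: "(\<lambda>w. k (a + c * w) (b + d * w)) field_differentiable at w"
    if ab: "a + c * w \<in> ball 0 r" "b + d * w \<in> ball 0 r" for a b c d w
  proof -
    define s where "s = min (r - cmod (a + c * w)) (r - cmod (b + d * w))"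
    have s: "0 < s" using ab by (simp add: s_def)
    have sub: "ball (a + c * w) s \<subseteq> ball 0 r" "ball (b + d * w) s \<subseteq> ball 0 r"
      by (auto simp: s_def intro!: ball_subset_of_center)
    have "((\<lambda>w. k (a + c * w) (b + d * w)) has_derivative
        (\<lambda>v. deriv (\<lambda>\<alpha>. k \<alpha> (b + d * w)) (a + c * w) * (c * v) + deriv (k (a + c * w)) (b + d * w) * (d * v))) (at w)"
      using sub s
      by (intro separately_holomorphic_compose[where r = s and C = C])
         (auto intro!: h1[THEN holomorphic_on_subset] h2[THEN holomorphic_on_subset] C derivative_eq_intros)
    then have "((\<lambda>w. k (a + c * w) (b + d * w)) has_field_derivative
        (deriv (\<lambda>\<alpha>. k \<alpha> (b + d * w)) (a + c * w) * c + deriv (k (a + c * w)) (b + d * w) * d)) (at w)"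
      by (rule has_derivative_imp_has_field_derivative) (simp add: algebra_simps)
    then show ?thesis unfolding field_differentiable_def by blast
  qed
  have hx: "(\<lambda>x. h x y) holomorphic_on ?B" if "y \<in> ?B" for y
    unfolding h_def
  proof (rule holomorphic_onI, rule field_differentiable_at_within)
    fix x assume "x \<in> ?B"
    then show "(\<lambda>x. k (x + \<i> * y) (x - \<i> * y)) field_differentiable at x"
      using diff[of "\<i> * y" 1 x "- \<i> * y" 1] dom[of x y] that by (simp add: add.commute)
  qed
  have hy: "(\<lambda>y. h x y) holomorphic_on ?B" if "x \<in> ?B" for x
    unfolding h_def
  proof (rule holomorphic_onI, rule field_differentiable_at_within)
    fix y assume "y \<in> ?B"
    then show "(\<lambda>y. k (x + \<i> * y) (x - \<i> * y)) field_differentiable at y"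
      using diff[of x \<i> y x "- \<i>"] dom[of x y] that by simp
  qed
  have lim: "(0::complex) islimpt (of_real ` {0<..<r / 2})"
    unfolding islimpt_approachable
  proof (intro allI impI)
    fix e :: real assume "0 < e"
    then show "\<exists>x'\<in>of_real ` {0<..<r / 2}. x' \<noteq> (0::complex) \<and> dist x' 0 < e"
      using r by (intro bexI[of _ "of_real (min (e / 2) (r / 4))"]) auto
  qed
  have sub: "of_real ` {0<..<r / 2} \<subseteq> ?B" by auto
  have real: "h (of_real x) (of_real y) = 0" if "x \<in> {0<..<r / 2}" "y \<in> {0<..<r / 2}" for x y
  proof -
    have "of_real x - \<i> * of_real y = cnj (of_real x + \<i> * of_real y)" by simp
    then show ?thesis
      unfolding h_def using diag[OF dom(1), of "of_real x" "of_real y"] that by simp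
  qed
  have x: "h x (of_real y) = 0" if "x \<in> ?B" "y \<in> {0<..<r / 2}" for x y
    by (rule analytic_continuation[OF hx _ _ sub _ lim _ that(1)]) (use that real r in auto)
  have xy: "h x y = 0" if "x \<in> ?B" "y \<in> ?B" for x y
    by (rule analytic_continuation[OF hy _ _ sub _ lim _ that(2)]) (use that x r in auto)
  have "cmod (\<alpha> + \<beta>) < r" "cmod (\<alpha> - \<beta>) < r"
    using \<alpha>\<beta> norm_triangle_ineq[of \<alpha> \<beta>] norm_triangle_ineq4[of \<alpha> \<beta>] by auto
  then have "h ((\<alpha> + \<beta>) / 2) ((\<alpha> - \<beta>) / (2 * \<i>)) = 0"
    by (intro xy) (simp_all add: norm_divide norm_mult)
  moreover have "(\<alpha> + \<beta>) / 2 + \<i> * ((\<alpha> - \<beta>) / (2 * \<i>)) = \<alpha>" "(\<alpha> + \<beta>) / 2 - \<i> * ((\<alpha> - \<beta>) / (2 * \<i>)) = \<beta>"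
    by (simp_all add: field_simps)
  ultimately show ?thesis unfolding h_def by simp
qed

section \<open>Holomorphic functions of several variables\<close>

definition dir_deriv :: "(complex^'n \<Rightarrow> complex) \<Rightarrow> complex^'n \<Rightarrow> complex^'n \<Rightarrow> complex" where
  "dir_deriv f v z = deriv (\<lambda>\<zeta>. f (z + \<zeta> *s v)) 0"

lemma of_real_smult: "complex_of_real c *s v = c *\<^sub>R v"
  by (simp add: vec_eq_iff scaleR_conv_of_real[where 'a = complex])

lemma bounded_linear_smult: "bounded_linear (\<lambda>\<zeta>. \<zeta> *s (v :: complex^'n))"
proof (rule bounded_linear_intro[where K = "norm v"])
  show "(x + y) *s v = x *s v + y *s v" for x y by (rule vector_sadd_rdistrib)
  show "(c *\<^sub>R x) *s v = c *\<^sub>R (x *s v)" for c x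
    by (simp add: vec_eq_iff)
  show "norm (x *s v) \<le> norm x * norm v" for x
    by (simp add: norm_complex_smult)
qed

lemma has_derivative_vecI:
  fixes \<gamma> :: "'a::real_normed_vector \<Rightarrow> complex^'n"
  assumes "\<And>i. ((\<lambda>t. \<gamma> t $ i) has_derivative (\<lambda>h. \<gamma>' h $ i)) (at t within S)"
  shows "(\<gamma> has_derivative \<gamma>') (at t within S)"
proof (subst has_derivative_componentwise_within, rule ballI)
  fix b :: "complex^'n" assume "b \<in> Basis"
  then obtain i u where b: "b = axis i u" unfolding Basis_vec_def by blast
  show "((\<lambda>x. \<gamma> x \<bullet> b) has_derivative (\<lambda>x. \<gamma>' x \<bullet> b)) (at t within S)"
    unfolding b inner_axis by (intro has_derivative_inner_left assms)
qed

lemma holo_on_subset: "holo_on f U \<Longrightarrow> V \<subseteq> U \<Longrightarrow> holo_on f V"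
  unfolding holo_on_def by blast

lemma holo_on_dir_deriv_linear:
  assumes "holo_on f U" "z \<in> U"
  shows "(f has_derivative (\<lambda>v. dir_deriv f v z)) (at z)" "dir_deriv f (c *s v) z = c * dir_deriv f v z"
proof -
  obtain f' where f': "(f has_derivative f') (at z)" "\<And>c v. f' (c *s v) = c * f' v"
    using assms unfolding holo_on_def by blast
  have "dir_deriv f v z = f' v" for v
  proof -
    have "((\<lambda>\<zeta>. z + \<zeta> *s v) has_derivative (\<lambda>\<zeta>. \<zeta> *s v)) (at 0)"
      by (rule has_derivative_eq_rhs, rule has_derivative_add[OF has_derivative_const
            bounded_linear_imp_has_derivative[OF bounded_linear_smult]]) simp
    then have "((\<lambda>\<zeta>. f (z + \<zeta> *s v)) has_derivative (\<lambda>\<zeta>. f' (\<zeta> *s v))) (at 0)"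
      by (rule has_derivative_compose) (simp add: f')
    then have "((\<lambda>\<zeta>. f (z + \<zeta> *s v)) has_field_derivative f' v) (at 0)"
      by (rule has_derivative_imp_has_field_derivative) (simp add: f' mult.commute)
    then show ?thesis unfolding dir_deriv_def by (rule DERIV_imp_deriv)
  qed
  then have "(\<lambda>v. dir_deriv f v z) = f'" by auto
  with f' show "(f has_derivative (\<lambda>v. dir_deriv f v z)) (at z)"
    "dir_deriv f (c *s v) z = c * dir_deriv f v z" by (simp_all add: fun_eq_iff)
qed

lemma dir_deriv_sum:
  assumes "holo_on f U" "z \<in> U"
  shows "dir_deriv f (\<Sum>i\<in>I. v i) z = (\<Sum>i\<in>I. dir_deriv f (v i) z)"
  using linear_sum[OF bounded_linear.linear[OF has_derivative_bounded_linear[OF holo_on_dir_deriv_linear(1)[OF assms]]]]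
  by simp

lemma dir_deriv_coordinates:
  assumes "holo_on f U" "z \<in> U"
  shows "dir_deriv f v z = (\<Sum>i\<in>UNIV. v $ i * dir_deriv f (axis i 1) z)"
proof -
  have "v = (\<Sum>i\<in>UNIV. v $ i *s axis i 1)"
    by (simp add: vec_eq_iff axis_def if_distrib cong: if_cong)
  then have "dir_deriv f v z = (\<Sum>i\<in>UNIV. dir_deriv f (v $ i *s axis i 1) z)"
    using dir_deriv_sum[OF assms, of "\<lambda>i. v $ i *s axis i 1" UNIV] by simp
  then show ?thesis by (simp add: holo_on_dir_deriv_linear(2)[OF assms])
qed

lemma holo_on_chain:
  assumes f: "holo_on f U" and t: "\<gamma> t \<in> U"
    and \<gamma>: "\<And>i. ((\<lambda>t. \<gamma> t $ i) has_field_derivative \<gamma>' $ i) (at t)"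
  shows "((\<lambda>t. f (\<gamma> t)) has_field_derivative dir_deriv f \<gamma>' (\<gamma> t)) (at t)"
proof -
  have "(\<gamma> has_derivative (\<lambda>h. h *s \<gamma>')) (at t)"
    by (intro has_derivative_vecI has_derivative_eq_rhs[OF \<gamma>[unfolded has_field_derivative_def]])
       (simp add: fun_eq_iff mult.commute)
  then have "((\<lambda>t. f (\<gamma> t)) has_derivative (\<lambda>h. dir_deriv f (h *s \<gamma>') (\<gamma> t))) (at t)"
    by (rule has_derivative_compose) (rule holo_on_dir_deriv_linear(1)[OF f t])
  then show ?thesis
    by (rule has_derivative_imp_has_field_derivative) (simp add: holo_on_dir_deriv_linear(2)[OF f t] mult.commute)
qed

lemma holo_on_line:
  assumes f: "holo_on f U" and z: "z + \<zeta> *s v \<in> U"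
  shows "((\<lambda>\<zeta>. f (z + \<zeta> *s v)) has_field_derivative dir_deriv f v (z + \<zeta> *s v)) (at \<zeta>)"
  by (rule holo_on_chain[where \<gamma> = "\<lambda>\<zeta>. z + \<zeta> *s v" and U = U])
     (use f z in \<open>auto intro!: derivative_eq_intros\<close>)

lemma holo_on_continuous_on: "holo_on f U \<Longrightarrow> continuous_on U f"
  by (meson continuous_at_imp_continuous_on has_derivative_continuous holo_on_dir_deriv_linear(1))

lemma holo_on_const: "holo_on (\<lambda>_. c) U"
  unfolding holo_on_def by (intro ballI exI[of _ "\<lambda>_. 0"]) auto

lemma holo_on_coord: "holo_on (\<lambda>z. z $ i) U"
  unfolding holo_on_def
  by (intro ballI exI[of _ "\<lambda>v. v $ i"])
     (auto intro!: bounded_linear_imp_has_derivative bounded_linear_vec_nth)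

lemma holo_on_diff:
  assumes "holo_on f U" "holo_on g U" shows "holo_on (\<lambda>z. f z - g z) U"
  unfolding holo_on_def
proof
  fix z assume "z \<in> U"
  then show "\<exists>f'. ((\<lambda>z. f z - g z) has_derivative f') (at z) \<and> (\<forall>c v. f' (c *s v) = c * f' v)"
    using assms by (intro exI[of _ "\<lambda>v. dir_deriv f v z - dir_deriv g v z"])
      (auto intro!: has_derivative_diff simp: holo_on_dir_deriv_linear algebra_simps)
qed

lemma holo_on_mult:
  assumes "holo_on f U" "holo_on g U" shows "holo_on (\<lambda>z. f z * g z) U"
  unfolding holo_on_def
proof
  fix z assume "z \<in> U"
  note z = holo_on_dir_deriv_linear[OF assms(1) this] holo_on_dir_deriv_linear[OF assms(2) this]
  have "((\<lambda>z. f z * g z) has_derivative (\<lambda>v. f z * dir_deriv g v z + dir_deriv f v z * g z)) (at z)"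
    by (rule has_derivative_mult[OF z(1,3)])
  then show "\<exists>f'. ((\<lambda>z. f z * g z) has_derivative f') (at z) \<and> (\<forall>c v. f' (c *s v) = c * f' v)"
    by (intro exI[of _ "\<lambda>v. f z * dir_deriv g v z + dir_deriv f v z * g z"] conjI)
       (simp_all add: z(2,4) algebra_simps)
qed

lemma holo_on_cmult: "holo_on f U \<Longrightarrow> holo_on (\<lambda>z. c * f z) U"
  by (intro holo_on_mult holo_on_const)

lemma holo_on_translate:
  assumes "holo_on f U" "\<And>z. z \<in> V \<Longrightarrow> z + a \<in> U" shows "holo_on (\<lambda>z. f (z + a)) V"
  unfolding holo_on_def
proof
  fix z assume "z \<in> V"
  then have za: "z + a \<in> U" by (rule assms(2))
  have "((\<lambda>z. f (z + a)) has_derivative (\<lambda>v. dir_deriv f v (z + a))) (at z)"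
    by (rule has_derivative_compose[where f = "\<lambda>z. z + a" and f' = "\<lambda>v. v"])
       (auto intro!: derivative_eq_intros holo_on_dir_deriv_linear(1)[OF assms(1) za])
  then show "\<exists>f'. ((\<lambda>z. f (z + a)) has_derivative f') (at z) \<and> (\<forall>c v. f' (c *s v) = c * f' v)"
    using holo_on_dir_deriv_linear(2)[OF assms(1) za] by blast
qed

text \<open>Cauchy's estimates along the complex line through \<open>z\<close> in direction \<open>v\<close>, uniform in \<open>z\<close>.\<close>

context
  fixes g :: "complex^'n \<Rightarrow> complex" and q v z :: "complex^'n" and r C \<rho> :: real
  assumes g: "holo_on g (ball q r)" and C: "\<And>x. x \<in> ball q r \<Longrightarrow> cmod (g x) \<le> C" and r: "0 < r"
    and z: "z \<in> ball q (r / 2)" and \<rho>: "\<rho> = r / 2 / (norm v + 1)"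
begin

lemma line_radius_pos: "0 < \<rho>"
  using r \<rho> by (simp add: add_nonneg_pos)

lemma line_in_ball: "\<zeta> \<in> ball 0 \<rho> \<Longrightarrow> z + \<zeta> *s v \<in> ball q r"
proof -
  assume "\<zeta> \<in> ball 0 \<rho>"
  then have "cmod \<zeta> * (norm v + 1) < r / 2"
    unfolding \<rho> using pos_less_divide_eq[of "norm v + 1" "cmod \<zeta>" "r / 2"] by (simp add: add_nonneg_pos)
  moreover have "cmod \<zeta> * norm v \<le> cmod \<zeta> * (norm v + 1)" by (intro mult_left_mono) auto
  ultimately have "norm (\<zeta> *s v) < r / 2" by (simp add: norm_complex_smult)
  moreover have "dist q z < r / 2" using z by simp
  ultimately show ?thesis
    using norm_triangle_ineq4[of "q - z" "\<zeta> *s v"] by (simp add: dist_norm diff_diff_eq)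
qed

lemma line_holomorphic: "(\<lambda>\<zeta>. g (z + \<zeta> *s v)) holomorphic_on ball 0 \<rho>"
proof (rule holomorphic_onI)
  fix \<zeta> :: complex assume "\<zeta> \<in> ball 0 \<rho>"
  then have "((\<lambda>\<zeta>. g (z + \<zeta> *s v)) has_field_derivative dir_deriv g v (z + \<zeta> *s v)) (at \<zeta>)"
    by (intro holo_on_line[OF g] line_in_ball)
  then show "(\<lambda>\<zeta>. g (z + \<zeta> *s v)) field_differentiable at \<zeta> within ball 0 \<rho>"
    unfolding field_differentiable_def using has_field_derivative_at_within by blast
qed

lemma line_bounded: "\<zeta> \<in> ball 0 \<rho> \<Longrightarrow> cmod (g (z + \<zeta> *s v)) \<le> C"
  by (intro C line_in_ball)

lemma dir_deriv_bound: "cmod (dir_deriv g v z) \<le> 2 * C / \<rho>"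
  unfolding dir_deriv_def
  by (rule cauchy_deriv_bound_1[OF line_holomorphic line_bounded line_radius_pos])

lemma difference_quotient_bound:
  assumes "h \<noteq> 0" "cmod h < \<rho> / 2"
  shows "cmod ((g (z + h *s v) - g z) / h) \<le> 4 * C / \<rho>"
  using cauchy_difference_bound[OF line_holomorphic line_bounded line_radius_pos, of h] assms
  by (simp add: norm_divide divide_le_eq)

lemma difference_quotient_limit:
  fixes h :: "nat \<Rightarrow> complex"
  assumes "\<And>n. h n \<noteq> 0" "h \<longlonglongrightarrow> 0"
  shows "(\<lambda>n. (g (z + h n *s v) - g z) / h n) \<longlonglongrightarrow> dir_deriv g v z"
proof -
  have "z \<in> ball q r" using z r by auto
  then have "((\<lambda>\<zeta>. g (z + \<zeta> *s v)) has_field_derivative dir_deriv g v z) (at 0)"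
    using holo_on_line[OF g, of z 0 v] by simp
  then have "((\<lambda>\<zeta>. (g (z + \<zeta> *s v) - g z) / \<zeta>) \<longlongrightarrow> dir_deriv g v z) (at 0)"
    by (simp add: has_field_derivative_iff)
  then show ?thesis
    by (rule filterlim_compose) (use assms in \<open>auto simp: filterlim_at\<close>)
qed

end

text \<open>For a uniformly bounded family of holomorphic functions the second-order Taylor remainder is
  bounded uniformly. Pointwise convergence of the functions therefore forces convergence of their
  derivatives at a point, and the remainder bound passes to the limit.\<close>

lemma bounded_pointwise_limit_differentiable:
  fixes f :: "nat \<Rightarrow> complex^'n \<Rightarrow> complex"
  assumes r: "0 < r" and f: "\<And>n. holo_on (f n) (ball p r)"
    and C: "\<And>n z. z \<in> ball p r \<Longrightarrow> cmod (f n z) \<le> C"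
    and lim: "\<And>z. z \<in> ball p r \<Longrightarrow> (\<lambda>n. f n z) \<longlonglongrightarrow> F z"
  shows "\<exists>T. (F has_derivative T) (at p) \<and> (\<forall>c v. T (c *s v) = c * T v)"
proof -
  define M where "M = 32 * C / r\<^sup>2"
  define A where "A n v = dir_deriv (f n) v p" for n v
  have pU: "p \<in> ball p r" using r by simp
  have A_smult: "A n (c *s v) = c * A n v" for n c v
    unfolding A_def by (rule holo_on_dir_deriv_linear(2)[OF f pU])
  have A_blin: "bounded_linear (A n)" for n
    unfolding A_def by (rule has_derivative_bounded_linear[OF holo_on_dir_deriv_linear(1)[OF f pU]])
  have Q: "cmod (f n (p + v) - f n p - A n v) \<le> M * (norm v)\<^sup>2" if v: "norm v < r / 2" for n v
  proof (cases "v = 0")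
    case True
    then show ?thesis using A_smult[of n 0 v] by simp
  next
    case False
    define u where "u = complex_of_real (1 / norm v) *s v"
    have nu: "norm u = 1" using False by (simp add: u_def norm_complex_smult norm_divide)
    have vu: "v = complex_of_real (norm v) *s u" using False by (simp add: u_def vec_eq_iff)
    have inb: "p + \<zeta> *s u \<in> ball p r" if "\<zeta> \<in> ball 0 r" for \<zeta>
      using that by (simp add: dist_norm norm_complex_smult nu)
    have "(\<lambda>\<zeta>. f n (p + \<zeta> *s u)) holomorphic_on ball 0 r"
    proof (rule holomorphic_onI)
      fix \<zeta> :: complex assume "\<zeta> \<in> ball 0 r"
      from holo_on_line[OF f inb[OF this], of n]
      show "(\<lambda>\<zeta>. f n (p + \<zeta> *s u)) field_differentiable at \<zeta> within ball 0 r"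
        unfolding field_differentiable_def using has_field_derivative_at_within by blast
    qed
    from cauchy_second_order_bound[OF this C[OF inb] r, of "of_real (norm v)"] v
    have "cmod (f n (p + v) - f n p - A n u * of_real (norm v)) \<le> M * (norm v)\<^sup>2"
      by (simp add: vu[symmetric] A_def dir_deriv_def M_def)
    moreover have "A n v = A n u * of_real (norm v)"
      by (subst vu) (simp add: A_smult mult.commute)
    ultimately show ?thesis by simp
  qed
  have "Cauchy (\<lambda>n. A n v)" for v
  proof (rule metric_CauchyI)
    fix e :: real assume e: "0 < e"
    define N where "N = \<bar>M\<bar> * (norm v)\<^sup>2 + 1"
    define s where "s = min (e / (4 * N)) (r / 4 / (norm v + 1))"
    have N: "0 < N" by (simp add: N_def add_nonneg_pos)
    have s: "0 < s" using e r N by (simp add: s_def add_nonneg_pos)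
    have n1: "0 < norm v + 1" by (simp add: add_nonneg_pos)
    have "s \<le> r / 4 / (norm v + 1)" unfolding s_def by (rule min.cobounded2)
    then have "s * (norm v + 1) \<le> r / 4" by (simp only: pos_le_divide_eq[OF n1])
    then have sv: "norm (of_real s *s v) < r / 2"
      using s r by (simp add: norm_complex_smult algebra_simps)
    have in1: "p + of_real s *s v \<in> ball p r" using sv r by (simp add: dist_norm)
    obtain N1 where N1: "\<And>m n. m \<ge> N1 \<Longrightarrow> n \<ge> N1 \<Longrightarrow> dist (f m (p + of_real s *s v)) (f n (p + of_real s *s v)) < s * e / 4"
      using metric_CauchyD[OF LIMSEQ_imp_Cauchy[OF lim[OF in1]], of "s * e / 4"] s e by auto
    obtain N2 where N2: "\<And>m n. m \<ge> N2 \<Longrightarrow> n \<ge> N2 \<Longrightarrow> dist (f m p) (f n p) < s * e / 4"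
      using metric_CauchyD[OF LIMSEQ_imp_Cauchy[OF lim[OF pU]], of "s * e / 4"] s e by auto
    have "dist (A m v) (A n v) < e" if mn: "m \<ge> max N1 N2" "n \<ge> max N1 N2" for m n
    proof -
      let ?w = "of_real s *s v :: complex^'n"
      define R where "R k = f k (p + ?w) - f k p - A k ?w" for k
      have R: "cmod (R k) \<le> s * (e / 4)" for k
      proof -
        have "cmod (R k) \<le> M * (norm ?w)\<^sup>2" unfolding R_def by (rule Q[OF sv])
        also have "\<dots> = s * (s * (M * (norm v)\<^sup>2))"
          using s by (simp add: norm_complex_smult power2_eq_square)
        also have "\<dots> \<le> s * (s * N)"
        proof -
          have "M * (norm v)\<^sup>2 \<le> \<bar>M\<bar> * (norm v)\<^sup>2" by (intro mult_right_mono) auto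
          then have "M * (norm v)\<^sup>2 \<le> N" unfolding N_def by linarith
          then show ?thesis using s by (intro mult_left_mono) auto
        qed
        also have "s * N \<le> e / 4"
        proof -
          have "s \<le> e / (4 * N)" unfolding s_def by (rule min.cobounded1)
          then show ?thesis using N by (simp add: field_simps)
        qed
        finally show ?thesis using s by simp
      qed
      have "of_real s * (A m v - A n v)
          = (f m (p + ?w) - f n (p + ?w)) - (f m p - f n p) - (R m - R n)"
        by (simp add: R_def A_smult algebra_simps)
      then have "s * cmod (A m v - A n v)
          = cmod ((f m (p + ?w) - f n (p + ?w)) - (f m p - f n p) - (R m - R n))"
        using s by (metis abs_of_pos norm_mult norm_of_real)
      also have "\<dots> \<le> cmod (f m (p + ?w) - f n (p + ?w)) + cmod (f m p - f n p) + (cmod (R m) + cmod (R n))"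
        by (intro order_trans[OF norm_triangle_ineq4] add_mono order_refl norm_triangle_ineq4)
      also have "\<dots> < s * e / 4 + s * e / 4 + (s * (e / 4) + s * (e / 4))"
        using N1[of m n] N2[of m n] mn R[of m] R[of n] unfolding dist_norm by linarith
      also have "\<dots> = s * e" by simp
      finally show ?thesis using s by (simp add: dist_norm)
    qed
    then show "\<exists>K. \<forall>m\<ge>K. \<forall>n\<ge>K. dist (A m v) (A n v) < e" by blast
  qed
  then have "\<forall>v. \<exists>L. (\<lambda>n. A n v) \<longlonglongrightarrow> L" using Cauchy_convergent unfolding convergent_def by blast
  then obtain T where T: "\<And>v. (\<lambda>n. A n v) \<longlonglongrightarrow> T v" by metis
  have T_smult: "T (c *s v) = c * T v" for c v
    using LIMSEQ_unique[OF T[of "c *s v"]] tendsto_mult[OF tendsto_const T[of v], of c]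
    by (simp add: A_smult)
  have "linear T"
  proof (rule linearI)
    show "T (v + w) = T v + T w" for v w
      using LIMSEQ_unique[OF T[of "v + w"]] tendsto_add[OF T[of v] T[of w]]
      by (simp add: bounded_linear.linear[OF A_blin, THEN linear_add])
    show "T (c *\<^sub>R v) = c *\<^sub>R T v" for c v
      using T_smult[of "of_real c" v] by (simp add: of_real_smult scaleR_conv_of_real[where 'a = complex])
  qed
  then have "bounded_linear T" by (simp add: linear_conv_bounded_linear)
  moreover have "norm (F (p + v) - F p - T v) \<le> M * (norm v)\<^sup>2" if v: "norm v < r / 2" for v
  proof (rule Lim_bounded)
    have "p + v \<in> ball p r" using v r by (simp add: dist_norm)
    then show "(\<lambda>n. cmod (f n (p + v) - f n p - A n v)) \<longlonglongrightarrow> cmod (F (p + v) - F p - T v)"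
      by (intro tendsto_intros lim pU T)
    show "\<forall>n\<ge>0. cmod (f n (p + v) - f n p - A n v) \<le> M * (norm v)\<^sup>2" using Q[OF v] by blast
  qed
  ultimately have "(F has_derivative T) (at p)"
    using r by (intro has_derivative_from_quadratic_bound[where \<delta> = "r / 2"]) auto
  then show ?thesis using T_smult by blast
qed

lemma holo_on_dir_deriv:
  fixes g :: "complex^'n \<Rightarrow> complex"
  assumes U: "open U" and g: "holo_on g U"
  shows "holo_on (dir_deriv g v) U"
  unfolding holo_on_def
proof
  fix p assume p: "p \<in> U"
  have "continuous (at p) g"
    using holo_on_continuous_on[OF g] U p by (simp add: continuous_on_eq_continuous_at)
  then obtain d where d: "0 < d" "\<And>x. dist x p < d \<Longrightarrow> dist (g x) (g p) < 1"
    unfolding continuous_at_eps_delta by (metis zero_less_one)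
  obtain d' where d': "0 < d'" "ball p d' \<subseteq> U" using U p openE by blast
  define r where "r = min d d'"
  define C where "C = cmod (g p) + 1"
  have r: "0 < r" using d d' by (simp add: r_def)
  have gr: "holo_on g (ball p r)" using d' by (intro holo_on_subset[OF g]) (auto simp: r_def)
  have C: "cmod (g x) \<le> C" if "x \<in> ball p r" for x
  proof -
    have "cmod (g x - g p) < 1" using d(2)[of x] that by (simp add: r_def dist_commute dist_norm norm_minus_commute)
    then show ?thesis unfolding C_def using norm_triangle_sub[of "g x" "g p"] by linarith
  qed
  define \<rho> where "\<rho> = r / 2 / (norm v + 1)"
  have \<rho>: "0 < \<rho>" using r by (simp add: \<rho>_def add_nonneg_pos)
  define h where "h n = complex_of_real (\<rho> / 4 / real (Suc n))" for n
  have h: "h n \<noteq> 0" "cmod (h n) < \<rho> / 2" for n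
  proof -
    show "h n \<noteq> 0" unfolding h_def of_real_eq_0_iff using \<rho> by simp
    have "cmod (h n) = \<rho> / 4 / real (Suc n)" 
      unfolding h_def norm_of_real using \<rho> by simp
    also have "\<dots> \<le> \<rho> / 4" using \<rho> by (simp add: divide_le_eq)
    finally show "cmod (h n) < \<rho> / 2" using \<rho> by linarith
  qed
  have hlim: "h \<longlonglongrightarrow> 0"
    unfolding h_def using LIMSEQ_Suc[OF lim_const_over_n[of "\<rho> / 4"]]
    by (metis of_real_0 tendsto_of_real)
  show "\<exists>f'. (dir_deriv g v has_derivative f') (at p) \<and> (\<forall>c w. f' (c *s w) = c * f' w)"
  proof (rule bounded_pointwise_limit_differentiable)
    show "0 < r / 2" using r by simp
    show "holo_on (\<lambda>z. (1 / h n) * (g (z + h n *s v) - g z)) (ball p (r / 2))" for n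
      using h[of n] \<rho> r
      by (intro holo_on_cmult holo_on_diff holo_on_translate[OF gr] line_in_ball[OF gr C r _ \<rho>_def]
            holo_on_subset[OF gr]) auto
    fix z assume z: "z \<in> ball p (r / 2)"
    show "cmod ((1 / h n) * (g (z + h n *s v) - g z)) \<le> 4 * C / \<rho>" for n
      using difference_quotient_bound[OF gr C r z \<rho>_def h] by simp
    show "(\<lambda>n. (1 / h n) * (g (z + h n *s v) - g z)) \<longlonglongrightarrow> dir_deriv g v z"
      using difference_quotient_limit[OF gr C r z \<rho>_def h(1) hlim] by simp
  qed
qed

section \<open>Sesquiholomorphic kernels\<close>

text \<open>Holomorphic in the first and antiholomorphic in the second variable. Local boundedness is
  included since it yields joint regularity through Cauchy's estimates.\<close>

definition sesqui_on :: "(complex^'n) set \<Rightarrow> (complex^'n \<Rightarrow> complex^'n \<Rightarrow> complex) \<Rightarrow> bool" where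
  "sesqui_on U k \<longleftrightarrow> open U \<and> (\<forall>w\<in>U. holo_on (\<lambda>z. k z w) U) \<and> (\<forall>z\<in>U. holo_on (\<lambda>w. cnj (k z w)) U) \<and>
     (\<forall>p\<in>U. \<forall>q\<in>U. \<exists>r>0. \<exists>C. ball p r \<subseteq> U \<and> ball q r \<subseteq> U \<and> (\<forall>z\<in>ball p r. \<forall>w\<in>ball q r. cmod (k z w) \<le> C))"

text \<open>The derivative of \<open>\<beta> \<mapsto> k z (w + cnj \<beta> *s v)\<close> at \<open>0\<close>, so that it is antilinear in \<open>v\<close>.\<close>

definition dbar_deriv :: "(complex^'n \<Rightarrow> complex^'n \<Rightarrow> complex) \<Rightarrow> complex^'n \<Rightarrow> complex^'n \<Rightarrow> complex^'n \<Rightarrow> complex" where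
  "dbar_deriv k v z w = cnj (dir_deriv (\<lambda>w. cnj (k z w)) v w)"

lemma sesqui_onD:
  assumes "sesqui_on U k"
  shows "open U" "w \<in> U \<Longrightarrow> holo_on (\<lambda>z. k z w) U" "z \<in> U \<Longrightarrow> holo_on (\<lambda>w. cnj (k z w)) U"
  using assms unfolding sesqui_on_def by auto

lemma sesqui_on_bound:
  assumes "sesqui_on U k" "p \<in> U" "q \<in> U"
  obtains r C where "0 < r" "ball p r \<subseteq> U" "ball q r \<subseteq> U"
    "\<And>z w. z \<in> ball p r \<Longrightarrow> w \<in> ball q r \<Longrightarrow> cmod (k z w) \<le> C"
  using assms unfolding sesqui_on_def by meson

text \<open>Holomorphy of the antiholomorphic derivative in the other variable: its difference quotients are
  holomorphic in \<open>z\<close> and, by Cauchy's estimates in \<open>w\<close>, uniformly bounded near each point.\<close>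

lemma sesqui_on_dbar_deriv:
  fixes k :: "complex^'n \<Rightarrow> complex^'n \<Rightarrow> complex"
  assumes k: "sesqui_on U k"
  shows "sesqui_on U (dbar_deriv k v)"
  unfolding sesqui_on_def
proof (intro conjI ballI)
  show U: "open U" by (rule sesqui_onD(1)[OF k])
  show "holo_on (\<lambda>w. cnj (dbar_deriv k v z w)) U" if "z \<in> U" for z
    unfolding dbar_deriv_def complex_cnj_cnj
    by (rule holo_on_dir_deriv[OF U sesqui_onD(3)[OF k that]])
  show "holo_on (\<lambda>z. dbar_deriv k v z w) U" if w: "w \<in> U" for w
    unfolding holo_on_def
  proof
    fix p assume p: "p \<in> U"
    obtain r C where r: "0 < r" and sub: "ball p r \<subseteq> U" "ball w r \<subseteq> U"
      and C: "\<And>z w'. z \<in> ball p r \<Longrightarrow> w' \<in> ball w r \<Longrightarrow> cmod (k z w') \<le> C"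
      using sesqui_on_bound[OF k p w] by metis
    define \<rho> where "\<rho> = r / 2 / (norm v + 1)"
    have \<rho>: "0 < \<rho>" using r by (simp add: \<rho>_def add_nonneg_pos)
    define h where "h n = complex_of_real (\<rho> / 4 / real (Suc n))" for n
    have h: "h n \<noteq> 0" "cmod (h n) < \<rho> / 2" for n
    proof -
      show "h n \<noteq> 0" unfolding h_def of_real_eq_0_iff using \<rho> by simp
      have "cmod (h n) = \<rho> / 4 / real (Suc n)"
        unfolding h_def norm_of_real using \<rho> by simp
      also have "\<dots> \<le> \<rho> / 4" using \<rho> by (simp add: divide_le_eq)
      finally show "cmod (h n) < \<rho> / 2" using \<rho> by linarith
    qed
    have hlim: "h \<longlonglongrightarrow> 0"
      unfolding h_def using LIMSEQ_Suc[OF lim_const_over_n[of "\<rho> / 4"]]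
      by (metis of_real_0 tendsto_of_real)
    have ww: "w \<in> ball w (r / 2)" using r by simp
    have g: "holo_on (\<lambda>w. cnj (k z w)) (ball w r)" if "z \<in> ball p r" for z
      using sub that by (intro holo_on_subset[OF sesqui_onD(3)[OF k]]) auto
    have gC: "cmod (cnj (k z x)) \<le> C" if "z \<in> ball p r" "x \<in> ball w r" for z x
      using C that by simp
    have inb: "w + h n *s v \<in> ball w r" for n
    proof -
      have "p \<in> ball p r" using r by simp
      then show ?thesis
        using h[of n] \<rho> by (intro line_in_ball[OF g gC r ww \<rho>_def, of p]) auto
    qed
    show "\<exists>f'. ((\<lambda>z. dbar_deriv k v z w) has_derivative f') (at p) \<and> (\<forall>c v. f' (c *s v) = c * f' v)"
    proof (rule bounded_pointwise_limit_differentiable[OF r])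
      show "holo_on (\<lambda>z. cnj (1 / h n) * (k z (w + h n *s v) - k z w)) (ball p r)" for n
        using sub inb[of n] w
        by (intro holo_on_cmult holo_on_diff holo_on_subset[OF sesqui_onD(2)[OF k]]) auto
      fix z assume z: "z \<in> ball p r"
      have eq: "cnj (1 / h n) * (k z (w + h n *s v) - k z w)
          = cnj ((cnj (k z (w + h n *s v)) - cnj (k z w)) / h n)" for n by simp
      show "cmod (cnj (1 / h n) * (k z (w + h n *s v) - k z w)) \<le> 4 * C / \<rho>" for n
        unfolding eq complex_mod_cnj
        by (rule difference_quotient_bound[OF g[OF z] gC[OF z] r ww \<rho>_def h])
      show "(\<lambda>n. cnj (1 / h n) * (k z (w + h n *s v) - k z w)) \<longlonglongrightarrow> dbar_deriv k v z w"
        unfolding eq dbar_deriv_def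
        by (intro tendsto_cnj difference_quotient_limit[OF g[OF z] gC[OF z] r ww \<rho>_def h(1) hlim])
    qed
  qed
  fix p q assume pq: "p \<in> U" "q \<in> U"
  obtain r C where r: "0 < r" and sub: "ball p r \<subseteq> U" "ball q r \<subseteq> U"
    and C: "\<And>z w'. z \<in> ball p r \<Longrightarrow> w' \<in> ball q r \<Longrightarrow> cmod (k z w') \<le> C"
    using sesqui_on_bound[OF k pq] by metis
  have "cmod (dbar_deriv k v z w) \<le> 2 * C / (r / 2 / (norm v + 1))"
    if z: "z \<in> ball p r" and w: "w \<in> ball q (r / 2)" for z w
    unfolding dbar_deriv_def complex_mod_cnj
  proof (rule dir_deriv_bound[OF _ _ r w refl])
    show "holo_on (\<lambda>w. cnj (k z w)) (ball q r)"
      using sub z by (intro holo_on_subset[OF sesqui_onD(3)[OF k]]) auto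
  qed (use C z in simp)
  then show "\<exists>r>0. \<exists>C. ball p r \<subseteq> U \<and> ball q r \<subseteq> U \<and> (\<forall>z\<in>ball p r. \<forall>w\<in>ball q r. cmod (dbar_deriv k v z w) \<le> C)"
    using r sub by (intro exI[of _ "r / 2"] exI[of _ "2 * C / (r / 2 / (norm v + 1))"] conjI) auto
qed

lemma dbar_deriv_coordinates:
  assumes "sesqui_on U k" "z \<in> U" "w \<in> U"
  shows "dbar_deriv k v z w = (\<Sum>i\<in>UNIV. cnj (v $ i) * dbar_deriv k (axis i 1) z w)"
  unfolding dbar_deriv_def
  by (subst dir_deriv_coordinates[OF sesqui_onD(3)[OF assms(1,2)] assms(3)]) simp

lemma dbar_deriv_smult:
  assumes "sesqui_on U k" "z \<in> U" "w \<in> U"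
  shows "dbar_deriv k (c *s v) z w = cnj c * dbar_deriv k v z w"
  unfolding dbar_deriv_def
  by (subst holo_on_dir_deriv_linear(2)[OF sesqui_onD(3)[OF assms(1,2)] assms(3)]) simp

lemma sesqui_on_chain2:
  assumes k: "sesqui_on U k" and z: "z \<in> U" and w: "\<gamma> (cnj s) \<in> U"
    and \<gamma>: "\<And>i. ((\<lambda>t. \<gamma> t $ i) has_field_derivative \<gamma>' $ i) (at (cnj s))"
  shows "((\<lambda>s. k z (\<gamma> (cnj s))) has_field_derivative dbar_deriv k \<gamma>' z (\<gamma> (cnj s))) (at s)"
proof -
  have "((\<lambda>t. cnj (k z (\<gamma> t))) has_field_derivative dir_deriv (\<lambda>w. cnj (k z w)) \<gamma>' (\<gamma> (cnj s))) (at (cnj s))"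
    by (rule holo_on_chain[OF sesqui_onD(3)[OF k z] w \<gamma>])
  from has_field_derivative_cnj_cnj[OF this] show ?thesis
    by (simp add: o_def dbar_deriv_def)
qed

text \<open>On the diagonal, the real derivative is the sum of the holomorphic and the antiholomorphic one.\<close>

lemma sesqui_on_diagonal_derivative:
  assumes k: "sesqui_on U k" and p: "p \<in> U"
  shows "((\<lambda>t::real. k (p + t *\<^sub>R e) (p + t *\<^sub>R e)) has_vector_derivative
           dir_deriv (\<lambda>z. k z p) e p + dbar_deriv k e p p) (at 0)"
proof -
  obtain r C where r: "0 < r" and sub: "ball p r \<subseteq> U"
    and C: "\<And>z w'. z \<in> ball p r \<Longrightarrow> w' \<in> ball p r \<Longrightarrow> cmod (k z w') \<le> C"
    using sesqui_on_bound[OF k p p] by metis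
  define \<rho> where "\<rho> = r / (norm e + 1)"
  have n1: "0 < norm e + 1" by (simp add: add_nonneg_pos)
  have \<rho>: "0 < \<rho>" using r n1 by (simp add: \<rho>_def)
  have inb: "p + \<zeta> *s e \<in> ball p r" if "\<zeta> \<in> ball 0 \<rho>" for \<zeta> :: complex
  proof -
    have "cmod \<zeta> * (norm e + 1) < r"
      using that by (simp only: pos_less_divide_eq[OF n1, symmetric] \<rho>_def[symmetric]) simp
    moreover have "cmod \<zeta> * norm e \<le> cmod \<zeta> * (norm e + 1)" by (intro mult_left_mono) auto
    ultimately show ?thesis by (simp add: dist_norm norm_complex_smult)
  qed
  then have inU: "p + \<zeta> *s e \<in> U" if "\<zeta> \<in> ball 0 \<rho>" for \<zeta> :: complex using sub that by blast
  have cnjb: "cnj \<zeta> \<in> ball 0 \<rho>" if "\<zeta> \<in> ball 0 \<rho>" for \<zeta> using that by simp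
  define k' where "k' \<alpha> \<beta> = k (p + \<alpha> *s e) (p + cnj \<beta> *s e)" for \<alpha> \<beta>
  have line: "((\<lambda>t. (p + t *s e) $ i) has_field_derivative e $ i) (at t)" for t i
    by (auto intro!: derivative_eq_intros)
  have d1: "((\<lambda>\<alpha>. k' \<alpha> \<beta>) has_field_derivative dir_deriv (\<lambda>z. k z (p + cnj \<beta> *s e)) e (p + \<alpha> *s e)) (at \<alpha>)"
    if "\<alpha> \<in> ball 0 \<rho>" "\<beta> \<in> ball 0 \<rho>" for \<alpha> \<beta>
    unfolding k'_def
    by (rule holo_on_line[OF sesqui_onD(2)[OF k inU[OF cnjb[OF that(2)]]] inU[OF that(1)]])
  have d2: "(k' \<alpha> has_field_derivative dbar_deriv k e (p + \<alpha> *s e) (p + cnj \<beta> *s e)) (at \<beta>)"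
    if "\<alpha> \<in> ball 0 \<rho>" "\<beta> \<in> ball 0 \<rho>" for \<alpha> \<beta>
    unfolding k'_def
    by (rule sesqui_on_chain2[OF k inU[OF that(1)], where \<gamma> = "\<lambda>t. p + t *s e"])
       (use inU[OF cnjb[OF that(2)]] line in auto)
  have "((\<lambda>t::real. k' (of_real t) (of_real t)) has_derivative
      (\<lambda>v. deriv (\<lambda>\<alpha>. k' \<alpha> 0) 0 * of_real v + deriv (k' 0) 0 * of_real v)) (at 0)"
  proof (rule separately_holomorphic_compose[OF \<rho>, where C = C])
    show "(\<lambda>\<alpha>. k' \<alpha> \<beta>) holomorphic_on ball 0 \<rho>" if "\<beta> \<in> ball 0 \<rho>" for \<beta>
      using d1[OF _ that] by (intro holomorphic_onI) (meson field_differentiable_at_within field_differentiable_def)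
    show "k' \<alpha> holomorphic_on ball 0 \<rho>" if "\<alpha> \<in> ball 0 \<rho>" for \<alpha>
      using d2[OF that] by (intro holomorphic_onI) (meson field_differentiable_at_within field_differentiable_def)
    show "cmod (k' \<alpha> \<beta>) \<le> C" if "\<alpha> \<in> ball 0 \<rho>" "\<beta> \<in> ball 0 \<rho>" for \<alpha> \<beta>
      unfolding k'_def using that by (intro C inb cnjb)
  qed (auto intro!: bounded_linear_imp_has_derivative bounded_linear_of_real)
  moreover have "deriv (\<lambda>\<alpha>. k' \<alpha> 0) 0 = dir_deriv (\<lambda>z. k z p) e p"
    using DERIV_imp_deriv[OF d1[of 0 0]] \<rho> by simp
  moreover have "deriv (k' 0) 0 = dbar_deriv k e p p"
    using DERIV_imp_deriv[OF d2[of 0 0]] \<rho> by simp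
  ultimately show ?thesis
    by (simp add: has_vector_derivative_def k'_def of_real_smult scaleR_conv_of_real[where 'a = complex] algebra_simps)
qed

section \<open>The Bergman kernel of a bounded domain\<close>

definition l2_inner :: "(complex^'n) set \<Rightarrow> (complex^'n \<Rightarrow> complex) \<Rightarrow> (complex^'n \<Rightarrow> complex) \<Rightarrow> complex" where
  "l2_inner \<Omega> f g = (LINT z:\<Omega>|lborel. f z * cnj (g z))"

lemma bergman_spaceD:
  assumes "f \<in> bergman_space \<Omega>"
  shows "holo_on f \<Omega>" "continuous_on \<Omega> f" "set_integrable lborel \<Omega> (\<lambda>z. (cmod (f z))\<^sup>2)"
  using assms holo_on_continuous_on unfolding bergman_space_def by auto

lemma set_integrable_by_bound:
  fixes f :: "complex^'n \<Rightarrow> complex" and g :: "complex^'n \<Rightarrow> real"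
  assumes \<Omega>: "open \<Omega>" and f: "continuous_on \<Omega> f" and g: "set_integrable lborel \<Omega> g"
    and le: "\<And>z. z \<in> \<Omega> \<Longrightarrow> cmod (f z) \<le> g z"
  shows "set_integrable lborel \<Omega> f"
  unfolding set_integrable_def
proof (rule Bochner_Integration.integrable_bound[OF g[unfolded set_integrable_def]])
  show "(\<lambda>x. indicator \<Omega> x *\<^sub>R f x) \<in> borel_measurable lborel"
    using borel_measurable_continuous_on_indicator[OF _ f] \<Omega> by simp
  show "AE x in lborel. norm (indicator \<Omega> x *\<^sub>R f x) \<le> norm (indicator \<Omega> x *\<^sub>R g x)"
    using le by (auto simp: indicator_def intro!: AE_I2 order_trans[OF le abs_ge_self])
qed

lemma bergman_space_inner_integrable:
  assumes \<Omega>: "open \<Omega>" and f: "f \<in> bergman_space \<Omega>" and g: "g \<in> bergman_space \<Omega>"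
  shows "set_integrable lborel \<Omega> (\<lambda>z. f z * cnj (g z))"
proof (rule set_integrable_by_bound[OF \<Omega>])
  show "continuous_on \<Omega> (\<lambda>z. f z * cnj (g z))"
    by (intro continuous_intros bergman_spaceD(2)[OF f] bergman_spaceD(2)[OF g])
  show "set_integrable lborel \<Omega> (\<lambda>z. (cmod (f z))\<^sup>2 + (cmod (g z))\<^sup>2)"
    by (intro set_integral_add(1) bergman_spaceD(3)[OF f] bergman_spaceD(3)[OF g])
  show "cmod (f z * cnj (g z)) \<le> (cmod (f z))\<^sup>2 + (cmod (g z))\<^sup>2" for z
    using sum_squares_bound[of "cmod (f z)" "cmod (g z)"] mult_nonneg_nonneg[OF norm_ge_zero norm_ge_zero, of "f z" "g z"]
    unfolding norm_mult complex_mod_cnj mult.assoc by linarith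
qed

lemma bergman_space_diff:
  assumes \<Omega>: "open \<Omega>" and f: "f \<in> bergman_space \<Omega>" and g: "g \<in> bergman_space \<Omega>"
  shows "(\<lambda>z. a * f z - b * g z) \<in> bergman_space \<Omega>"
  unfolding bergman_space_def
proof (intro CollectI conjI)
  show h: "holo_on (\<lambda>z. a * f z - b * g z) \<Omega>"
    by (intro holo_on_diff holo_on_cmult bergman_spaceD(1)[OF f] bergman_spaceD(1)[OF g])
  let ?b = "\<lambda>z. (2 * (cmod a)\<^sup>2) * (cmod (f z))\<^sup>2 + (2 * (cmod b)\<^sup>2) * (cmod (g z))\<^sup>2"
  have "set_integrable lborel \<Omega> (\<lambda>z. complex_of_real ((cmod (a * f z - b * g z))\<^sup>2))"
  proof (rule set_integrable_by_bound[OF \<Omega>])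
    show "continuous_on \<Omega> (\<lambda>z. complex_of_real ((cmod (a * f z - b * g z))\<^sup>2))"
      by (intro continuous_intros bergman_spaceD(2)[OF f] bergman_spaceD(2)[OF g])
    show "set_integrable lborel \<Omega> ?b"
      by (intro set_integral_add(1) set_integrable_mult_right bergman_spaceD(3)[OF f] bergman_spaceD(3)[OF g])
    show "cmod (complex_of_real ((cmod (a * f z - b * g z))\<^sup>2)) \<le> ?b z" for z
    proof -
      have "(cmod (a * f z - b * g z))\<^sup>2 \<le> (cmod (a * f z) + cmod (b * g z))\<^sup>2"
        by (intro power_mono norm_triangle_ineq4) auto
      also have "\<dots> \<le> 2 * (cmod (a * f z))\<^sup>2 + 2 * (cmod (b * g z))\<^sup>2"
        using sum_squares_bound[of "cmod (a * f z)" "cmod (b * g z)"] by (simp add: power2_sum)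
      finally show ?thesis by (simp add: norm_mult power_mult_distrib norm_power)
    qed
  qed
  then have "set_integrable lborel \<Omega> (\<lambda>z. Re (complex_of_real ((cmod (a * f z - b * g z))\<^sup>2)))"
    unfolding set_integrable_def by (auto dest: integrable_Re)
  then show "set_integrable lborel \<Omega> (\<lambda>z. (cmod (a * f z - b * g z))\<^sup>2)" by (simp only: Re_complex_of_real)
qed

lemma bounded_in_bergman_space:
  assumes \<Omega>: "open \<Omega>" "bounded \<Omega>" and f: "holo_on f \<Omega>" and C: "\<And>z. z \<in> \<Omega> \<Longrightarrow> cmod (f z) \<le> C"
  shows "f \<in> bergman_space \<Omega>"
  unfolding bergman_space_def
proof (intro CollectI conjI f)
  have fin: "emeasure lborel \<Omega> < \<infinity>" using emeasure_bounded_finite[OF \<Omega>(2)] .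
  have "set_integrable lborel \<Omega> (\<lambda>z. complex_of_real ((cmod (f z))\<^sup>2))"
  proof (rule set_integrable_by_bound[OF \<Omega>(1)])
    show "continuous_on \<Omega> (\<lambda>z. complex_of_real ((cmod (f z))\<^sup>2))"
      by (intro continuous_intros holo_on_continuous_on[OF f])
    show "set_integrable lborel \<Omega> (\<lambda>z. C\<^sup>2)"
      unfolding set_integrable_def using fin \<Omega>(1) by (intro integrable_scaleR_left integrable_real_indicator) auto
    show "cmod (complex_of_real ((cmod (f z))\<^sup>2)) \<le> C\<^sup>2" if "z \<in> \<Omega>" for z
      using C[OF that] by (simp add: norm_power power_mono)
  qed
  then have "set_integrable lborel \<Omega> (\<lambda>z. Re (complex_of_real ((cmod (f z))\<^sup>2)))"
    unfolding set_integrable_def by (auto dest: integrable_Re)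
  then show "set_integrable lborel \<Omega> (\<lambda>z. (cmod (f z))\<^sup>2)" by (simp only: Re_complex_of_real)
qed

lemma l2_inner_cnj: "l2_inner \<Omega> g f = cnj (l2_inner \<Omega> f g)"
proof -
  have "cnj (l2_inner \<Omega> f g) = (LINT z:\<Omega>|lborel. cnj (f z * cnj (g z)))"
    unfolding l2_inner_def set_lebesgue_integral_def
    by (subst Bochner_Integration.integral_cnj[symmetric]) simp
  then show ?thesis by (simp add: l2_inner_def mult.commute)
qed

lemma l2_inner_self: "l2_inner \<Omega> f f = complex_of_real (LINT z:\<Omega>|lborel. (cmod (f z))\<^sup>2)"
  unfolding l2_inner_def set_integral_complex_of_real[symmetric] by (simp only: complex_norm_square)

lemma l2_inner_null:
  assumes \<Omega>: "open \<Omega>" and u: "u \<in> bergman_space \<Omega>" "l2_inner \<Omega> u u = 0"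
  shows "l2_inner \<Omega> g u = 0"
proof -
  have "(LINT z|lborel. indicator \<Omega> z *\<^sub>R (cmod (u z))\<^sup>2) = 0"
    using u(2) unfolding l2_inner_self set_lebesgue_integral_def by simp
  then have "AE z in lborel. indicator \<Omega> z *\<^sub>R (cmod (u z))\<^sup>2 = 0"
    using integral_nonneg_eq_0_iff_AE[OF bergman_spaceD(3)[OF u(1), unfolded set_integrable_def]] by simp
  then have "AE z in lborel. indicator \<Omega> z *\<^sub>R (g z * cnj (u z)) = 0"
    by eventually_elim (auto simp: indicator_def split: if_splits)
  then show ?thesis
    unfolding l2_inner_def set_lebesgue_integral_def by (rule integral_eq_zero_AE)
qed

locale bergman_kernel =
  fixes \<Omega> :: "(complex^'n) set" and K :: "complex^'n \<Rightarrow> complex^'n \<Rightarrow> complex"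
  assumes open_dom: "open \<Omega>" and bounded_dom: "bounded \<Omega>" and kernel: "is_bergman_kernel \<Omega> K"
begin

lemma kernel_in_space: "w \<in> \<Omega> \<Longrightarrow> (\<lambda>z. K z w) \<in> bergman_space \<Omega>"
  using kernel unfolding is_bergman_kernel_def by blast

lemma reproducing: "w \<in> \<Omega> \<Longrightarrow> f \<in> bergman_space \<Omega> \<Longrightarrow> f w = l2_inner \<Omega> f (\<lambda>z. K z w)"
  using kernel unfolding is_bergman_kernel_def l2_inner_def by blast

lemma one_in_space: "(\<lambda>_. 1) \<in> bergman_space \<Omega>"
  by (rule bounded_in_bergman_space[OF open_dom bounded_dom holo_on_const, where C = 1]) simp

lemma coord_in_space: "(\<lambda>z. z $ i) \<in> bergman_space \<Omega>"
proof -
  obtain B where B: "\<And>z. z \<in> \<Omega> \<Longrightarrow> norm z \<le> B" using bounded_dom unfolding bounded_iff by blast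
  show ?thesis
    by (rule bounded_in_bergman_space[OF open_dom bounded_dom holo_on_coord, where C = B])
       (rule order_trans[OF Finite_Cartesian_Product.norm_nth_le B])
qed

lemma hermitian: "z \<in> \<Omega> \<Longrightarrow> w \<in> \<Omega> \<Longrightarrow> K w z = cnj (K z w)"
  using reproducing[of w "\<lambda>u. K u z"] reproducing[of z "\<lambda>u. K u w"] kernel_in_space
    l2_inner_cnj[of \<Omega> "\<lambda>u. K u z" "\<lambda>u. K u w"] by simp

lemma diagonal_real_pos:
  assumes z: "z \<in> \<Omega>"
  shows "K z z = complex_of_real (Re (K z z))" "0 < Re (K z z)"
proof -
  define r where "r = (LINT u:\<Omega>|lborel. (cmod (K u z))\<^sup>2)"
  have Kr: "K z z = complex_of_real r"
    using reproducing[OF z kernel_in_space[OF z]] unfolding l2_inner_self r_def .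
  then show "K z z = complex_of_real (Re (K z z))" by simp
  have "0 \<le> r" unfolding r_def set_lebesgue_integral_def by (rule integral_nonneg_AE) simp
  moreover have "r \<noteq> 0"
  proof
    assume "r = 0"
    then have "l2_inner \<Omega> (\<lambda>_. 1) (\<lambda>u. K u z) = 0"
      using l2_inner_null[OF open_dom kernel_in_space[OF z]] reproducing[OF z kernel_in_space[OF z]] Kr by simp
    then show False using reproducing[OF z one_in_space] by simp
  qed
  ultimately show "0 < Re (K z z)" using Kr by simp
qed

text \<open>Equality in the Cauchy--Schwarz inequality makes \<open>K(\<cdot>, p)\<close> and \<open>K(\<cdot>, q)\<close> proportional as
  functionals on the Bergman space. Evaluating them on the constant \<open>1\<close> and on the coordinates, which
  belong to the space since \<open>\<Omega>\<close> is bounded, gives \<open>p = q\<close>.\<close>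

lemma cauchy_schwarz_equality:
  assumes p: "p \<in> \<Omega>" and q: "q \<in> \<Omega>" and eq: "K p p * K q q = K p q * K q p"
  shows "p = q"
proof -
  define u where "u z = K q q * K z p - K q p * K z q" for z
  have u: "u \<in> bergman_space \<Omega>"
    unfolding u_def by (intro bergman_space_diff open_dom kernel_in_space p q)
  have inner_u: "l2_inner \<Omega> f u = cnj (K q q) * f p - cnj (K q p) * f q" if f: "f \<in> bergman_space \<Omega>" for f
  proof -
    note i = bergman_space_inner_integrable[OF open_dom f kernel_in_space]
    have "l2_inner \<Omega> f u
        = (LINT z:\<Omega>|lborel. cnj (K q q) * (f z * cnj (K z p)) - cnj (K q p) * (f z * cnj (K z q)))"
      unfolding l2_inner_def u_def by (simp add: algebra_simps)
    also have "\<dots> = cnj (K q q) * l2_inner \<Omega> f (\<lambda>z. K z p) - cnj (K q p) * l2_inner \<Omega> f (\<lambda>z. K z q)"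
      unfolding l2_inner_def
      by (simp only: set_integral_diff(2)[OF set_integrable_mult_right[OF i[OF p]] set_integrable_mult_right[OF i[OF q]]]
          set_integral_mult_right)
    finally show ?thesis using reproducing f p q by simp
  qed
  have "u q = 0" "u p = 0" using eq by (simp_all add: u_def mult.commute)
  then have "l2_inner \<Omega> u u = 0" using inner_u[OF u] by simp
  then have 0: "cnj (K q q) * f p = cnj (K q p) * f q" if "f \<in> bergman_space \<Omega>" for f
    using l2_inner_null[OF open_dom u] inner_u[OF that] by simp
  have "cnj (K q q) = cnj (K q p)" using 0[OF one_in_space] by simp
  moreover have "K q q \<noteq> 0" using diagonal_real_pos[OF q] by auto
  ultimately have "p $ i = q $ i" for i using 0[OF coord_in_space, of i] by simp
  then show ?thesis by (simp add: vec_eq_iff)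
qed

end

section \<open>Consequences of Nash algebraicity\<close>

text \<open>The point \<open>(z, cnj w)\<close>, at which the kernel is a holomorphic function.\<close>

definition join :: "complex^'n \<Rightarrow> complex^'n \<Rightarrow> complex^('n::finite + 'n)" where
  "join z w = (\<chi> i. case i of Inl a \<Rightarrow> z $ a | Inr b \<Rightarrow> cnj (w $ b))"

lemma join_parts [simp]: "fst_part (join z w) = z" "cnj_snd_part (join z w) = w"
  by (simp_all add: fst_part_def cnj_snd_part_def join_def vec_eq_iff)

lemma join_of_parts: "join (fst_part x) (cnj_snd_part x) = x"
  by (auto simp: fst_part_def cnj_snd_part_def join_def vec_eq_iff split: sum.split)

lemma join_perturb: "join (z + \<alpha> *s a) (w + cnj \<beta> *s b) = join z w + \<alpha> *s join a 0 + \<beta> *s join 0 b"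
  by (auto simp: join_def vec_eq_iff split: sum.split)

lemma norm_join_le: "norm (join z w) \<le> norm z + norm w"
proof -
  have "(norm (join z w))\<^sup>2 = (\<Sum>i\<in>UNIV <+> UNIV. (cmod (join z w $ i))\<^sup>2)"
    by (simp add: norm_vec_def L2_set_def sum_nonneg)
  also have "\<dots> = (norm z)\<^sup>2 + (norm w)\<^sup>2"
    by (subst sum.Plus) (auto simp: norm_vec_def L2_set_def sum_nonneg join_def)
  also have "\<dots> \<le> (norm z + norm w)\<^sup>2" by (simp add: power2_sum)
  finally show ?thesis by (rule power2_le_imp_le) simp
qed

lemma join_diff: "join z w - join z' w' = join (z - z') (w - w')"
  by (auto simp: join_def vec_eq_iff split: sum.split)

lemma polyfun_join: "polyfun p \<Longrightarrow> polyfun (\<lambda>z. p (join z w))"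
proof (induction rule: polyfun.induct)
  case (coord i)
  show ?case by (cases i) (auto simp: join_def intro: polyfun.intros)
qed (auto intro: polyfun.intros)

lemma polyfun_family_along_line:
  fixes d :: nat
  assumes "\<And>j. polyfun (p j)"
  obtains M q where "\<And>j k. polyfun (q j k)"
    "\<And>j x \<alpha>. j \<le> d \<Longrightarrow> p j (x + \<alpha> *s v) = (\<Sum>k\<le>M. q j k x * \<alpha> ^ k)"
proof -
  have "\<forall>j. \<exists>m q. (\<forall>k. polyfun (q k)) \<and> (\<forall>k>m. \<forall>x. q k x = 0) \<and>
      (\<forall>x \<alpha>. p j (x + \<alpha> *s v) = (\<Sum>k\<le>m. q k x * \<alpha> ^ k))"
    by (intro allI polyfun_along_line assms)
  from choice[OF this] obtain m where "\<forall>j. \<exists>q. (\<forall>k. polyfun (q k)) \<and> (\<forall>k>m j. \<forall>x. q k x = 0) \<and>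
      (\<forall>x \<alpha>. p j (x + \<alpha> *s v) = (\<Sum>k\<le>m j. q k x * \<alpha> ^ k))" ..
  from choice[OF this] obtain q where q: "\<forall>j. (\<forall>k. polyfun (q j k)) \<and> (\<forall>k>m j. \<forall>x. q j k x = 0) \<and>
      (\<forall>x \<alpha>. p j (x + \<alpha> *s v) = (\<Sum>k\<le>m j. q j k x * \<alpha> ^ k))" ..
  define M where "M = (\<Sum>j\<le>d. m j)"
  have "p j (x + \<alpha> *s v) = (\<Sum>k\<le>M. q j k x * \<alpha> ^ k)" if "j \<le> d" for j x \<alpha>
  proof -
    have "m j \<le> M" unfolding M_def using that by (intro member_le_sum) auto
    then have "(\<Sum>k\<le>m j. q j k x * \<alpha> ^ k) = (\<Sum>k\<le>M. q j k x * \<alpha> ^ k)"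
      using q by (intro sum.mono_neutral_left) auto
    then show ?thesis using q by simp
  qed
  moreover have "polyfun (q j k)" for j k using spec[OF q, of j] by simp
  ultimately show ?thesis by (rule that[rotated])
qed

lemma polyfun_along_lineE:
  assumes "polyfun p"
  obtains m q where "\<And>k. polyfun (q k)" "\<And>x \<alpha>. p (x + \<alpha> *s v) = (\<Sum>k\<le>m. q k x * \<alpha> ^ k)"
proof -
  from polyfun_along_line[OF assms, of v] show thesis
    by (elim exE conjE) (rule that; simp)
qed

text \<open>A polynomial that does not vanish identically on the plane \<open>x\<^sub>0 + \<alpha>a + \<beta>b\<close> is zero-free on suitable
  small tori: choose the circle for \<open>\<beta>\<close> to avoid the zeros of the lowest coefficient in \<open>\<alpha>\<close>, then a
  circle for \<open>\<alpha>\<close> so small that this coefficient dominates.\<close>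

lemma polyfun_zero_free_torus:
  fixes x0 a b :: "complex^'m"
  assumes p: "polyfun p" and nz: "p (x0 + a + b) \<noteq> 0" and \<rho>: "0 < \<rho>"
  obtains r1 r2 where "0 < r1" "r1 < \<rho>" "0 < r2" "r2 < \<rho>"
    "\<And>\<alpha> \<beta>. cmod \<alpha> = r1 \<Longrightarrow> cmod \<beta> = r2 \<Longrightarrow> p (x0 + \<alpha> *s a + \<beta> *s b) \<noteq> 0"
proof -
  obtain m q where q: "\<And>k. polyfun (q k)" "\<And>x \<alpha>. p (x + \<alpha> *s a) = (\<Sum>k\<le>m. q k x * \<alpha> ^ k)"
    by (rule polyfun_along_lineE[OF p, of a]) (rule that)
  define \<psi> where "\<psi> k \<beta> = q k (x0 + \<beta> *s b)" for k \<beta>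
  have p\<psi>: "p (x0 + \<alpha> *s a + \<beta> *s b) = (\<Sum>k\<le>m. \<psi> k \<beta> * \<alpha> ^ k)" for \<alpha> \<beta>
    using q(2)[of "x0 + \<beta> *s b" \<alpha>] by (simp add: \<psi>_def algebra_simps)
  have cont: "continuous_on A (\<psi> k)" for A k
    unfolding \<psi>_def
    by (intro continuous_on_compose2[OF continuous_on_polyfun[OF q(1), of UNIV]] continuous_intros
        bounded_linear.continuous_on[OF bounded_linear_smult]) auto
  define Q where "Q k \<longleftrightarrow> k \<le> m \<and> (\<exists>\<beta>. \<psi> k \<beta> \<noteq> 0)" for k
  have "\<exists>k. Q k"
  proof (rule ccontr)
    assume "\<nexists>k. Q k"
    then have "p (x0 + 1 *s a + 1 *s b) = 0" unfolding p\<psi> Q_def by auto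
    then show False using nz by simp
  qed
  define k where "k = (LEAST k. Q k)"
  have k: "Q k" unfolding k_def using \<open>\<exists>k. Q k\<close> by (metis LeastI)
  have low: "\<psi> i \<beta> = 0" if "i < k" for i \<beta>
  proof -
    have "\<not> Q i" using not_less_Least[of i Q] that unfolding k_def by blast
    then show ?thesis using k that unfolding Q_def by auto
  qed
  have "finite {\<beta>. \<psi> k \<beta> = 0}"
  proof -
    obtain n s where s: "\<And>x \<alpha>. q k (x + \<alpha> *s b) = (\<Sum>j\<le>n. s j x * \<alpha> ^ j)"
      by (rule polyfun_along_lineE[OF q(1)[of k], of b]) (rule that)
    have "\<exists>j\<le>n. s j x0 \<noteq> 0"
      using k unfolding Q_def \<psi>_def s by (metis (no_types, lifting) atMost_iff mult_zero_left sum.neutral)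
    then show ?thesis unfolding \<psi>_def s by (subst polyfun_finite_roots)
  qed
  then have "infinite ({0<..<\<rho>} - cmod ` {\<beta>. \<psi> k \<beta> = 0})"
    using \<rho> by (intro Diff_infinite_finite) (auto simp: infinite_Ioo)
  then obtain r2 where "r2 \<in> {0<..<\<rho>} - cmod ` {\<beta>. \<psi> k \<beta> = 0}"
    by (metis finite.emptyI ex_in_conv)
  then have r2: "0 < r2" "r2 < \<rho>" "\<And>\<beta>. cmod \<beta> = r2 \<Longrightarrow> \<psi> k \<beta> \<noteq> 0" by auto
  have ne: "sphere (0::complex) r2 \<noteq> {}" using r2(1) by simp
  have comp: "compact (sphere (0::complex) r2)" by simp
  obtain \<beta>0 where \<beta>0: "\<beta>0 \<in> sphere 0 r2" "\<And>\<beta>. \<beta> \<in> sphere 0 r2 \<Longrightarrow> cmod (\<psi> k \<beta>0) \<le> cmod (\<psi> k \<beta>)"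
    using continuous_attains_inf[OF comp ne continuous_on_norm[OF cont]] by blast
  define \<delta> where "\<delta> = cmod (\<psi> k \<beta>0)"
  have \<delta>: "0 < \<delta>" using r2(3) \<beta>0(1) by (simp add: \<delta>_def)
  obtain \<beta>1 where \<beta>1: "\<And>\<beta>. \<beta> \<in> sphere 0 r2 \<Longrightarrow> (\<Sum>i\<le>m. cmod (\<psi> i \<beta>)) \<le> (\<Sum>i\<le>m. cmod (\<psi> i \<beta>1))"
  proof -
    have "continuous_on (sphere 0 r2) (\<lambda>\<beta>. \<Sum>i\<le>m. cmod (\<psi> i \<beta>))"
      by (intro continuous_on_sum continuous_on_norm cont)
    from continuous_attains_sup[OF comp ne this] show ?thesis using that by blast
  qed
  define B where "B = (\<Sum>i\<le>m. cmod (\<psi> i \<beta>1))"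
  have B: "0 \<le> B" by (simp add: B_def sum_nonneg)
  define r1 where "r1 = min (min (\<rho> / 2) (1 / 2)) (\<delta> / (2 * (B + 1)))"
  have r1: "0 < r1" "r1 < \<rho>" "r1 \<le> 1" using \<rho> \<delta> B by (auto simp: r1_def)
  have "r1 \<le> \<delta> / (2 * (B + 1))" by (simp add: r1_def)
  then have "r1 * (2 * (B + 1)) \<le> \<delta>" using B by (simp add: pos_le_divide_eq)
  moreover have "r1 * B < r1 * (2 * (B + 1))" using r1(1) B by (intro mult_strict_left_mono) auto
  ultimately have r1B: "r1 * B < \<delta>" by linarith
  show ?thesis
  proof (rule that[OF r1(1,2) r2(1,2)])
    fix \<alpha> \<beta> assume \<alpha>: "cmod \<alpha> = r1" and \<beta>: "cmod \<beta> = r2"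
    define R where "R = (\<Sum>i\<in>{k<..m}. \<psi> i \<beta> * \<alpha> ^ i)"
    have "p (x0 + \<alpha> *s a + \<beta> *s b) = (\<Sum>i\<in>{k..m}. \<psi> i \<beta> * \<alpha> ^ i)"
      unfolding p\<psi> by (intro sum.mono_neutral_right) (auto simp: low)
    also have "{k..m} = insert k {k<..m}" using k by (auto simp: Q_def)
    finally have split: "p (x0 + \<alpha> *s a + \<beta> *s b) = \<psi> k \<beta> * \<alpha> ^ k + R" by (simp add: R_def)
    have "cmod R \<le> (\<Sum>i\<in>{k<..m}. cmod (\<psi> i \<beta>) * r1 ^ Suc k)"
      unfolding R_def
    proof (rule order_trans[OF norm_sum sum_mono])
      fix i assume "i \<in> {k<..m}"
      then have "r1 ^ i \<le> r1 ^ Suc k" using r1 by (intro power_decreasing) auto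
      then show "cmod (\<psi> i \<beta> * \<alpha> ^ i) \<le> cmod (\<psi> i \<beta>) * r1 ^ Suc k"
        unfolding norm_mult norm_power \<alpha> by (rule mult_left_mono) simp
    qed
    also have "\<dots> = (\<Sum>i\<in>{k<..m}. cmod (\<psi> i \<beta>)) * r1 ^ Suc k" by (simp only: sum_distrib_right)
    also have "\<dots> \<le> B * r1 ^ Suc k"
    proof (rule mult_right_mono)
      have "(\<Sum>i\<in>{k<..m}. cmod (\<psi> i \<beta>)) \<le> (\<Sum>i\<le>m. cmod (\<psi> i \<beta>))" by (rule sum_mono2) auto
      then show "(\<Sum>i\<in>{k<..m}. cmod (\<psi> i \<beta>)) \<le> B" using \<beta>1[of \<beta>] \<beta> by (simp add: B_def)
    qed (use r1 in simp)
    also have "\<dots> = r1 * B * r1 ^ k" by simp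
    also have "\<dots> < \<delta> * r1 ^ k" using r1B r1 by (intro mult_strict_right_mono) auto
    also have "\<dots> \<le> cmod (\<psi> k \<beta> * \<alpha> ^ k)"
      unfolding norm_mult norm_power \<alpha> using \<beta>0(2)[of \<beta>] \<beta> r1 by (intro mult_right_mono) (auto simp: \<delta>_def)
    finally have "cmod R < cmod (\<psi> k \<beta> * \<alpha> ^ k)" .
    then show "p (x0 + \<alpha> *s a + \<beta> *s b) \<noteq> 0"
      unfolding split by (metis add_eq_0_iff norm_minus_cancel less_irrefl)
  qed
qed

lemma root_bound:
  fixes c :: "nat \<Rightarrow> complex"
  assumes rel: "(\<Sum>j\<le>d. c j * y ^ j) = 0" and lead: "c d \<noteq> 0"
  shows "cmod y \<le> 1 + (\<Sum>j<d. cmod (c j)) / cmod (c d)"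
proof (cases "cmod y \<le> 1")
  case True
  then show ?thesis by (rule order_trans) (simp add: sum_nonneg)
next
  case False
  have "d \<noteq> 0" using rel lead by (intro notI) simp
  then obtain n where n: "d = Suc n" by (cases d) auto
  have "c d * y ^ d = - (\<Sum>j<d. c j * y ^ j)"
    using rel by (simp add: lessThan_Suc_atMost[symmetric] add_eq_0_iff)
  then have "cmod (c d) * cmod y ^ d = cmod (\<Sum>j<d. c j * y ^ j)"
    by (metis norm_minus_cancel norm_mult norm_power)
  also have "\<dots> \<le> (\<Sum>j<d. cmod (c j) * cmod y ^ n)"
  proof (rule order_trans[OF norm_sum sum_mono])
    fix j assume "j \<in> {..<d}"
    then have "cmod y ^ j \<le> cmod y ^ n" using False n by (intro power_increasing) auto
    then show "cmod (c j * y ^ j) \<le> cmod (c j) * cmod y ^ n"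
      unfolding norm_mult norm_power by (rule mult_left_mono) simp
  qed
  also have "\<dots> = (\<Sum>j<d. cmod (c j)) * cmod y ^ n" by (simp only: sum_distrib_right)
  finally have "(cmod (c d) * cmod y) * cmod y ^ n \<le> (\<Sum>j<d. cmod (c j)) * cmod y ^ n"
    by (simp add: n mult.assoc)
  moreover have "0 < cmod y ^ n" using False by (intro zero_less_power) linarith
  ultimately have "cmod (c d) * cmod y \<le> (\<Sum>j<d. cmod (c j))" by (rule mult_right_le_imp_le)
  then have "cmod y \<le> (\<Sum>j<d. cmod (c j)) / cmod (c d)"
    using lead by (simp add: pos_le_divide_eq mult.commute)
  then show ?thesis by simp
qed

lemma holo_on_cong:
  assumes "open U" "holo_on f U" "\<And>z. z \<in> U \<Longrightarrow> f z = g z" shows "holo_on g U"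
  unfolding holo_on_def
proof
  fix z assume z: "z \<in> U"
  have "(g has_derivative (\<lambda>v. dir_deriv f v z)) (at z)"
    using has_derivative_transform_within_open[OF holo_on_dir_deriv_linear(1)[OF assms(2) z] assms(1) z assms(3)] .
  then show "\<exists>f'. (g has_derivative f') (at z) \<and> (\<forall>c v. f' (c *s v) = c * f' v)"
    using holo_on_dir_deriv_linear(2)[OF assms(2) z] by blast
qed

lemma maximum_modulus_at_centre:
  assumes d: "\<And>\<zeta>. cmod \<zeta> \<le> r \<Longrightarrow> h field_differentiable at \<zeta>" and r: "0 < r"
    and B: "\<And>\<zeta>. cmod \<zeta> = r \<Longrightarrow> cmod (h \<zeta>) \<le> B"
  shows "cmod (h 0) \<le> B"
proof -
  have h: "h holomorphic_on ball 0 r"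
    using d by (simp add: holomorphic_on_def field_differentiable_at_within)
  have c: "continuous_on (cball 0 r) h"
    by (rule continuous_at_imp_continuous_on) (simp add: d field_differentiable_imp_continuous_at)
  show ?thesis
  proof (rule maximum_modulus_frontier[of h "cball 0 r" B 0])
    show "h holomorphic_on interior (cball 0 r)" using h by simp
    show "continuous_on (closure (cball 0 r)) h" using c by simp
    show "bounded (cball (0::complex) r)" by simp
    show "cmod (h z) \<le> B" if "z \<in> frontier (cball 0 r)" for z using that B r by simp
    show "(0::complex) \<in> cball 0 r" using r by simp
  qed
qed
lemma maximum_modulus_on_line:
  assumes f: "holo_on f U" and line: "\<And>\<zeta>. cmod \<zeta> \<le> r \<Longrightarrow> z + \<zeta> *s v \<in> U" and r: "0 < r"
    and B: "\<And>\<zeta>. cmod \<zeta> = r \<Longrightarrow> cmod (f (z + \<zeta> *s v)) \<le> B"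
  shows "cmod (f z) \<le> B"
proof -
  define h where "h \<zeta> = f (z + \<zeta> *s v)" for \<zeta>
  have "\<exists>D. (h has_field_derivative D) (at \<zeta>)" if "cmod \<zeta> \<le> r" for \<zeta>
    unfolding h_def by (rule exI) (rule holo_on_line[OF f line[OF that]])
  then have d: "h field_differentiable at \<zeta>" if "cmod \<zeta> \<le> r" for \<zeta>
    using that by (simp add: field_differentiable_def)
  have "cmod (h 0) \<le> B"
    by (rule maximum_modulus_at_centre[OF d r]) (simp_all add: h_def B)
  then show ?thesis by (simp add: h_def)
qed

locale nash_bergman_kernel = bergman_kernel +
  assumes nash: "nash_algebraic_kernel \<Omega> K"
begin

lemma kernel_holo: "w \<in> \<Omega> \<Longrightarrow> holo_on (\<lambda>z. K z w) \<Omega>"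
  by (rule bergman_spaceD(1)[OF kernel_in_space])

lemma kernel_antiholo: "z \<in> \<Omega> \<Longrightarrow> holo_on (\<lambda>w. cnj (K z w)) \<Omega>"
  by (rule holo_on_cong[OF open_dom kernel_holo]) (assumption, rule hermitian)

lemma kernel_equation:
  obtains d p where "\<And>j. polyfun (p j)" "\<exists>j\<le>d. \<exists>x. p j x \<noteq> 0"
    "\<And>z w. z \<in> \<Omega> \<Longrightarrow> w \<in> \<Omega> \<Longrightarrow> (\<Sum>j\<le>d. p j (join z w) * K z w ^ j) = 0"
proof (rule nash_algebraic_coefficients[OF nash[unfolded nash_algebraic_kernel_def]])
  fix d :: nat and p :: "nat \<Rightarrow> complex^('a + 'a) \<Rightarrow> complex"
  assume p: "\<And>j. polyfun (p j)" "\<exists>j\<le>d. \<exists>x. p j x \<noteq> 0"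
    and rel: "\<And>x. x \<in> {x. fst_part x \<in> \<Omega> \<and> cnj_snd_part x \<in> \<Omega>} \<Longrightarrow>
      (\<Sum>j\<le>d. p j x * K (fst_part x) (cnj_snd_part x) ^ j) = 0"
  show thesis
  proof (rule that[OF p])
    show "(\<Sum>j\<le>d. p j (join z w) * K z w ^ j) = 0" if "z \<in> \<Omega>" "w \<in> \<Omega>" for z w
    proof -
      have "join z w \<in> {x. fst_part x \<in> \<Omega> \<and> cnj_snd_part x \<in> \<Omega>}" using that by simp
      from rel[OF this] show ?thesis unfolding join_parts .
    qed
  qed
qed

text \<open>The equation of \<open>K\<close> is specialised to the given \<open>w\<close> and then to the set \<open>T\<close>. Each time it is first
  moved in a direction in which some coefficient does not vanish, and the lowest-order part in the
  displacement is kept.\<close>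

lemma kernel_algebraic_in_first_variable:
  assumes w: "w \<in> \<Omega>" and T: "T \<subseteq> \<Omega>" "T \<noteq> {}"
  obtains d q where "\<And>j. polyfun (q j)" "\<exists>j\<le>d. \<exists>z\<in>T. q j z \<noteq> 0"
    "\<And>z. z \<in> T \<Longrightarrow> (\<Sum>j\<le>d. q j z * K z w ^ j) = 0"
proof -
  obtain d p where p: "\<And>j. polyfun (p j)" "\<exists>j\<le>d. \<exists>x. p j x \<noteq> 0"
    "\<And>z w. z \<in> \<Omega> \<Longrightarrow> w \<in> \<Omega> \<Longrightarrow> (\<Sum>j\<le>d. p j (join z w) * K z w ^ j) = 0"
    by (rule kernel_equation) (rule that)
  obtain j1 x1 where j1: "j1 \<le> d" "p j1 x1 \<noteq> 0" using p(2) by blast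
  define z1 where "z1 = fst_part x1"
  define b where "b = cnj_snd_part x1 - w"
  have x1: "x1 = join z1 w + 1 *s join 0 b"
    using join_perturb[of z1 0 0 w 1 b] join_of_parts[of x1] by (simp add: z1_def b_def)
  obtain M q where q: "\<And>j k. polyfun (q j k)"
    "\<And>j x \<alpha>. j \<le> d \<Longrightarrow> p j (x + \<alpha> *s join 0 b) = (\<Sum>k\<le>M. q j k x * \<alpha> ^ k)"
    by (rule polyfun_family_along_line[where d = d and v = "join 0 b", OF p(1)]) (rule that)
  have ex1: "\<exists>j\<le>d. \<exists>k\<le>M. \<exists>z\<in>UNIV. q j k (join z w) \<noteq> 0"
  proof -
    have "(\<Sum>k\<le>M. q j1 k (join z1 w) * 1 ^ k) \<noteq> 0" using j1 q(2) x1 by metis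
    then obtain k where "k \<le> M" "q j1 k (join z1 w) \<noteq> 0"
      by (metis (no_types, lifting) atMost_iff mult_zero_left sum.neutral)
    then show ?thesis using j1 by blast
  qed
  have small: "\<forall>\<^sub>F \<epsilon> in at 0. y + \<epsilon> *s v \<in> \<Omega>" "((\<lambda>\<epsilon>. y + \<epsilon> *s v) \<longlongrightarrow> y) (at 0)"
    if "y \<in> \<Omega>" for y v :: "complex^'a"
  proof -
    have "((\<lambda>\<epsilon>. y + \<epsilon> *s v) \<longlongrightarrow> y + 0 *s v) (at 0)"
      by (intro tendsto_add tendsto_const bounded_linear.tendsto[OF bounded_linear_smult] tendsto_ident_at)
    then show "((\<lambda>\<epsilon>. y + \<epsilon> *s v) \<longlongrightarrow> y) (at 0)" by simp
    then show "\<forall>\<^sub>F \<epsilon> in at 0. y + \<epsilon> *s v \<in> \<Omega>" using topological_tendstoD open_dom that by blast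
  qed
  have small_cnj: "\<forall>\<^sub>F \<epsilon> in at 0. w + cnj \<epsilon> *s b \<in> \<Omega>" "((\<lambda>\<epsilon>. w + cnj \<epsilon> *s b) \<longlongrightarrow> w) (at 0)"
  proof -
    have "((\<lambda>\<epsilon>. w + cnj \<epsilon> *s b) \<longlongrightarrow> w + cnj 0 *s b) (at 0)"
      by (intro tendsto_add tendsto_const bounded_linear.tendsto[OF bounded_linear_smult] tendsto_cnj tendsto_ident_at)
    then show "((\<lambda>\<epsilon>. w + cnj \<epsilon> *s b) \<longlongrightarrow> w) (at 0)" by simp
    then show "\<forall>\<^sub>F \<epsilon> in at 0. w + cnj \<epsilon> *s b \<in> \<Omega>" using topological_tendstoD open_dom w by blast
  qed
  have cont1: "((\<lambda>\<epsilon>. K z (w + cnj \<epsilon> *s b)) \<longlongrightarrow> K z (w + cnj 0 *s b)) (at 0)" if z: "z \<in> \<Omega>" for z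
  proof -
    have "isCont (\<lambda>w. cnj (K z w)) w"
      using holo_on_continuous_on[OF kernel_antiholo[OF z]] open_dom w continuous_on_eq_continuous_at by blast
    from tendsto_cnj[OF isCont_tendsto_compose[OF this small_cnj(2)]] show ?thesis by simp
  qed
  have rel1: "\<forall>\<^sub>F \<epsilon> in at 0. (\<Sum>j\<le>d. (\<Sum>k\<le>M. q j k (join z w) * \<epsilon> ^ k) * K z (w + cnj \<epsilon> *s b) ^ j) = 0"
    if z: "z \<in> \<Omega>" for z
    using small_cnj(1)
  proof eventually_elim
    case (elim \<epsilon>)
    have "join z (w + cnj \<epsilon> *s b) = join z w + \<epsilon> *s join 0 b"
      using join_perturb[of z 0 0 w \<epsilon> b] by simp
    then show ?case using p(3)[OF z elim] q(2) by simp
  qed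
  obtain k where k: "\<exists>j\<le>d. \<exists>z\<in>UNIV. q j k (join z w) \<noteq> 0"
    "\<And>z. z \<in> \<Omega> \<Longrightarrow> (\<Sum>j\<le>d. q j k (join z w) * K z (w + cnj 0 *s b) ^ j) = 0"
    by (rule lowest_order_equation[where c = "\<lambda>j k z. q j k (join z w)" and T = \<Omega>
          and G = "\<lambda>\<epsilon> z. K z (w + cnj \<epsilon> *s b)", OF ex1 subset_UNIV rel1 cont1]) (assumption, assumption, rule that)
  define p' where "p' j z = q j k (join z w)" for j z
  have p': "polyfun (p' j)" for j unfolding p'_def by (rule polyfun_join[OF q(1)])
  obtain j2 z2 where j2: "j2 \<le> d" "p' j2 z2 \<noteq> 0" using k(1) unfolding p'_def by blast
  obtain z0 where z0: "z0 \<in> T" using T(2) by blast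
  define a where "a = z2 - z0"
  obtain N s where s: "\<And>j k. polyfun (s j k)"
    "\<And>j x \<alpha>. j \<le> d \<Longrightarrow> p' j (x + \<alpha> *s a) = (\<Sum>k\<le>N. s j k x * \<alpha> ^ k)"
    by (rule polyfun_family_along_line[where d = d and v = a, OF p']) (rule that)
  have ex2: "\<exists>j\<le>d. \<exists>k\<le>N. \<exists>z\<in>T. s j k z \<noteq> 0"
  proof -
    have "(\<Sum>k\<le>N. s j2 k z0 * 1 ^ k) \<noteq> 0" using j2 s(2)[OF j2(1), of z0 1] by (simp add: a_def)
    then obtain k where "k \<le> N" "s j2 k z0 \<noteq> 0"
      by (metis (no_types, lifting) atMost_iff mult_zero_left sum.neutral)
    then show ?thesis using j2 z0 by blast
  qed
  have cont2: "((\<lambda>\<epsilon>. K (z + \<epsilon> *s a) w) \<longlongrightarrow> K (z + 0 *s a) w) (at 0)" if z: "z \<in> T" for z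
  proof -
    have zU: "z \<in> \<Omega>" using z T(1) by blast
    have "isCont (\<lambda>z. K z w) z"
      using holo_on_continuous_on[OF kernel_holo[OF w]] open_dom zU continuous_on_eq_continuous_at by blast
    from isCont_tendsto_compose[OF this small(2)[OF zU]] show ?thesis by simp
  qed
  have rel2: "\<forall>\<^sub>F \<epsilon> in at 0. (\<Sum>j\<le>d. (\<Sum>k\<le>N. s j k z * \<epsilon> ^ k) * K (z + \<epsilon> *s a) w ^ j) = 0"
    if z: "z \<in> T" for z
  proof -
    have zU: "z \<in> \<Omega>" using z T(1) by blast
    show ?thesis
      using small(1)[OF zU, of a]
    proof eventually_elim
      case (elim \<epsilon>)
      have "(\<Sum>j\<le>d. p' j (z + \<epsilon> *s a) * K (z + \<epsilon> *s a) w ^ j) = 0"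
        using k(2)[OF elim] unfolding p'_def by simp
      then show ?case using s(2) by simp
    qed
  qed
  obtain l where l: "\<exists>j\<le>d. \<exists>z\<in>T. s j l z \<noteq> 0"
    "\<And>z. z \<in> T \<Longrightarrow> (\<Sum>j\<le>d. s j l z * K (z + 0 *s a) w ^ j) = 0"
    by (rule lowest_order_equation[where c = s and T = T
          and G = "\<lambda>\<epsilon> z. K (z + \<epsilon> *s a) w", OF ex2 subset_refl rel2 cont2]) (assumption, assumption, rule that)
  show ?thesis by (rule that[of "\<lambda>j. s j l" d]) (use s(1) l in auto)
qed

text \<open>Where the leading coefficient of its equation does not vanish, \<open>K\<close> is bounded by its coefficients.
  Zeros of the leading coefficient are avoided by going to a torus around the given point, and the
  maximum principle in each of the two variables brings the bound back to the point.\<close>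

lemma kernel_locally_bounded:
  assumes z0: "z0 \<in> \<Omega>" and w0: "w0 \<in> \<Omega>"
  shows "\<exists>r>0. \<exists>C. ball z0 r \<subseteq> \<Omega> \<and> ball w0 r \<subseteq> \<Omega> \<and> (\<forall>z\<in>ball z0 r. \<forall>w\<in>ball w0 r. cmod (K z w) \<le> C)"
proof -
  obtain d' p where p: "\<And>j. polyfun (p j)" and nz: "\<exists>j\<le>d'. \<exists>x. p j x \<noteq> 0"
    and eq: "\<And>z w. z \<in> \<Omega> \<Longrightarrow> w \<in> \<Omega> \<Longrightarrow> (\<Sum>j\<le>d'. p j (join z w) * K z w ^ j) = 0"
    by (rule kernel_equation) (rule that)
  define d where "d = Max {j. j \<le> d' \<and> (\<exists>x. p j x \<noteq> 0)}"
  have fin: "finite {j. j \<le> d' \<and> (\<exists>x. p j x \<noteq> 0)}" by simp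
  have d: "d \<le> d'" "\<exists>x. p d x \<noteq> 0" using Max_in[OF fin] nz unfolding d_def by auto
  have top: "p j x = 0" if "d < j" "j \<le> d'" for j x
    using Max_ge[OF fin, of j] that unfolding d_def by fastforce
  have rel: "(\<Sum>j\<le>d. p j (join z w) * K z w ^ j) = 0" if "z \<in> \<Omega>" "w \<in> \<Omega>" for z w
  proof -
    have "(\<Sum>j\<le>d. p j (join z w) * K z w ^ j) = (\<Sum>j\<le>d'. p j (join z w) * K z w ^ j)"
      using d(1) top by (intro sum.mono_neutral_left) auto
    then show ?thesis using eq[OF that] by simp
  qed
  define bnd where "bnd x = 1 + (\<Sum>j<d. cmod (p j x)) / cmod (p d x)" for x
  have K_bnd: "cmod (K z w) \<le> bnd (join z w)" if "z \<in> \<Omega>" "w \<in> \<Omega>" "p d (join z w) \<noteq> 0" for z w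
    unfolding bnd_def by (rule root_bound[OF rel[OF that(1,2)] that(3)])
  obtain x1 where x1: "p d x1 \<noteq> 0" using d by blast
  define u where "u = fst_part x1 - z0"
  define v where "v = cnj_snd_part x1 - w0"
  have "x1 = join z0 w0 + join u 0 + join 0 v"
    using join_perturb[of z0 1 u w0 1 v] join_of_parts[of x1] by (simp add: u_def v_def)
  then have p1: "p d (join z0 w0 + join u 0 + join 0 v) \<noteq> 0" using x1 by simp
  obtain e1 e2 where "0 < e1" "ball z0 e1 \<subseteq> \<Omega>" "0 < e2" "ball w0 e2 \<subseteq> \<Omega>"
    using open_dom z0 w0 openE by metis
  then obtain e where e: "0 < e" "ball z0 e \<subseteq> \<Omega>" "ball w0 e \<subseteq> \<Omega>"
    by (metis min_less_iff_conj subset_trans subset_ball min.cobounded1 min.cobounded2)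
  define \<rho> where "\<rho> = e / 2 / (norm u + norm v + 1)"
  have n1: "0 < norm u + norm v + 1" by (simp add: add_nonneg_pos)
  have \<rho>: "0 < \<rho>" using e n1 by (simp add: \<rho>_def)
  have stay: "norm (\<zeta> *s y) < e / 2" if "cmod \<zeta> < \<rho>" "norm y \<le> norm u + norm v" for \<zeta> and y :: "complex^'a"
  proof -
    have "cmod \<zeta> * (norm u + norm v + 1) < e / 2"
      using that(1) unfolding \<rho>_def by (simp only: pos_less_divide_eq[OF n1])
    moreover have "cmod \<zeta> * norm y \<le> cmod \<zeta> * (norm u + norm v + 1)"
      using that(2) by (intro mult_left_mono) auto
    ultimately show ?thesis by (simp add: norm_complex_smult)
  qed
  obtain r1 r2 where r1: "0 < r1" "r1 < \<rho>" and r2: "0 < r2" "r2 < \<rho>"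
    and tor: "\<And>\<alpha> \<beta>. cmod \<alpha> = r1 \<Longrightarrow> cmod \<beta> = r2 \<Longrightarrow> p d (join z0 w0 + \<alpha> *s join u 0 + \<beta> *s join 0 v) \<noteq> 0"
    by (rule polyfun_zero_free_torus[OF p p1 \<rho>]) (rule that)
  define tp where "tp c = join z0 w0 + fst c *s join u 0 + snd c *s join 0 v" for c :: "complex \<times> complex"
  define T where "T = tp ` (sphere 0 r1 \<times> sphere 0 r2)"
  have contT: "continuous_on A tp" for A
    unfolding tp_def
    by (intro continuous_intros bounded_linear.continuous_on[OF bounded_linear_smult])
  have T: "compact T"
    unfolding T_def by (intro compact_continuous_image contT compact_Times) auto
  define V where "V = {x. p d x \<noteq> 0}"
  have V: "open V"
  proof -
    have "V = p d -` (- {0})" by (auto simp: V_def)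
    then show ?thesis using open_vimage[OF _ continuous_on_polyfun[OF p]] by (simp add: open_Compl)
  qed
  have "T \<subseteq> V" unfolding T_def V_def tp_def using tor by auto
  then obtain \<epsilon> where \<epsilon>: "0 < \<epsilon>" "(\<Union>x\<in>T. ball x \<epsilon>) \<subseteq> V"
    using compact_subset_open_imp_ball_epsilon_subset[OF T V] by metis
  define S where "S = {x + y | x y. x \<in> T \<and> y \<in> cball 0 (\<epsilon> / 2)}"
  have S: "compact S" unfolding S_def by (rule compact_sums[OF T compact_cball])
  have SV: "S \<subseteq> V"
  proof
    fix x assume "x \<in> S"
    then obtain t y where ty: "x = t + y" "t \<in> T" "norm y \<le> \<epsilon> / 2" unfolding S_def by auto
    then have "x \<in> ball t \<epsilon>" using \<epsilon>(1) by (simp add: dist_norm)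
    then show "x \<in> V" using \<epsilon>(2) ty(2) by blast
  qed
  have "continuous_on S bnd"
    unfolding bnd_def using SV by (intro continuous_intros continuous_on_polyfun p) (auto simp: V_def)
  then have "bounded (bnd ` S)" by (intro compact_imp_bounded compact_continuous_image S)
  then obtain B where B: "\<And>x. x \<in> S \<Longrightarrow> bnd x \<le> B"
    unfolding bounded_iff by (metis abs_le_D1 imageI real_norm_def)
  define r where "r = min (e / 2) (\<epsilon> / 4)"
  have r: "0 < r" using e \<epsilon> by (simp add: r_def)
  have "cmod (K z w) \<le> B" if z: "z \<in> ball z0 r" and w: "w \<in> ball w0 r" for z w
  proof -
    have nz: "norm (z - z0) < e / 2" "norm (z - z0) < \<epsilon> / 4" and nw: "norm (w - w0) < e / 2" "norm (w - w0) < \<epsilon> / 4"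
      using z w by (auto simp: r_def dist_norm norm_minus_commute)
    have inz: "z + \<alpha> *s u \<in> \<Omega>" if "cmod \<alpha> < \<rho>" for \<alpha>
    proof -
      have "norm ((z - z0) + \<alpha> *s u) < e"
        using norm_triangle_ineq[of "z - z0" "\<alpha> *s u"] nz(1) stay[OF that, of u] by simp
      then have "z + \<alpha> *s u \<in> ball z0 e" by (simp add: dist_norm norm_minus_commute algebra_simps)
      then show ?thesis using e(2) by blast
    qed
    have inw: "w + \<beta> *s v \<in> \<Omega>" if "cmod \<beta> < \<rho>" for \<beta>
    proof -
      have "norm ((w - w0) + \<beta> *s v) < e"
        using norm_triangle_ineq[of "w - w0" "\<beta> *s v"] nw(1) stay[OF that, of v] by simp
      then have "w + \<beta> *s v \<in> ball w0 e" by (simp add: dist_norm norm_minus_commute algebra_simps)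
      then show ?thesis using e(3) by blast
    qed
    have wU: "w \<in> \<Omega>" using inw[of 0] \<rho> by simp
    have torus: "cmod (K (z + \<alpha> *s u) (w + \<beta> *s v)) \<le> B" if ab: "cmod \<alpha> = r1" "cmod \<beta> = r2" for \<alpha> \<beta>
    proof -
      have "join (z + \<alpha> *s u) (w + \<beta> *s v) = tp (\<alpha>, cnj \<beta>) + join (z - z0) (w - w0)"
        using join_perturb[of z \<alpha> u w "cnj \<beta>" v] by (simp add: tp_def join_diff[symmetric])
      moreover have "norm (join (z - z0) (w - w0)) \<le> \<epsilon> / 2"
        using norm_join_le[of "z - z0" "w - w0"] nz(2) nw(2) by linarith
      moreover have "tp (\<alpha>, cnj \<beta>) \<in> T" unfolding T_def using ab by auto
      ultimately have "join (z + \<alpha> *s u) (w + \<beta> *s v) \<in> S" unfolding S_def by auto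
      moreover from this have "p d (join (z + \<alpha> *s u) (w + \<beta> *s v)) \<noteq> 0" using SV by (auto simp: V_def)
      ultimately show ?thesis
        using K_bnd[OF inz inw] B ab r1 r2 by (meson order_trans)
    qed
    have circle: "cmod (K (z + \<alpha> *s u) w) \<le> B" if "cmod \<alpha> = r1" for \<alpha>
    proof -
      have zU: "z + \<alpha> *s u \<in> \<Omega>" using that r1 by (intro inz) simp
      have "cmod (cnj (K (z + \<alpha> *s u) w)) \<le> B"
      proof (rule maximum_modulus_on_line[OF kernel_antiholo[OF zU] _ r2(1)])
        show "w + \<zeta> *s v \<in> \<Omega>" if "cmod \<zeta> \<le> r2" for \<zeta> using that r2 by (intro inw) simp
        show "cmod (cnj (K (z + \<alpha> *s u) (w + \<zeta> *s v))) \<le> B" if "cmod \<zeta> = r2" for \<zeta>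
          using torus[OF \<open>cmod \<alpha> = r1\<close> that] by simp
      qed
      then show ?thesis by simp
    qed
    show ?thesis
    proof (rule maximum_modulus_on_line[OF kernel_holo[OF wU] _ r1(1) circle])
      show "z + \<zeta> *s u \<in> \<Omega>" if "cmod \<zeta> \<le> r1" for \<zeta> using that r1 by (intro inz) simp
    qed
  qed
  moreover have "ball z0 r \<subseteq> \<Omega>" "ball w0 r \<subseteq> \<Omega>"
    using e by (auto simp: r_def subset_iff)
  ultimately show ?thesis using r by blast
qed

lemma sesqui_on_kernel: "sesqui_on \<Omega> K"
  unfolding sesqui_on_def
proof (intro conjI ballI)
  fix p q assume "p \<in> \<Omega>" "q \<in> \<Omega>"
  then show "\<exists>r>0. \<exists>C. ball p r \<subseteq> \<Omega> \<and> ball q r \<subseteq> \<Omega> \<and> (\<forall>z\<in>ball p r. \<forall>w\<in>ball q r. cmod (K z w) \<le> C)"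
    by (rule kernel_locally_bounded)
qed (rule open_dom kernel_holo kernel_antiholo, assumption?)+

end

section \<open>The metric coefficients\<close>

text \<open>The two Wirtinger operators pick out the complex linear part \<open>a\<close> and the antilinear part \<open>b\<close> of the
  real derivative.\<close>

lemma wirtinger_split:
  assumes d: "\<And>e. ((\<lambda>t::real. G (p + t *\<^sub>R e)) has_vector_derivative a e + b e) (at 0)"
    and a: "a (axis i \<i>) = \<i> * a (axis i 1)" and b: "b (axis i \<i>) = - \<i> * b (axis i 1)"
  shows "d_z i G p = a (axis i 1)" "d_zbar i G p = b (axis i 1)"
proof -
  have "partial_deriv e G p = a e + b e" for e
    unfolding partial_deriv_def by (rule vector_derivative_at[OF d])
  then show "d_z i G p = a (axis i 1)" "d_zbar i G p = b (axis i 1)"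
    unfolding d_z_def d_zbar_def by (simp_all add: a b algebra_simps)
qed

lemma d_z_cong:
  assumes "open U" "p \<in> U" "\<And>z. z \<in> U \<Longrightarrow> F z = G z"
  shows "d_z i F p = d_z i G p"
proof -
  have "partial_deriv e F p = partial_deriv e G p" for e
    unfolding partial_deriv_def
  proof (rule vector_derivative_cong_eq)
    have "((\<lambda>t::real. p + t *\<^sub>R e) \<longlongrightarrow> p + 0 *\<^sub>R e) (nhds 0)"
      by (intro tendsto_intros filterlim_ident)
    then have "\<forall>\<^sub>F t in nhds (0::real). p + t *\<^sub>R e \<in> U"
      using assms(1,2) by (intro topological_tendstoD) auto
    then show "\<forall>\<^sub>F t in nhds (0::real). t \<in> UNIV \<longrightarrow> F (p + t *\<^sub>R e) = G (p + t *\<^sub>R e)"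
      by eventually_elim (simp add: assms(3))
  qed auto
  then show ?thesis unfolding d_z_def by simp
qed

lemma axis_imaginary: "axis i \<i> = \<i> *s axis i (1::complex)"
  by (simp add: vec_eq_iff axis_def)

text \<open>On a pair \<open>u, \<i>u\<close> a form \<open>\<i>\<partial>\<partial>\<^bsub>bar\<^esub>\<phi>\<close> is twice the Levi form of \<open>\<phi>\<close>.\<close>

lemma i_ddbar_levi:
  "i_ddbar \<phi> z u (\<i> *s u) = 2 * (\<Sum>i\<in>UNIV. \<Sum>j\<in>UNIV. d_z i (d_zbar j \<phi>) z * (u $ i * cnj (u $ j)))"
proof -
  have "a * (x * cnj (\<i> * y) - \<i> * x * cnj y) = (- 2 * \<i>) * (a * (x * cnj y))" for a x y :: complex
    by (simp add: algebra_simps)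
  then have "d_z i (d_zbar j \<phi>) z * (u $ i * cnj ((\<i> *s u) $ j) - (\<i> *s u) $ i * cnj (u $ j))
      = (- 2 * \<i>) * (d_z i (d_zbar j \<phi>) z * (u $ i * cnj (u $ j)))" for i j
    by (simp only: vector_smult_component)
  then have "(\<Sum>i\<in>UNIV. \<Sum>j\<in>UNIV. d_z i (d_zbar j \<phi>) z * (u $ i * cnj ((\<i> *s u) $ j) - (\<i> *s u) $ i * cnj (u $ j)))
      = (\<Sum>i\<in>UNIV. \<Sum>j\<in>UNIV. (- 2 * \<i>) * (d_z i (d_zbar j \<phi>) z * (u $ i * cnj (u $ j))))"
    by (intro sum.cong refl)
  also have "\<dots> = (- 2 * \<i>) * (\<Sum>i\<in>UNIV. \<Sum>j\<in>UNIV. d_z i (d_zbar j \<phi>) z * (u $ i * cnj (u $ j)))"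
    by (simp only: sum_distrib_left)
  finally have "i_ddbar \<phi> z u (\<i> *s u)
      = \<i> * ((- 2 * \<i>) * (\<Sum>i\<in>UNIV. \<Sum>j\<in>UNIV. d_z i (d_zbar j \<phi>) z * (u $ i * cnj (u $ j))))"
    unfolding i_ddbar_def by (rule arg_cong)
  moreover have "\<i> * ((- 2 * \<i>) * x) = 2 * x" for x :: complex by simp
  ultimately show ?thesis by (simp only:)
qed

text \<open>The coefficients \<open>\<plusminus>1\<close> of the indefinite form, as complex numbers.\<close>

definition signature :: "nat \<Rightarrow> 'N::{finite,linorder} \<Rightarrow> complex" where
  "signature \<kappa> i = (if i \<in> first_indices \<kappa> then -1 else 1)"

lemma indef_euclidean_levi:
  fixes z u :: "(complex, 'N::{finite,linorder}) vec"
  shows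
  "indef_euclidean_form \<kappa> z u (\<i> *s u) = 8 * (\<Sum>i\<in>UNIV. signature \<kappa> i * (u $ i * cnj (u $ i)))"
proof -
  let ?\<psi> = "\<lambda>z. complex_of_real
       ((\<Sum>i\<in>- first_indices \<kappa>. (cmod (z $ i))\<^sup>2) - (\<Sum>j\<in>first_indices \<kappa>. (cmod (z $ j))\<^sup>2))"
  have psi: "?\<psi> z = (\<Sum>i\<in>UNIV. signature \<kappa> i * (z $ i * cnj (z $ i)))" for z :: "(complex, 'N) vec"
  proof -
    have "(\<Sum>i\<in>UNIV. signature \<kappa> i * (z $ i * cnj (z $ i)))
        = (\<Sum>i\<in>- first_indices \<kappa> \<union> first_indices \<kappa>. signature \<kappa> i * (z $ i * cnj (z $ i)))"
      by (simp add: Un_commute)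
    also have "\<dots> = (\<Sum>i\<in>- first_indices \<kappa>. signature \<kappa> i * (z $ i * cnj (z $ i)))
        + (\<Sum>i\<in>first_indices \<kappa>. signature \<kappa> i * (z $ i * cnj (z $ i)))"
      by (rule sum.union_disjoint) auto
    finally show ?thesis
      by (simp add: signature_def sum_negf complex_norm_square[symmetric])
  qed
  have zbar: "d_zbar j ?\<psi> z = signature \<kappa> j * z $ j" for j and z :: "(complex, 'N) vec"
  proof -
    have "d_zbar j ?\<psi> z = (\<lambda>e. \<Sum>i\<in>UNIV. signature \<kappa> i * (z $ i * cnj (e $ i))) (axis j 1)"
    proof (rule wirtinger_split(2)[where a = "\<lambda>e. \<Sum>i\<in>UNIV. signature \<kappa> i * (e $ i * cnj (z $ i))"])
      fix e :: "(complex, 'N) vec"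
      have "((\<lambda>t::real. \<Sum>i\<in>UNIV. signature \<kappa> i * ((z $ i + of_real t * e $ i) * (cnj (z $ i) + of_real t * cnj (e $ i))))
          has_vector_derivative (\<Sum>i\<in>UNIV. signature \<kappa> i * (e $ i * cnj (z $ i)) + signature \<kappa> i * (z $ i * cnj (e $ i)))) (at 0)"
        by (rule has_vector_derivative_eq_rhs)
           (auto intro!: derivative_eq_intros has_vector_derivative_sum has_vector_derivative_mult_right
             has_vector_derivative_mult has_vector_derivative_real_field simp: algebra_simps)
      then show "((\<lambda>t::real. ?\<psi> (z + t *\<^sub>R e)) has_vector_derivative
          (\<Sum>i\<in>UNIV. signature \<kappa> i * (e $ i * cnj (z $ i))) + (\<Sum>i\<in>UNIV. signature \<kappa> i * (z $ i * cnj (e $ i)))) (at 0)"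
        unfolding psi by (simp add: sum.distrib scaleR_conv_of_real[where 'a = complex])
    qed (simp_all add: axis_imaginary sum_distrib_left algebra_simps sum_negf)
    also have "\<dots> = (\<Sum>i\<in>UNIV. if i = j then signature \<kappa> j * z $ j else 0)"
      by (rule sum.cong) (auto simp: axis_def)
    finally show ?thesis by simp
  qed
  have "d_z i (d_zbar j ?\<psi>) z = (if i = j then signature \<kappa> i else 0)" for i j
  proof -
    have "d_z i (\<lambda>z. signature \<kappa> j * z $ j) z = (\<lambda>e. signature \<kappa> j * e $ j) (axis i 1)"
    proof (rule wirtinger_split(1)[where b = "\<lambda>_. 0"])
      fix e :: "(complex, 'N) vec"
      have "((\<lambda>t::real. signature \<kappa> j * (z $ j + of_real t * e $ j)) has_vector_derivative signature \<kappa> j * e $ j) (at 0)"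
        by (rule has_vector_derivative_eq_rhs)
           (auto intro!: derivative_eq_intros has_vector_derivative_real_field)
      then show "((\<lambda>t::real. signature \<kappa> j * (z + t *\<^sub>R e) $ j) has_vector_derivative signature \<kappa> j * e $ j + 0) (at 0)"
        by (simp add: scaleR_conv_of_real[where 'a = complex])
    qed (simp_all add: axis_imaginary)
    then show ?thesis unfolding zbar by (simp add: axis_def)
  qed
  then have "(\<Sum>i\<in>UNIV. \<Sum>j\<in>UNIV. d_z i (d_zbar j ?\<psi>) z * (u $ i * cnj (u $ j)))
      = (\<Sum>i\<in>UNIV. \<Sum>j\<in>UNIV. if j = i then signature \<kappa> i * (u $ i * cnj (u $ i)) else 0)"
    by (intro sum.cong) auto
  then show ?thesis unfolding indef_euclidean_form_def i_ddbar_levi by simp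
qed

context nash_bergman_kernel
begin

lemma diagonal_nonzero: "z \<in> \<Omega> \<Longrightarrow> K z z \<noteq> 0"
  using diagonal_real_pos[of z] by auto

lemma log_kernel_d_zbar:
  assumes p: "p \<in> \<Omega>"
  shows "d_zbar j (\<lambda>z. complex_of_real (ln (Re (K z z)))) p = dbar_deriv K (axis j 1) p p / K p p"
proof -
  have "d_zbar j (\<lambda>z. complex_of_real (ln (Re (K z z)))) p = (\<lambda>e. dbar_deriv K e p p / K p p) (axis j 1)"
  proof (rule wirtinger_split(2)[where a = "\<lambda>e. dir_deriv (\<lambda>z. K z p) e p / K p p"])
    fix e
    define F where "F t = K (p + t *\<^sub>R e) (p + t *\<^sub>R e)" for t :: real
    have F: "(F has_vector_derivative dir_deriv (\<lambda>z. K z p) e p + dbar_deriv K e p p) (at 0)"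
      unfolding F_def by (rule sesqui_on_diagonal_derivative[OF sesqui_on_kernel p])
    have F0: "F 0 = K p p" by (simp add: F_def)
    have pos: "F 0 \<notin> \<real>\<^sub>\<le>\<^sub>0"
      using diagonal_real_pos[OF p] unfolding F0 by (auto simp: complex_nonpos_Reals_iff)
    have "(Ln has_field_derivative inverse (F 0)) (at (F 0) within range F)"
      by (rule has_field_derivative_at_within[OF has_field_derivative_Ln[OF pos]])
    from field_vector_diff_chain_within[OF F this]
    have "((\<lambda>t. Ln (F t)) has_vector_derivative
        (dir_deriv (\<lambda>z. K z p) e p + dbar_deriv K e p p) * inverse (K p p)) (at 0)"
      by (simp add: o_def F0)
    moreover have "open ((\<lambda>t::real. p + t *\<^sub>R e) -` \<Omega>)"
      by (intro open_vimage open_dom continuous_intros)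
    moreover have "(0::real) \<in> (\<lambda>t::real. p + t *\<^sub>R e) -` \<Omega>" using p by simp
    moreover have "Ln (F t) = complex_of_real (ln (Re (K (p + t *\<^sub>R e) (p + t *\<^sub>R e))))"
      if "t \<in> (\<lambda>t::real. p + t *\<^sub>R e) -` \<Omega>" for t
    proof -
      have "p + t *\<^sub>R e \<in> \<Omega>" using that by simp
      from diagonal_real_pos[OF this] show ?thesis unfolding F_def by (metis Ln_of_real)
    qed
    ultimately have "((\<lambda>t. complex_of_real (ln (Re (K (p + t *\<^sub>R e) (p + t *\<^sub>R e))))) has_vector_derivative
        (dir_deriv (\<lambda>z. K z p) e p + dbar_deriv K e p p) * inverse (K p p)) (at 0)"
      by (rule has_vector_derivative_transform_within_open)
    then show "((\<lambda>t. complex_of_real (ln (Re (K (p + t *\<^sub>R e) (p + t *\<^sub>R e))))) has_vector_derivative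
        dir_deriv (\<lambda>z. K z p) e p / K p p + dbar_deriv K e p p / K p p) (at 0)"
      by (simp only: divide_inverse distrib_right)
  qed (simp_all add: axis_imaginary dbar_deriv_smult[OF sesqui_on_kernel p p]
      holo_on_dir_deriv_linear(2)[OF kernel_holo[OF p] p])
  then show ?thesis .
qed

lemma bergman_metric_coefficient:
  assumes p: "p \<in> \<Omega>"
  shows "d_z i (d_zbar j (\<lambda>z. complex_of_real (ln (Re (K z z))))) p
    = (dir_deriv (\<lambda>z. dbar_deriv K (axis j 1) z p) (axis i 1) p * K p p
        - dbar_deriv K (axis j 1) p p * dir_deriv (\<lambda>z. K z p) (axis i 1) p) / (K p p)\<^sup>2"
proof -
  define m where "m = dbar_deriv K (axis j 1)"
  have m: "sesqui_on \<Omega> m" unfolding m_def by (rule sesqui_on_dbar_deriv[OF sesqui_on_kernel])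
  have "d_z i (d_zbar j (\<lambda>z. complex_of_real (ln (Re (K z z))))) p = d_z i (\<lambda>z. m z z / K z z) p"
    by (rule d_z_cong[OF open_dom p]) (simp add: log_kernel_d_zbar m_def)
  also have "\<dots> = (\<lambda>e. (dir_deriv (\<lambda>z. m z p) e p * K p p - m p p * dir_deriv (\<lambda>z. K z p) e p) / (K p p)\<^sup>2) (axis i 1)"
  proof (rule wirtinger_split(1)[where b = "\<lambda>e. (dbar_deriv m e p p * K p p - m p p * dbar_deriv K e p p) / (K p p)\<^sup>2"])
    fix e
    note M = sesqui_on_diagonal_derivative[OF m p, of e] and F = sesqui_on_diagonal_derivative[OF sesqui_on_kernel p, of e]
    have K0: "K (p + 0 *\<^sub>R e) (p + 0 *\<^sub>R e) \<noteq> 0" using diagonal_nonzero[OF p] by simp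
    have "((\<lambda>z. 1 / z) has_field_derivative - (1 / (K p p)\<^sup>2)) (at (K p p) within A)" for A
      using diagonal_nonzero[OF p] by (auto intro!: derivative_eq_intros simp: power2_eq_square)
    moreover have val: "m p p * ((dir_deriv (\<lambda>z. K z p) e p + dbar_deriv K e p p) * - (1 / (K p p)\<^sup>2))
         + (dir_deriv (\<lambda>z. m z p) e p + dbar_deriv m e p p) * (1 / K p p)
        = (dir_deriv (\<lambda>z. m z p) e p * K p p - m p p * dir_deriv (\<lambda>z. K z p) e p) / (K p p)\<^sup>2
        + (dbar_deriv m e p p * K p p - m p p * dbar_deriv K e p p) / (K p p)\<^sup>2"
      using diagonal_nonzero[OF p] by (simp add: field_simps power2_eq_square)
    ultimately have inv: "((\<lambda>z. 1 / z) has_field_derivative - (1 / (K p p)\<^sup>2))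
        (at ((\<lambda>t. K (p + t *\<^sub>R e) (p + t *\<^sub>R e)) 0) within range (\<lambda>t. K (p + t *\<^sub>R e) (p + t *\<^sub>R e)))"
      by simp
    from has_vector_derivative_mult[OF M field_vector_diff_chain_within[OF F inv]]
    have "((\<lambda>t. m (p + t *\<^sub>R e) (p + t *\<^sub>R e) * (1 / K (p + t *\<^sub>R e) (p + t *\<^sub>R e))) has_vector_derivative
        m p p * ((dir_deriv (\<lambda>z. K z p) e p + dbar_deriv K e p p) * - (1 / (K p p)\<^sup>2))
         + (dir_deriv (\<lambda>z. m z p) e p + dbar_deriv m e p p) * (1 / K p p)) (at 0)"
      by (simp add: o_def)
    then show "((\<lambda>t. m (p + t *\<^sub>R e) (p + t *\<^sub>R e) / K (p + t *\<^sub>R e) (p + t *\<^sub>R e)) has_vector_derivative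
        (dir_deriv (\<lambda>z. m z p) e p * K p p - m p p * dir_deriv (\<lambda>z. K z p) e p) / (K p p)\<^sup>2
        + (dbar_deriv m e p p * K p p - m p p * dbar_deriv K e p p) / (K p p)\<^sup>2) (at 0)"
      unfolding val[symmetric] by (simp only: times_divide_eq_right mult_1_right)
  next
    show "(dir_deriv (\<lambda>z. m z p) (axis i \<i>) p * K p p - m p p * dir_deriv (\<lambda>z. K z p) (axis i \<i>) p) / (K p p)\<^sup>2
        = \<i> * ((dir_deriv (\<lambda>z. m z p) (axis i 1) p * K p p - m p p * dir_deriv (\<lambda>z. K z p) (axis i 1) p) / (K p p)\<^sup>2)"
      unfolding axis_imaginary
      by (simp add: holo_on_dir_deriv_linear(2)[OF kernel_holo[OF p] p]
          holo_on_dir_deriv_linear(2)[OF sesqui_onD(2)[OF m p] p] algebra_simps)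
    show "(dbar_deriv m (axis i \<i>) p p * K p p - m p p * dbar_deriv K (axis i \<i>) p p) / (K p p)\<^sup>2
        = - \<i> * ((dbar_deriv m (axis i 1) p p * K p p - m p p * dbar_deriv K (axis i 1) p p) / (K p p)\<^sup>2)"
      unfolding axis_imaginary
      by (simp add: dbar_deriv_smult[OF sesqui_on_kernel p p] dbar_deriv_smult[OF m p p] diff_divide_distrib algebra_simps)
  qed
  finally show ?thesis unfolding m_def .
qed

lemma bergman_levi:
  assumes p: "p \<in> \<Omega>"
  shows "bergman_form K p u (\<i> *s u)
    = 2 * ((dir_deriv (\<lambda>z. dbar_deriv K u z p) u p * K p p
        - dbar_deriv K u p p * dir_deriv (\<lambda>z. K z p) u p) / (K p p)\<^sup>2)"
proof -
  define m where "m j = dbar_deriv K (axis j 1)" for j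
  have m: "sesqui_on \<Omega> (m j)" for j unfolding m_def by (rule sesqui_on_dbar_deriv[OF sesqui_on_kernel])
  have mu: "sesqui_on \<Omega> (dbar_deriv K u)" by (rule sesqui_on_dbar_deriv[OF sesqui_on_kernel])
  have msum: "dbar_deriv K u z p = (\<Sum>j\<in>UNIV. cnj (u $ j) * m j z p)" if "z \<in> \<Omega>" for z
    unfolding m_def by (rule dbar_deriv_coordinates[OF sesqui_on_kernel that p])
  have d_msum: "dir_deriv (\<lambda>z. dbar_deriv K u z p) v p = (\<Sum>j\<in>UNIV. cnj (u $ j) * dir_deriv (\<lambda>z. m j z p) v p)" for v
  proof -
    have p0: "p + 0 *s v \<in> \<Omega>" using p by simp
    have "((\<lambda>\<zeta>. \<Sum>j\<in>UNIV. cnj (u $ j) * m j (p + \<zeta> *s v) p) has_field_derivative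
        (\<Sum>j\<in>UNIV. cnj (u $ j) * dir_deriv (\<lambda>z. m j z p) v (p + 0 *s v))) (at 0)"
      by (intro DERIV_sum DERIV_cmult holo_on_line[OF sesqui_onD(2)[OF m p] p0])
    moreover have "open ((\<lambda>\<zeta>. p + \<zeta> *s v) -` \<Omega>)"
      by (intro open_vimage open_dom continuous_intros bounded_linear.continuous_on[OF bounded_linear_smult])
    moreover have "0 \<in> (\<lambda>\<zeta>. p + \<zeta> *s v) -` \<Omega>" using p by simp
    ultimately have "((\<lambda>\<zeta>. dbar_deriv K u (p + \<zeta> *s v) p) has_field_derivative
        (\<Sum>j\<in>UNIV. cnj (u $ j) * dir_deriv (\<lambda>z. m j z p) v (p + 0 *s v))) (at 0)"
      by (rule has_field_derivative_transform_within_open) (simp add: msum)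
    then show ?thesis unfolding dir_deriv_def by (simp add: DERIV_imp_deriv)
  qed
  let ?k = "K p p"
  have "(\<Sum>i\<in>UNIV. \<Sum>j\<in>UNIV. d_z i (d_zbar j (\<lambda>z. complex_of_real (ln (Re (K z z))))) p * (u $ i * cnj (u $ j)))
      = (\<Sum>i\<in>UNIV. \<Sum>j\<in>UNIV. (u $ i * (cnj (u $ j) * dir_deriv (\<lambda>z. m j z p) (axis i 1) p)) * (?k / ?k\<^sup>2)
          - ((cnj (u $ j) * m j p p) * (u $ i * dir_deriv (\<lambda>z. K z p) (axis i 1) p)) * (1 / ?k\<^sup>2))"
    unfolding bergman_metric_coefficient[OF p] m_def
    by (intro sum.cong refl) (simp add: divide_inverse algebra_simps)
  also have "\<dots> = (\<Sum>i\<in>UNIV. u $ i * (\<Sum>j\<in>UNIV. cnj (u $ j) * dir_deriv (\<lambda>z. m j z p) (axis i 1) p)) * (?k / ?k\<^sup>2)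
      - ((\<Sum>j\<in>UNIV. cnj (u $ j) * m j p p) * (\<Sum>i\<in>UNIV. u $ i * dir_deriv (\<lambda>z. K z p) (axis i 1) p)) * (1 / ?k\<^sup>2)"
    by (simp only: sum_subtractf sum_distrib_left sum_distrib_right sum_product)
  also have "\<dots> = dir_deriv (\<lambda>z. dbar_deriv K u z p) u p * (?k / ?k\<^sup>2)
      - (dbar_deriv K u p p * dir_deriv (\<lambda>z. K z p) u p) * (1 / ?k\<^sup>2)"
    using dir_deriv_coordinates[OF sesqui_onD(2)[OF mu p] p, of u]
      dir_deriv_coordinates[OF kernel_holo[OF p] p, of u] msum[OF p]
    by (simp add: d_msum)
  finally show ?thesis unfolding bergman_form_def i_ddbar_levi by (simp add: diff_divide_distrib)
qed

end

section \<open>The kernel along an isometric curve\<close>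

lemma cnj_holomorphic:
  assumes "g holomorphic_on ball 0 r" shows "(\<lambda>s. cnj (g (cnj s))) holomorphic_on ball 0 r"
proof -
  have "cnj ` ball 0 r = ball 0 r" unfolding image_cnj_conv_vimage_cnj by auto
  then show ?thesis using holomorphic_on_compose_cnj_cnj[of g "ball 0 r"] assms by (simp add: o_def)
qed

lemma sesqui_on_curve:
  assumes k: "sesqui_on U k" and \<rho>: "0 < \<rho>" and fU: "\<And>t. t \<in> ball 0 \<rho> \<Longrightarrow> f t \<in> U"
    and f: "\<And>t i. t \<in> ball 0 \<rho> \<Longrightarrow> ((\<lambda>t. f t $ i) has_field_derivative f' t $ i) (at t)"
  shows "\<And>s. s \<in> ball 0 \<rho> \<Longrightarrow> (\<lambda>t. k (f t) (f (cnj s))) holomorphic_on ball 0 \<rho>"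
    and "\<And>t. t \<in> ball 0 \<rho> \<Longrightarrow> (\<lambda>s. k (f t) (f (cnj s))) holomorphic_on ball 0 \<rho>"
    and "\<exists>r>0. r \<le> \<rho> \<and> (\<exists>C. \<forall>t\<in>ball 0 r. \<forall>s\<in>ball 0 r. cmod (k (f t) (f (cnj s))) \<le> C)"
proof -
  have cb: "cnj s \<in> ball 0 r" if "s \<in> ball 0 r" for s r using that by simp
  show "(\<lambda>t. k (f t) (f (cnj s))) holomorphic_on ball 0 \<rho>" if s: "s \<in> ball 0 \<rho>" for s
  proof (rule holomorphic_onI)
    fix t :: complex assume t: "t \<in> ball 0 \<rho>"
    have "((\<lambda>t. k (f t) (f (cnj s))) has_field_derivative dir_deriv (\<lambda>z. k z (f (cnj s))) (f' t) (f t)) (at t)"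
      by (rule holo_on_chain[OF sesqui_onD(2)[OF k fU[OF cb[OF s]]] fU[OF t] f[OF t]])
    from has_field_derivative_at_within[OF this]
    show "(\<lambda>t. k (f t) (f (cnj s))) field_differentiable at t within ball 0 \<rho>"
      by (auto simp: field_differentiable_def)
  qed
  show "(\<lambda>s. k (f t) (f (cnj s))) holomorphic_on ball 0 \<rho>" if t: "t \<in> ball 0 \<rho>" for t
  proof (rule holomorphic_onI)
    fix s :: complex assume s: "s \<in> ball 0 \<rho>"
    have "((\<lambda>s. k (f t) (f (cnj s))) has_field_derivative dbar_deriv k (f' (cnj s)) (f t) (f (cnj s))) (at s)"
      by (rule sesqui_on_chain2[OF k fU[OF t] fU[OF cb[OF s]] f[OF cb[OF s]]])
    from has_field_derivative_at_within[OF this]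
    show "(\<lambda>s. k (f t) (f (cnj s))) field_differentiable at s within ball 0 \<rho>"
      by (auto simp: field_differentiable_def)
  qed
  have 0: "(0::complex) \<in> ball 0 \<rho>" using \<rho> by simp
  obtain r C where r: "0 < r" and C: "\<And>z w. z \<in> ball (f 0) r \<Longrightarrow> w \<in> ball (f 0) r \<Longrightarrow> cmod (k z w) \<le> C"
    using sesqui_on_bound[OF k fU[OF 0] fU[OF 0]] by metis
  have "(f has_derivative (\<lambda>h. h *s f' 0)) (at 0)"
    by (intro has_derivative_vecI has_derivative_eq_rhs[OF f[OF 0, unfolded has_field_derivative_def]])
       (simp add: fun_eq_iff mult.commute)
  then have "isCont f 0" by (rule has_derivative_continuous)
  then obtain d where d: "0 < d" "\<And>t. dist t 0 < d \<Longrightarrow> dist (f t) (f 0) < r"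
    using r unfolding continuous_at_eps_delta by blast
  show "\<exists>r>0. r \<le> \<rho> \<and> (\<exists>C. \<forall>t\<in>ball 0 r. \<forall>s\<in>ball 0 r. cmod (k (f t) (f (cnj s))) \<le> C)"
  proof (rule exI[of _ "min d \<rho>"], intro conjI exI[of _ C] ballI)
    fix t s :: complex assume "t \<in> ball 0 (min d \<rho>)" "s \<in> ball 0 (min d \<rho>)"
    then show "cmod (k (f t) (f (cnj s))) \<le> C"
      using d(2)[of t] d(2)[of "cnj s"] by (intro C) (auto simp: dist_commute)
  qed (use d \<rho> in auto)
qed

text \<open>The isometry says that \<open>W(t, s) = \<partial>\<^sub>s log K(f t, f(cnj s)) - 4 \<Sum>\<^sub>i \<plusminus> l\<^sub>i(t) m\<^sub>i'(s)\<close>, where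
  \<open>m\<^sub>i(s) = cnj (l\<^sub>i(cnj s))\<close>, has vanishing \<open>t\<close>-derivative at \<open>s = cnj t\<close>. Hence \<open>V(s) = W(cnj s, s)\<close> is
  holomorphic, and by polarisation \<open>W(t, s) = V(s)\<close> for all \<open>t\<close> and \<open>s\<close>. Integrating in \<open>s\<close> gives
  the exponential formula, up to exchanging the variables by hermitian symmetry.\<close>

lemma (in nash_bergman_kernel) kernel_along_isometric_curve:
  fixes l l' :: "complex \<Rightarrow> complex^'N" and \<epsilon> :: "'N \<Rightarrow> complex"
  assumes \<rho>: "0 < \<rho>" and fU: "\<And>t. t \<in> ball 0 \<rho> \<Longrightarrow> f t \<in> \<Omega>"
    and f: "\<And>t i. t \<in> ball 0 \<rho> \<Longrightarrow> ((\<lambda>t. f t $ i) has_field_derivative f' t $ i) (at t)"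
    and l: "\<And>t i. t \<in> ball 0 \<rho> \<Longrightarrow> ((\<lambda>t. l t $ i) has_field_derivative l' t $ i) (at t)"
    and \<epsilon>: "\<And>i. cnj (\<epsilon> i) = \<epsilon> i"
    and iso: "\<And>t. t \<in> ball 0 \<rho> \<Longrightarrow>
       (dir_deriv (\<lambda>z. dbar_deriv K (f' t) z (f t)) (f' t) (f t) * K (f t) (f t)
        - dbar_deriv K (f' t) (f t) (f t) * dir_deriv (\<lambda>z. K z (f t)) (f' t) (f t)) / (K (f t) (f t))\<^sup>2
       = 4 * (\<Sum>i\<in>UNIV. \<epsilon> i * (l' t $ i * cnj (l' t $ i)))"
  obtains r C h where "0 < r" "r \<le> \<rho>"
    "\<And>t s. t \<in> ball 0 r \<Longrightarrow> s \<in> ball 0 r \<Longrightarrow> K (f t) (f (cnj s)) \<noteq> 0"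
    "\<And>t s. t \<in> ball 0 r \<Longrightarrow> s \<in> ball 0 r \<Longrightarrow>
       K (f t) (f (cnj s)) = C s * exp ((\<Sum>i\<in>UNIV. l t $ i * (4 * \<epsilon> i * cnj (l (cnj s) $ i))) + h t)"
proof -
  have cb: "cnj s \<in> ball 0 r" if "s \<in> ball 0 r" for s r using that by simp
  define k where "k t s = K (f t) (f (cnj s))" for t s
  define n where "n t s = dbar_deriv K (f' (cnj s)) (f t) (f (cnj s))" for t s
  define m where "m j = dbar_deriv K (axis j 1)" for j
  define \<mu> where "\<mu> i s = cnj (l (cnj s) $ i)" for i s
  define \<mu>' where "\<mu>' i s = cnj (l' (cnj s) $ i)" for i s
  note KS = sesqui_on_kernel
  have mS: "sesqui_on \<Omega> (m j)" for j unfolding m_def by (rule sesqui_on_dbar_deriv[OF KS])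
  have dK: "sesqui_on \<Omega> (dbar_deriv K v)" for v by (rule sesqui_on_dbar_deriv[OF KS])
  have f'hol: "(\<lambda>t. f' t $ i) holomorphic_on ball 0 \<rho>" for i
  proof -
    have "(\<lambda>t. f t $ i) holomorphic_on ball 0 \<rho>"
      using f by (intro holomorphic_onI) (meson field_differentiable_at_within field_differentiable_def)
    then have "deriv (\<lambda>t. f t $ i) holomorphic_on ball 0 \<rho>" by (intro holomorphic_deriv) auto
    then show ?thesis by (rule holomorphic_transform) (simp add: DERIV_imp_deriv[OF f])
  qed
  have lhol: "(\<lambda>t. l t $ i) holomorphic_on ball 0 \<rho>" for i
    using l by (intro holomorphic_onI) (meson field_differentiable_at_within field_differentiable_def)
  have l'hol: "(\<lambda>t. l' t $ i) holomorphic_on ball 0 \<rho>" for i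
  proof -
    have "deriv (\<lambda>t. l t $ i) holomorphic_on ball 0 \<rho>" using lhol by (intro holomorphic_deriv) auto
    then show ?thesis by (rule holomorphic_transform) (simp add: DERIV_imp_deriv[OF l])
  qed
  have \<mu>: "(\<mu> i has_field_derivative \<mu>' i s) (at s)" if "s \<in> ball 0 \<rho>" for i s
    using has_field_derivative_cnj_cnj[OF l[OF cb[OF that], of i]] unfolding \<mu>_def \<mu>'_def by (simp add: o_def)
  have \<mu>'hol: "\<mu>' i holomorphic_on ball 0 \<rho>" for i
    unfolding \<mu>'_def by (rule cnj_holomorphic[OF l'hol])
  have kt: "((\<lambda>t. k t s) has_field_derivative dir_deriv (\<lambda>z. K z (f (cnj s))) (f' t) (f t)) (at t)"
    if "t \<in> ball 0 \<rho>" "s \<in> ball 0 \<rho>" for t s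
    unfolding k_def by (rule holo_on_chain[OF kernel_holo[OF fU[OF cb[OF that(2)]]] fU[OF that(1)] f[OF that(1)]])
  have ks: "(k t has_field_derivative n t s) (at s)" if "t \<in> ball 0 \<rho>" "s \<in> ball 0 \<rho>" for t s
    unfolding k_def n_def
    by (rule sesqui_on_chain2[OF KS fU[OF that(1)] fU[OF cb[OF that(2)]] f[OF cb[OF that(2)]]])
  have nt: "((\<lambda>t. n t s) has_field_derivative
      dir_deriv (\<lambda>z. dbar_deriv K (f' (cnj s)) z (f (cnj s))) (f' t) (f t)) (at t)"
    if "t \<in> ball 0 \<rho>" "s \<in> ball 0 \<rho>" for t s
    unfolding n_def
    by (rule holo_on_chain[OF sesqui_onD(2)[OF dK fU[OF cb[OF that(2)]]] fU[OF that(1)] f[OF that(1)]])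
  note kcurve = sesqui_on_curve[OF KS \<rho> fU f, folded k_def]
  have nsum: "n t s = (\<Sum>j\<in>UNIV. cnj (f' (cnj s) $ j) * m j (f t) (f (cnj s)))"
    if "t \<in> ball 0 \<rho>" "s \<in> ball 0 \<rho>" for t s
    unfolding n_def m_def by (rule dbar_deriv_coordinates[OF KS fU[OF that(1)] fU[OF cb[OF that(2)]]])
  have nhol1: "(\<lambda>t. n t s) holomorphic_on ball 0 \<rho>" if "s \<in> ball 0 \<rho>" for s
  proof -
    have "(\<lambda>t. \<Sum>j\<in>UNIV. cnj (f' (cnj s) $ j) * m j (f t) (f (cnj s))) holomorphic_on ball 0 \<rho>"
      using that by (intro holomorphic_on_sum holomorphic_on_mult holomorphic_on_const sesqui_on_curve(1)[OF mS \<rho> fU f])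
    then show ?thesis by (rule holomorphic_transform) (use nsum that in simp)
  qed
  have nhol2: "n t holomorphic_on ball 0 \<rho>" if "t \<in> ball 0 \<rho>" for t
  proof -
    have "(\<lambda>s. \<Sum>j\<in>UNIV. cnj (f' (cnj s) $ j) * m j (f t) (f (cnj s))) holomorphic_on ball 0 \<rho>"
      using that by (intro holomorphic_on_sum holomorphic_on_mult cnj_holomorphic[OF f'hol] sesqui_on_curve(2)[OF mS \<rho> fU f])
    then show ?thesis by (rule holomorphic_transform) (use nsum that in simp)
  qed
  text \<open>All functions of \<open>(t, s)\<close> below are bounded on a common small bidisc.\<close>
  obtain r0 C0 where r0: "0 < r0" "r0 \<le> \<rho>" and "\<forall>t\<in>ball 0 r0. \<forall>s\<in>ball 0 r0. cmod (k t s) \<le> C0"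
    using kcurve(3) by blast
  then have C0: "cmod (k t s) \<le> C0" if "t \<in> ball 0 r0" "s \<in> ball 0 r0" for t s using that by blast
  have "\<forall>j. \<exists>r. 0 < r \<and> r \<le> \<rho> \<and> (\<exists>C. \<forall>t\<in>ball 0 r. \<forall>s\<in>ball 0 r. cmod (m j (f t) (f (cnj s))) \<le> C)"
    using sesqui_on_curve(3)[OF mS \<rho> fU f] by auto
  from choice[OF this] obtain R where R: "\<forall>j. 0 < R j \<and> R j \<le> \<rho> \<and>
      (\<exists>C. \<forall>t\<in>ball 0 (R j). \<forall>s\<in>ball 0 (R j). cmod (m j (f t) (f (cnj s))) \<le> C)" ..
  then have "\<forall>j. \<exists>C. \<forall>t\<in>ball 0 (R j). \<forall>s\<in>ball 0 (R j). cmod (m j (f t) (f (cnj s))) \<le> C" by simp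
  from choice[OF this] obtain B where
    B: "\<forall>j. \<forall>t\<in>ball 0 (R j). \<forall>s\<in>ball 0 (R j). cmod (m j (f t) (f (cnj s))) \<le> B j" ..
  have z0: "(0::complex) \<in> ball 0 r0" using r0 by simp
  have z\<rho>: "(0::complex) \<in> ball 0 \<rho>" using \<rho> by simp
  have k00: "k 0 0 \<noteq> 0" unfolding k_def using diagonal_nonzero[OF fU[OF z\<rho>]] by simp
  have sub0: "ball 0 r0 \<subseteq> ball (0::complex) \<rho>" using r0 by auto
  have "((\<lambda>p. k (fst p) (snd p)) has_derivative
      (\<lambda>p. deriv (\<lambda>\<alpha>. k \<alpha> 0) 0 * fst p + deriv (k 0) 0 * snd p)) (at (0, 0))"
    using sub0 C0
    by (intro separately_holomorphic_has_derivative[OF r0(1)] holomorphic_on_subset[OF _ sub0] kcurve(1,2)) auto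
  then have "isCont (\<lambda>p. k (fst p) (snd p)) (0, 0)" by (rule has_derivative_continuous)
  then have "\<forall>e>0. \<exists>d>0. \<forall>p. dist p (0, 0) < d \<longrightarrow> dist (k (fst p) (snd p)) (k 0 0) < e"
    unfolding continuous_at_eps_delta fst_conv snd_conv .
  moreover have "0 < cmod (k 0 0) / 2" using k00 by simp
  ultimately obtain d where d: "0 < d"
      "\<And>p. dist p (0, 0) < d \<Longrightarrow> dist (k (fst p) (snd p)) (k 0 0) < cmod (k 0 0) / 2"
    by meson
  define r1 where "r1 = Min (insert (\<rho> / 2) (insert r0 (insert (d / 2) (range R))))"
  have fin: "finite (insert (\<rho> / 2) (insert r0 (insert (d / 2) (range R))))" by simp
  have "r1 \<in> insert (\<rho> / 2) (insert r0 (insert (d / 2) (range R)))"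
    unfolding r1_def by (rule Min_in) auto
  then consider "r1 = \<rho> / 2" | "r1 = r0" | "r1 = d / 2" | j where "r1 = R j" by blast
  then have r1: "0 < r1" by cases (use \<rho> r0(1) d(1) R in simp_all)
  have r1le: "r1 \<le> \<rho> / 2" "r1 \<le> r0" "r1 \<le> d / 2" "\<And>j. r1 \<le> R j"
    unfolding r1_def by (rule Min_le[OF fin], simp)+
  have sub: "ball 0 r1 \<subseteq> ball (0::complex) \<rho>" using r1le(1) \<rho> by auto
  have csub: "cball 0 r1 \<subseteq> ball (0::complex) \<rho>" using r1le(1) \<rho> by auto
  have klow: "cmod (k 0 0) / 2 \<le> cmod (k t s)" if "t \<in> ball 0 r1" "s \<in> ball 0 r1" for t s
  proof -
    have "cmod t + cmod s < d" using that r1le(3) by auto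
    then have "dist (t, s) (0, 0) < d"
      using norm_Pair_le[of t s] by (simp add: dist_norm)
    from d(2)[OF this] have "cmod (k t s - k 0 0) < cmod (k 0 0) / 2" by (simp add: dist_norm)
    then show ?thesis using norm_triangle_sub[of "k 0 0" "k t s"] by (simp add: norm_minus_commute)
  qed
  have knz: "k t s \<noteq> 0" if "t \<in> ball 0 r1" "s \<in> ball 0 r1" for t s
    using klow[OF that] k00 by auto
  have bdd: "\<exists>B. \<forall>t\<in>ball 0 r1. cmod (g t) \<le> B" if "g holomorphic_on ball 0 \<rho>" for g
  proof -
    have "continuous_on (cball 0 r1) g"
      using holomorphic_on_imp_continuous_on[OF that] csub by (rule continuous_on_subset)
    then have "bounded (g ` cball 0 r1)" by (intro compact_imp_bounded compact_continuous_image) auto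
    then show ?thesis unfolding bounded_iff by fastforce
  qed
  have "\<forall>j. \<exists>B. \<forall>s\<in>ball 0 r1. cmod (cnj (f' (cnj s) $ j)) \<le> B"
    using bdd[OF cnj_holomorphic[OF f'hol]] by blast
  from choice[OF this] obtain F where F: "\<forall>j. \<forall>s\<in>ball 0 r1. cmod (cnj (f' (cnj s) $ j)) \<le> F j" ..
  have "\<forall>i. \<exists>B. \<forall>t\<in>ball 0 r1. cmod (l t $ i) \<le> B" using bdd[OF lhol] by blast
  from choice[OF this] obtain L where L: "\<forall>i. \<forall>t\<in>ball 0 r1. cmod (l t $ i) \<le> L i" ..
  have "\<forall>i. \<exists>B. \<forall>s\<in>ball 0 r1. cmod (\<mu>' i s) \<le> B" using bdd[OF \<mu>'hol] by blast
  from choice[OF this] obtain M where M: "\<forall>i. \<forall>s\<in>ball 0 r1. cmod (\<mu>' i s) \<le> M i" ..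
  define W where "W t s = n t s / k t s - 4 * (\<Sum>i\<in>UNIV. \<epsilon> i * (l t $ i * \<mu>' i s))" for t s
  have Whol1: "(\<lambda>t. W t s) holomorphic_on ball 0 r1" if "s \<in> ball 0 r1" for s
    unfolding W_def using that sub knz
    by (intro holomorphic_intros holomorphic_on_subset[OF nhol1 sub] holomorphic_on_subset[OF kcurve(1) sub]
        holomorphic_on_subset[OF lhol sub]) auto
  have Whol2: "W t holomorphic_on ball 0 r1" if "t \<in> ball 0 r1" for t
    unfolding W_def using that sub knz
    by (intro holomorphic_intros holomorphic_on_subset[OF nhol2 sub] holomorphic_on_subset[OF kcurve(2) sub]
        holomorphic_on_subset[OF \<mu>'hol sub]) auto
  define CW where "CW = (\<Sum>j\<in>UNIV. F j * B j) / (cmod (k 0 0) / 2) + 4 * (\<Sum>i\<in>UNIV. cmod (\<epsilon> i) * (L i * M i))"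
  have Wbd: "cmod (W t s) \<le> CW" if t: "t \<in> ball 0 r1" and s: "s \<in> ball 0 r1" for t s
  proof -
    have "cmod (n t s) \<le> (\<Sum>j\<in>UNIV. F j * B j)"
      unfolding nsum[OF subsetD[OF sub t] subsetD[OF sub s]]
    proof (rule order_trans[OF norm_sum sum_mono])
      fix j
      have "t \<in> ball 0 (R j)" "s \<in> ball 0 (R j)" using t s r1le(4)[of j] by auto
      then have "cmod (m j (f t) (f (cnj s))) \<le> B j" using B by blast
      moreover have "cmod (cnj (f' (cnj s) $ j)) \<le> F j" using F s by blast
      ultimately show "cmod (cnj (f' (cnj s) $ j) * m j (f t) (f (cnj s))) \<le> F j * B j"
        unfolding norm_mult by (intro mult_mono) (auto intro: order_trans[OF norm_ge_zero])
    qed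
    then have "cmod (n t s / k t s) \<le> (\<Sum>j\<in>UNIV. F j * B j) / (cmod (k 0 0) / 2)"
      unfolding norm_divide using klow[OF t s] k00
      by (intro frac_le) (auto intro: order_trans[OF norm_ge_zero])
    moreover have "cmod (4 * (\<Sum>i\<in>UNIV. \<epsilon> i * (l t $ i * \<mu>' i s))) \<le> 4 * (\<Sum>i\<in>UNIV. cmod (\<epsilon> i) * (L i * M i))"
    proof -
      have "cmod (\<Sum>i\<in>UNIV. \<epsilon> i * (l t $ i * \<mu>' i s)) \<le> (\<Sum>i\<in>UNIV. cmod (\<epsilon> i) * (L i * M i))"
      proof (rule order_trans[OF norm_sum sum_mono])
        fix i
        have "cmod (l t $ i) \<le> L i" "cmod (\<mu>' i s) \<le> M i" using L M t s by blast+
        then have "cmod (l t $ i) * cmod (\<mu>' i s) \<le> L i * M i"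
          by (intro mult_mono) (auto intro: order_trans[OF norm_ge_zero])
        then show "cmod (\<epsilon> i * (l t $ i * \<mu>' i s)) \<le> cmod (\<epsilon> i) * (L i * M i)"
          unfolding norm_mult by (intro mult_left_mono) auto
      qed
      then show ?thesis by (simp add: norm_mult)
    qed
    ultimately show ?thesis unfolding W_def CW_def by (intro order_trans[OF norm_triangle_ineq4] add_mono)
  qed
  have Wt0: "((\<lambda>t. W t (cnj t0)) has_field_derivative 0) (at t0)" if t0: "t0 \<in> ball 0 r1" for t0
  proof -
    have t: "t0 \<in> ball 0 \<rho>" "cnj t0 \<in> ball 0 \<rho>" using t0 sub by auto
    have nz: "k t0 (cnj t0) \<noteq> 0" using t0 by (intro knz) auto
    let ?s = "cnj t0"
    have "((\<lambda>t. W t ?s) has_field_derivative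
        (dir_deriv (\<lambda>z. dbar_deriv K (f' (cnj ?s)) z (f (cnj ?s))) (f' t0) (f t0) * k t0 ?s
          - n t0 ?s * dir_deriv (\<lambda>z. K z (f (cnj ?s))) (f' t0) (f t0)) / (k t0 ?s * k t0 ?s)
        - 4 * (\<Sum>i\<in>UNIV. \<epsilon> i * (l' t0 $ i * \<mu>' i ?s))) (at t0)"
      unfolding W_def
      by (intro DERIV_diff DERIV_divide[OF nt[OF t] kt[OF t] nz] DERIV_cmult DERIV_sum DERIV_cmult_right l t)
    then show ?thesis
      using iso[OF t(1)] by (simp add: k_def n_def \<mu>'_def power2_eq_square)
  qed
  define V where "V s = W (cnj s) s" for s
  have Vd: "\<exists>D. (V has_field_derivative D) (at s)" if s: "s \<in> ball 0 r1" for s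
  proof -
    define e where "e = r1 - cmod s"
    have e: "0 < e" using s by (simp add: e_def)
    have es: "ball s e \<subseteq> ball 0 r1" "ball (cnj s) e \<subseteq> ball 0 r1"
      by (auto simp: e_def intro!: ball_subset_of_center)
    have "((\<lambda>s. W (cnj s) s) has_derivative
        (\<lambda>v. deriv (\<lambda>\<alpha>. W \<alpha> s) (cnj s) * cnj v + deriv (W (cnj s)) s * v)) (at s)"
      using es e
      by (intro separately_holomorphic_compose[where r = e and C = CW])
         (auto intro!: Whol1[THEN holomorphic_on_subset] Whol2[THEN holomorphic_on_subset] Wbd
           bounded_linear_imp_has_derivative bounded_linear_cnj)
    moreover have "deriv (\<lambda>\<alpha>. W \<alpha> s) (cnj s) = 0"
      using DERIV_imp_deriv[OF Wt0[OF cb[OF s]]] by simp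
    ultimately have "(V has_derivative (\<lambda>v. deriv (W (cnj s)) s * v)) (at s)" unfolding V_def by simp
    then show ?thesis unfolding has_field_derivative_def by (intro exI)
  qed
  have Vhol: "V holomorphic_on ball 0 r1"
    using Vd by (auto simp: holomorphic_on_open)
  have Vbd: "cmod (V s) \<le> CW" if "s \<in> ball 0 r1" for s
    unfolding V_def by (intro Wbd cb that)
  define r where "r = r1 / 2"
  have r: "0 < r" "r < r1" using r1 by (auto simp: r_def)
  have rsub: "ball 0 r \<subseteq> ball (0::complex) r1" "ball 0 r \<subseteq> ball (0::complex) \<rho>" using r sub by auto
  have WV: "W t s = V s" if "t \<in> ball 0 r" "s \<in> ball 0 r" for t s
  proof -
    have "W t s - V s = 0"
    proof (rule polarisation[where k = "\<lambda>t s. W t s - V s", OF r1])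
      show "(\<lambda>\<alpha>. W \<alpha> \<beta> - V \<beta>) holomorphic_on ball 0 r1" if "\<beta> \<in> ball 0 r1" for \<beta>
        by (intro holomorphic_on_diff Whol1 that holomorphic_on_const)
      show "(\<lambda>\<beta>. W \<alpha> \<beta> - V \<beta>) holomorphic_on ball 0 r1" if "\<alpha> \<in> ball 0 r1" for \<alpha>
        by (intro holomorphic_on_diff Whol2 that Vhol)
      show "cmod (W \<alpha> \<beta> - V \<beta>) \<le> CW + CW" if "\<alpha> \<in> ball 0 r1" "\<beta> \<in> ball 0 r1" for \<alpha> \<beta>
        by (intro order_trans[OF norm_triangle_ineq4] add_mono Wbd Vbd that)
      show "W t (cnj t) - V (cnj t) = 0" for t by (simp add: V_def)
    qed (use that in \<open>simp_all add: r_def\<close>)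
    then show ?thesis by simp
  qed
  obtain H where H: "\<And>s. s \<in> ball 0 r \<Longrightarrow> (H has_field_derivative V s) (at s within ball 0 r)"
    using holomorphic_convex_primitive'[OF convex_ball open_ball holomorphic_on_subset[OF Vhol rsub(1)]] by blast
  define E where "E t s = (\<Sum>i\<in>UNIV. l t $ i * (4 * \<epsilon> i * \<mu> i s)) + H s" for t s
  have ksol: "k t s = k t 0 * exp (- E t 0) * exp (E t s)" if t: "t \<in> ball 0 r" and s: "s \<in> ball 0 r" for t s
  proof -
    define Q where "Q s = k t s * exp (- E t s)" for s
    have Qd: "(Q has_field_derivative 0) (at s)" if s: "s \<in> ball 0 r" for s
    proof -
      have sr: "s \<in> ball 0 \<rho>" "t \<in> ball 0 \<rho>" using s t rsub by auto
      have Hs: "(H has_field_derivative V s) (at s)"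
        using H[OF s] at_within_open[OF s open_ball] by simp
      have Es: "(E t has_field_derivative (\<Sum>i\<in>UNIV. l t $ i * (4 * \<epsilon> i * \<mu>' i s)) + V s) (at s)"
        unfolding E_def by (intro DERIV_add DERIV_sum DERIV_cmult \<mu>[OF sr(1)] Hs)
      have "(Q has_field_derivative n t s * exp (- E t s)
          + (exp (- E t s) * - ((\<Sum>i\<in>UNIV. l t $ i * (4 * \<epsilon> i * \<mu>' i s)) + V s)) * k t s) (at s)"
        unfolding Q_def by (intro DERIV_mult' DERIV_mult ks[OF sr(2,1)] DERIV_chain2[OF DERIV_exp] DERIV_minus Es)
      moreover have "n t s = ((\<Sum>i\<in>UNIV. l t $ i * (4 * \<epsilon> i * \<mu>' i s)) + V s) * k t s"
      proof -
        have "n t s / k t s = 4 * (\<Sum>i\<in>UNIV. \<epsilon> i * (l t $ i * \<mu>' i s)) + V s"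
          using WV[OF t s] unfolding W_def by (simp add: algebra_simps)
        moreover have "4 * (\<Sum>i\<in>UNIV. \<epsilon> i * (l t $ i * \<mu>' i s)) = (\<Sum>i\<in>UNIV. l t $ i * (4 * \<epsilon> i * \<mu>' i s))"
          by (simp add: sum_distrib_left mult_ac)
        moreover have "k t s \<noteq> 0" using t s rsub by (intro knz) auto
        ultimately show ?thesis by (simp add: nonzero_divide_eq_eq)
      qed
      ultimately show ?thesis by (simp add: algebra_simps)
    qed
    have "\<exists>c. \<forall>x\<in>ball 0 r. Q x = c"
      by (rule has_field_derivative_zero_constant[OF convex_ball], rule has_field_derivative_at_within, rule Qd)
    then have "Q s = Q 0" using s r by (metis centre_in_ball)
    then show ?thesis unfolding Q_def by (metis exp_minus_inverse mult.assoc mult.commute mult.right_neutral)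
  qed
  show ?thesis
  proof (rule that[of r "\<lambda>s. cnj (k (cnj s) 0 * exp (- E (cnj s) 0))" "\<lambda>t. cnj (H (cnj t))"])
    show "0 < r" "r \<le> \<rho>" using r sub r1le(1) \<rho> by auto
    fix t s :: complex assume t: "t \<in> ball 0 r" and s: "s \<in> ball 0 r"
    show "K (f t) (f (cnj s)) \<noteq> 0" using knz[of t s] t s r by (simp add: k_def)
    have "K (f t) (f (cnj s)) = cnj (K (f (cnj s)) (f t))"
      using t s rsub by (intro hermitian fU) auto
    also have "\<dots> = cnj (k (cnj s) (cnj t))" by (simp add: k_def)
    also have "\<dots> = cnj (k (cnj s) 0 * exp (- E (cnj s) 0)) * exp (cnj (E (cnj s) (cnj t)))"
      using ksol[OF cb[OF s] cb[OF t]] by (simp add: exp_cnj)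
    also have "cnj (E (cnj s) (cnj t)) = (\<Sum>i\<in>UNIV. l t $ i * (4 * \<epsilon> i * cnj (l (cnj s) $ i))) + cnj (H (cnj t))"
      by (simp add: E_def \<mu>_def \<epsilon> mult_ac)
    finally show "K (f t) (f (cnj s)) = cnj (k (cnj s) 0 * exp (- E (cnj s) 0))
        * exp ((\<Sum>i\<in>UNIV. l t $ i * (4 * \<epsilon> i * cnj (l (cnj s) $ i))) + cnj (H (cnj t)))" .
  qed
qed

section \<open>Sums of points of a curve\<close>

text \<open>Let \<open>B\<^sub>1\<close> be a maximal independent set of velocities \<open>c' s\<close> of the curve \<open>c\<close>. The sum of
  \<open>card B\<^sub>1\<close> increments of \<open>c\<close> at the corresponding parameters has the span of \<open>B\<^sub>1\<close> as image of its
  derivative, so that it reaches all small vectors of this span. Completing \<open>B\<^sub>1\<close> to a basis, with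
  linear terms for the added basis vectors, puts this in the form of the open mapping theorem for a
  surjective derivative. The added terms are recovered as zero, since the coordinates outside \<open>B\<^sub>1\<close> do
  not change along \<open>c\<close>.\<close>

lemma curve_increments_fill_span:
  fixes c c' :: "complex \<Rightarrow> complex^'N"
  assumes c: "\<And>s i. s \<in> ball 0 r \<Longrightarrow> ((\<lambda>s. c s $ i) has_field_derivative c' s $ i) (at s)"
    and r: "0 < r"
    and B1: "B1 \<subseteq> c' ` ball 0 r" "vec.independent B1" "c' ` ball 0 r \<subseteq> vec.span B1"
    and v: "v \<in> B1"
  obtains \<delta> where "0 < \<delta>"
    "\<And>\<tau>. cmod \<tau> < \<delta> \<Longrightarrow> \<exists>(I :: 'N set) s s'. (\<forall>i\<in>I. s i \<in> ball 0 r \<and> s' i \<in> ball 0 r) \<and>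
        \<tau> *s v = (\<Sum>i\<in>I. c (s' i) - c (s i))"
proof -
  obtain B where B: "B1 \<subseteq> B" "vec.independent B" "UNIV \<subseteq> vec.span B"
    using vec.maximal_independent_subset_extend[OF subset_UNIV B1(2)] by metis
  have span: "w \<in> vec.span B" for w using B(3) by auto
  have finB: "finite B" using vec.finiteI_independent[OF B(2)] .
  have "card B = CARD('N)"
    using vec.dim_unique[OF subset_UNIV B(3) B(2) refl] vec_dim_card by metis
  then obtain \<beta> :: "'N \<Rightarrow> complex^'N" where \<beta>: "bij_betw \<beta> UNIV B"
    using finite_same_card_bij[OF finite finB] by metis
  have \<beta>B: "\<beta> i \<in> B" for i using \<beta> by (auto simp: bij_betw_def)
  have \<beta>inj: "\<beta> i = \<beta> j \<longleftrightarrow> i = j" for i j using \<beta> by (auto simp: bij_betw_def inj_on_def)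
  define \<phi> where "\<phi> w b = vec.representation B w b" for w b
  have \<phi>_add: "\<phi> (w + x) b = \<phi> w b + \<phi> x b" for w x b
    unfolding \<phi>_def using vec.representation_add[OF B(2) span span] by simp
  have \<phi>_scale: "\<phi> (a *s w) b = a * \<phi> w b" for a w b
    unfolding \<phi>_def using vec.representation_scale[OF B(2) span] by simp
  have \<phi>_linear: "linear (\<lambda>w. \<phi> w b)" for b
  proof (rule linearI)
    show "\<phi> (x + y) b = \<phi> x b + \<phi> y b" for x y by (rule \<phi>_add)
    show "\<phi> (a *\<^sub>R x) b = a *\<^sub>R \<phi> x b" for a x
      using \<phi>_scale[of "of_real a" x b] by (simp add: of_real_smult scaleR_conv_of_real[where 'a = complex])
  qed
  have \<phi>_blin: "bounded_linear (\<lambda>w. \<phi> w b)" for b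
    using \<phi>_linear by (simp add: linear_conv_bounded_linear)
  have \<phi>_basis: "\<phi> (\<beta> i) (\<beta> j) = (if i = j then 1 else 0)" for i j
    unfolding \<phi>_def using vec.representation_basis[OF B(2) \<beta>B] by (auto simp: \<beta>inj)
  have expand: "w = (\<Sum>i\<in>UNIV. \<phi> w (\<beta> i) *s \<beta> i)" for w
  proof -
    have "w = (\<Sum>b\<in>B. \<phi> w b *s b)"
      unfolding \<phi>_def using vec.sum_representation_eq[OF B(2) span finB subset_refl] by simp
    also have "\<dots> = (\<Sum>i\<in>UNIV. \<phi> w (\<beta> i) *s \<beta> i)"
      by (rule sum.reindex_bij_betw[OF \<beta>, symmetric])
    finally show ?thesis .
  qed
  have \<phi>_span: "\<phi> w b = 0" if "w \<in> vec.span B1" "b \<notin> B1" for w b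
  proof -
    have "vec.representation B w = vec.representation B1 w"
      by (rule vec.representation_extend[OF B(2) that(1) B(1)])
    then show ?thesis unfolding \<phi>_def using vec.representation_ne_zero[of B1 w b] that(2) by auto
  qed
  have dc: "(c has_derivative (\<lambda>h. h *s c' s)) (at s)" if "s \<in> ball 0 r" for s
    by (intro has_derivative_vecI has_derivative_eq_rhs[OF c[OF that, unfolded has_field_derivative_def]])
       (simp add: fun_eq_iff mult.commute)
  have \<phi>_const: "\<phi> (c s) b = \<phi> (c s') b" if ss: "s \<in> ball 0 r" "s' \<in> ball 0 r" and b: "b \<notin> B1" for s s' b
  proof -
    have "((\<lambda>s. \<phi> (c s) b) has_derivative (\<lambda>h. 0)) (at s within ball 0 r)" if s: "s \<in> ball 0 r" for s
    proof -
      have "((\<lambda>s. \<phi> (c s) b) has_derivative (\<lambda>h. \<phi> (h *s c' s) b)) (at s)"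
        by (rule bounded_linear.has_derivative[OF \<phi>_blin dc[OF s]])
      moreover have "\<phi> (h *s c' s) b = 0" for h
        using \<phi>_span[OF subsetD[OF B1(3) imageI[OF s]] b] by (simp add: \<phi>_scale)
      ultimately show ?thesis by (simp add: has_derivative_at_withinI)
    qed
    then have "\<exists>k. \<forall>x\<in>ball 0 r. \<phi> (c x) b = k"
      by (intro has_derivative_zero_constant convex_ball)
    then obtain k where "\<forall>x\<in>ball 0 r. \<phi> (c x) b = k" ..
    then show ?thesis using ss by simp
  qed
  have "\<forall>i. \<exists>s. \<beta> i \<in> B1 \<longrightarrow> s \<in> ball 0 r \<and> c' s = \<beta> i"
  proof
    fix i
    show "\<exists>s. \<beta> i \<in> B1 \<longrightarrow> s \<in> ball 0 r \<and> c' s = \<beta> i"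
    proof (cases "\<beta> i \<in> B1")
      case True
      then have "\<beta> i \<in> c' ` ball 0 r" by (rule subsetD[OF B1(1)])
      then show ?thesis by (elim imageE) (intro exI impI conjI, assumption, rule sym)
    qed simp
  qed
  from choice[OF this] obtain s where s: "\<forall>i. \<beta> i \<in> B1 \<longrightarrow> s i \<in> ball 0 r \<and> c' (s i) = \<beta> i" ..
  define \<Phi> where "\<Phi> \<sigma> = (\<Sum>i\<in>UNIV. if \<beta> i \<in> B1 then c (s i + \<sigma> $ i) - c (s i) else \<sigma> $ i *s \<beta> i)"
    for \<sigma> :: "complex^'N"
  define S where "S = {\<sigma> :: complex^'N. \<forall>i. \<beta> i \<in> B1 \<longrightarrow> s i + \<sigma> $ i \<in> ball 0 r}"
  have S: "open S"
  proof -
    have "S = (\<Inter>i\<in>{i. \<beta> i \<in> B1}. (\<lambda>\<sigma>. s i + \<sigma> $ i) -` ball 0 r)" by (auto simp: S_def)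
    then show ?thesis
      by (auto intro!: open_INT open_vimage continuous_intros)
  qed
  have S0: "0 \<in> S" using s by (simp add: S_def)
  have dterm: "((\<lambda>\<sigma>. if \<beta> i \<in> B1 then c (s i + \<sigma> $ i) - c (s i) else \<sigma> $ i *s \<beta> i) has_derivative
      (\<lambda>h. h $ i *s (if \<beta> i \<in> B1 then c' (s i + \<sigma> $ i) else \<beta> i))) (at \<sigma>)" if "\<sigma> \<in> S" for \<sigma> i
  proof (cases "\<beta> i \<in> B1")
    case True
    then have "s i + \<sigma> $ i \<in> ball 0 r" using that by (simp add: S_def)
    note d = dc[OF this]
    have "((\<lambda>\<sigma>. s i + \<sigma> $ i) has_derivative (\<lambda>h. h $ i)) (at \<sigma>)"
      by (auto intro!: derivative_eq_intros bounded_linear_imp_has_derivative bounded_linear_vec_nth)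
    from has_derivative_compose[OF this d]
    have "((\<lambda>\<sigma>. c (s i + \<sigma> $ i) - c (s i)) has_derivative (\<lambda>h. h $ i *s c' (s i + \<sigma> $ i) - 0)) (at \<sigma>)"
      by (intro has_derivative_diff has_derivative_const)
    then show ?thesis using True by simp
  next
    case False
    have "((\<lambda>\<sigma>. \<sigma> $ i *s \<beta> i) has_derivative (\<lambda>h. h $ i *s \<beta> i)) (at \<sigma>)"
      by (intro bounded_linear.has_derivative[OF bounded_linear_smult]
          bounded_linear_imp_has_derivative bounded_linear_vec_nth)
    then show ?thesis using False by simp
  qed
  have d\<Phi>: "(\<Phi> has_derivative (\<lambda>h. \<Sum>i\<in>UNIV. h $ i *s (if \<beta> i \<in> B1 then c' (s i + \<sigma> $ i) else \<beta> i))) (at \<sigma>)"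
    if "\<sigma> \<in> S" for \<sigma>
    unfolding \<Phi>_def by (intro has_derivative_sum dterm that)
  have \<Phi>0: "\<Phi> 0 = 0" by (simp add: \<Phi>_def cong: if_cong)
  define T where "T h = (\<Sum>i\<in>UNIV. h $ i *s \<beta> i)" for h :: "complex^'N"
  define g where "g w = (\<chi> i. \<phi> w (\<beta> i))" for w
  have "(\<lambda>h::complex^'N. \<Sum>i\<in>UNIV. h $ i *s (if \<beta> i \<in> B1 then c' (s i + 0 $ i) else \<beta> i)) = T"
    unfolding T_def using s by (intro ext sum.cong refl) auto
  then have d0: "(\<Phi> has_derivative T) (at 0)" using d\<Phi>[OF S0] by simp
  have "linear g"
  proof (rule linearI)
    show "g (x + y) = g x + g y" for x y by (simp add: g_def vec_eq_iff \<phi>_add)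
    show "g (a *\<^sub>R x) = a *\<^sub>R g x" for a x
      using linear_scale[OF \<phi>_linear] by (simp add: g_def vec_eq_iff)
  qed
  then have g: "bounded_linear g" by (simp add: linear_conv_bounded_linear)
  have Tg: "T \<circ> g = id"
    unfolding T_def g_def using expand by (auto simp: fun_eq_iff)
  have cont: "continuous_on S \<Phi>"
    using d\<Phi> by (intro continuous_at_imp_continuous_on) (blast intro: has_derivative_continuous)
  have "\<Phi> 0 \<in> interior (\<Phi> ` S)"
    by (rule sussmann_open_mapping[OF S cont S0 d0 g Tg subset_refl]) (simp add: interior_open S S0)
  then obtain e where e: "0 < e" "ball 0 e \<subseteq> \<Phi> ` S" unfolding \<Phi>0 mem_interior by blast
  have n1: "0 < norm v + 1" by (simp add: add_nonneg_pos)
  show ?thesis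
  proof (rule that[of "e / (norm v + 1)"])
    show "0 < e / (norm v + 1)" using e n1 by simp
    fix \<tau> assume "cmod \<tau> < e / (norm v + 1)"
    then have "cmod \<tau> * (norm v + 1) < e" by (simp only: pos_less_divide_eq[OF n1])
    moreover have "cmod \<tau> * norm v \<le> cmod \<tau> * (norm v + 1)" by (intro mult_left_mono) auto
    ultimately have "\<tau> *s v \<in> ball 0 e" by (simp add: norm_complex_smult)
    then obtain \<sigma> where \<sigma>: "\<sigma> \<in> S" "\<tau> *s v = \<Phi> \<sigma>" using e(2) by blast
    have zero: "\<sigma> $ j = 0" if j: "\<beta> j \<notin> B1" for j
    proof -
      have "\<phi> (\<tau> *s v) (\<beta> j) = 0"
        using \<phi>_span[OF vec.span_base[OF v] j] by (simp add: \<phi>_scale)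
      moreover have "\<phi> (\<Phi> \<sigma>) (\<beta> j)
          = (\<Sum>i\<in>UNIV. \<phi> (if \<beta> i \<in> B1 then c (s i + \<sigma> $ i) - c (s i) else \<sigma> $ i *s \<beta> i) (\<beta> j))"
        unfolding \<Phi>_def by (rule linear_sum[OF \<phi>_linear])
      moreover have "\<dots> = (\<Sum>i\<in>UNIV. if i = j then \<sigma> $ j else 0)"
      proof (rule sum.cong[OF refl])
        fix i
        show "\<phi> (if \<beta> i \<in> B1 then c (s i + \<sigma> $ i) - c (s i) else \<sigma> $ i *s \<beta> i) (\<beta> j) = (if i = j then \<sigma> $ j else 0)"
        proof (cases "\<beta> i \<in> B1")
          case True
          then have "\<phi> (c (s i + \<sigma> $ i)) (\<beta> j) = \<phi> (c (s i)) (\<beta> j)"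
            using \<sigma>(1) s j by (intro \<phi>_const) (auto simp: S_def)
          then show ?thesis using True j linear_diff[OF \<phi>_linear] by auto
        next
          case False
          then show ?thesis by (simp add: \<phi>_scale \<phi>_basis)
        qed
      qed
      ultimately show ?thesis using \<sigma>(2) by simp
    qed
    have "\<Phi> \<sigma> = (\<Sum>i\<in>{i. \<beta> i \<in> B1}. c (s i + \<sigma> $ i) - c (s i))"
      unfolding \<Phi>_def by (rule sum.mono_neutral_cong_right) (auto simp: zero)
    then show "\<exists>(I :: 'N set) s s'. (\<forall>i\<in>I. s i \<in> ball 0 r \<and> s' i \<in> ball 0 r) \<and>
        \<tau> *s v = (\<Sum>i\<in>I. c (s' i) - c (s i))"
      using \<sigma> s by (intro exI[of _ "{i. \<beta> i \<in> B1}"] exI[of _ s] exI[of _ "\<lambda>i. s i + \<sigma> $ i"]) (auto simp: S_def)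
  qed
qed

section \<open>Power series of functions along a curve\<close>

definition germ :: "(complex \<Rightarrow> complex) \<Rightarrow> complex fps" where
  "germ g = fps_expansion g 0"

context
  fixes r :: real
  assumes r: "0 < r"
begin

lemma germ_expansion: "g holomorphic_on ball 0 r \<Longrightarrow> g has_fps_expansion germ g"
  unfolding germ_def using r by (intro has_fps_expansion_fps_expansion[of "ball 0 r"]) auto

lemma germ_unique: "g holomorphic_on ball 0 r \<Longrightarrow> g has_fps_expansion G \<Longrightarrow> germ g = G"
  using fps_expansion_unique_complex[OF germ_expansion] .

lemma germ_const: "germ (\<lambda>_. c) = fps_const c"
  by (rule germ_unique) (auto intro: has_fps_expansion_const)

lemma germ_add:
  assumes "f holomorphic_on ball 0 r" "g holomorphic_on ball 0 r"
  shows "germ (\<lambda>t. f t + g t) = germ f + germ g"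
  by (rule germ_unique) (intro holomorphic_on_add has_fps_expansion_add germ_expansion assms)+

lemma germ_mult:
  assumes "f holomorphic_on ball 0 r" "g holomorphic_on ball 0 r"
  shows "germ (\<lambda>t. f t * g t) = germ f * germ g"
  by (rule germ_unique) (intro holomorphic_on_mult has_fps_expansion_mult germ_expansion assms)+

lemma germ_power:
  assumes "f holomorphic_on ball 0 r"
  shows "germ (\<lambda>t. f t ^ n) = germ f ^ n"
proof (induction n)
  case (Suc n)
  have "germ (\<lambda>t. f t * f t ^ n) = germ f * germ (\<lambda>t. f t ^ n)"
    by (intro germ_mult assms holomorphic_on_power)
  then show ?case using Suc by simp
qed (simp add: germ_const)

lemma germ_sum:
  assumes "\<And>i. i \<in> I \<Longrightarrow> f i holomorphic_on ball 0 r"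
  shows "germ (\<lambda>t. \<Sum>i\<in>I. f i t) = (\<Sum>i\<in>I. germ (f i))"
  using assms
proof (induction I rule: infinite_finite_induct)
  case (insert i I)
  have "germ (\<lambda>t. f i t + (\<Sum>j\<in>I. f j t)) = germ (f i) + germ (\<lambda>t. \<Sum>j\<in>I. f j t)"
    using insert.prems by (intro germ_add holomorphic_on_sum) auto
  then show ?case using insert by simp
qed (simp_all add: germ_const)

lemma germ_prod:
  assumes "\<And>i. i \<in> I \<Longrightarrow> f i holomorphic_on ball 0 r"
  shows "germ (\<lambda>t. \<Prod>i\<in>I. f i t) = (\<Prod>i\<in>I. germ (f i))"
  using assms
proof (induction I rule: infinite_finite_induct)
  case (insert i I)
  have "germ (\<lambda>t. f i t * (\<Prod>j\<in>I. f j t)) = germ (f i) * germ (\<lambda>t. \<Prod>j\<in>I. f j t)"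
    using insert.prems by (intro germ_mult holomorphic_on_prod) auto
  then show ?case using insert by simp
qed (simp_all add: germ_const)

lemma germ_cong:
  assumes "f holomorphic_on ball 0 r" "\<And>t. t \<in> ball 0 r \<Longrightarrow> f t = g t"
  shows "germ f = germ g"
proof (rule germ_unique[OF assms(1)])
  have "g has_fps_expansion germ g"
    by (rule germ_expansion[OF holomorphic_transform[OF assms]])
  moreover have "\<forall>\<^sub>F t in nhds 0. f t = g t"
    using r eventually_nhds_in_open[of "ball 0 r" "0::complex"] by (auto elim!: eventually_mono intro: assms(2))
  ultimately show "f has_fps_expansion germ g" by (simp add: has_fps_expansion_cong)
qed

lemma germ_eq_0D:
  assumes "f holomorphic_on ball 0 r" "germ f = 0" "t \<in> ball 0 r"
  shows "f t = 0"
proof (rule has_fps_expansion_0_analytic_continuation[of f "ball 0 r"])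
  show "f has_fps_expansion 0" using germ_expansion[OF assms(1)] assms(2) by simp
qed (use assms r in auto)

lemma germ_exponential_family:
  assumes x: "\<And>t. t \<in> ball 0 r \<Longrightarrow> (x has_field_derivative x' t) (at t)"
    and nz: "t0 \<in> ball 0 r" "x' t0 \<noteq> 0"
  shows "exponential_family (\<lambda>\<tau>. germ (\<lambda>t. exp (\<tau> * x t))) (germ x')"
proof
  have xh: "x holomorphic_on ball 0 r"
    using x by (intro holomorphic_onI) (meson field_differentiable_at_within field_differentiable_def)
  have x'h: "x' holomorphic_on ball 0 r"
  proof -
    have "deriv x holomorphic_on ball 0 r" by (intro holomorphic_deriv xh open_ball)
    then show ?thesis by (rule holomorphic_transform) (simp add: DERIV_imp_deriv[OF x])
  qed
  have eh: "(\<lambda>t. exp (\<tau> * x t)) holomorphic_on ball 0 r" for \<tau>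
    by (intro holomorphic_intros xh)
  show "germ (\<lambda>t. exp ((\<tau> + \<mu>) * x t)) = germ (\<lambda>t. exp (\<tau> * x t)) * germ (\<lambda>t. exp (\<mu> * x t))" for \<tau> \<mu>
    using germ_mult[OF eh[of \<tau>] eh[of \<mu>]] by (simp add: distrib_right exp_add)
  show "germ (\<lambda>t. exp (0 * x t)) = 1" by (simp add: germ_const)
  show "fps_deriv (germ (\<lambda>t. exp (\<tau> * x t))) = fps_const \<tau> * germ x' * germ (\<lambda>t. exp (\<tau> * x t))" for \<tau>
  proof -
    have "deriv (\<lambda>t. exp (\<tau> * x t)) has_fps_expansion fps_deriv (germ (\<lambda>t. exp (\<tau> * x t)))"
      by (rule has_fps_expansion_deriv[OF germ_expansion[OF eh]])
    moreover have "deriv (\<lambda>t. exp (\<tau> * x t)) holomorphic_on ball 0 r"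
      by (intro holomorphic_deriv eh open_ball)
    ultimately have "fps_deriv (germ (\<lambda>t. exp (\<tau> * x t))) = germ (deriv (\<lambda>t. exp (\<tau> * x t)))"
      using germ_unique by simp
    also have "\<dots> = germ (\<lambda>t. \<tau> * x' t * exp (\<tau> * x t))"
    proof (rule germ_cong)
      show "deriv (\<lambda>t. exp (\<tau> * x t)) holomorphic_on ball 0 r"
        by (intro holomorphic_deriv eh open_ball)
      fix t :: complex assume t: "t \<in> ball 0 r"
      have "((\<lambda>t. exp (\<tau> * x t)) has_field_derivative exp (\<tau> * x t) * (\<tau> * x' t)) (at t)"
        by (intro DERIV_chain2[OF DERIV_exp] DERIV_cmult x t)
      then show "deriv (\<lambda>t. exp (\<tau> * x t)) t = \<tau> * x' t * exp (\<tau> * x t)"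
        by (simp add: DERIV_imp_deriv mult.commute)
    qed
    also have "\<dots> = germ (\<lambda>t. \<tau> * x' t) * germ (\<lambda>t. exp (\<tau> * x t))"
      by (rule germ_mult[OF _ eh]) (intro holomorphic_intros x'h)
    also have "germ (\<lambda>t. \<tau> * x' t) = fps_const \<tau> * germ x'"
      using germ_mult[OF holomorphic_on_const x'h] by (simp add: germ_const)
    finally show ?thesis .
  qed
  show "germ x' \<noteq> 0" using germ_eq_0D[OF x'h _ nz(1)] nz(2) by blast
qed

text \<open>The ring \<open>\<complex>[f\<^sub>1, \<dots>, f\<^sub>n]\<close> of polynomials in the components of a curve is spanned by the countably
  many monomials.\<close>

definition curve_monomial :: "(complex \<Rightarrow> complex^'n) \<Rightarrow> ('n \<Rightarrow> nat) \<Rightarrow> complex fps" where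
  "curve_monomial f e = (\<Prod>i\<in>UNIV. germ (\<lambda>t. f t $ i) ^ e i)"

lemma is_subring_curve: "is_subring (fam_span (curve_monomial f))"
proof (rule is_subring_fam_span)
  show "\<exists>u. curve_monomial f u = 1" by (rule exI[of _ "\<lambda>_. 0"]) (simp add: curve_monomial_def)
  show "\<exists>c. curve_monomial f a * curve_monomial f b = curve_monomial f c" for a b
    by (rule exI[of _ "\<lambda>i. a i + b i"]) (simp add: curve_monomial_def power_add prod.distrib)
qed

lemma fps_const_in_curve_ring: "fps_const a \<in> fam_span (curve_monomial f)"
  using fam_span_scale[OF is_subring_closed(1)[OF is_subring_curve], of a f] by simp

lemma polyfun_along_curve:
  fixes f :: "complex \<Rightarrow> complex^'n"
  assumes f: "\<And>i. (\<lambda>t. f t $ i) holomorphic_on ball 0 r" and q: "polyfun q"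
  shows "(\<lambda>t. q (f t)) holomorphic_on ball 0 r \<and> germ (\<lambda>t. q (f t)) \<in> fam_span (curve_monomial f)"
  using q
proof (induction rule: polyfun.induct)
  case (const c)
  then show ?case by (simp add: germ_const fps_const_in_curve_ring)
next
  case (coord i)
  have "curve_monomial f (\<lambda>j. if j = i then 1 else 0) = (\<Prod>j\<in>UNIV. if j = i then germ (\<lambda>t. f t $ i) else 1)"
    unfolding curve_monomial_def by (rule prod.cong) auto
  then have "germ (\<lambda>t. f t $ i) = curve_monomial f (\<lambda>j. if j = i then 1 else 0)" by simp
  then show ?case using f fam_span_base[of "curve_monomial f"] by metis
next
  case (add p q)
  then show ?case by (auto simp: germ_add intro!: holomorphic_on_add fam_span_add)
next
  case (mult p q)
  then show ?case
    by (auto simp: germ_mult intro!: holomorphic_on_mult is_subring_closed(4)[OF is_subring_curve])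
qed

end

text \<open>The equation for \<open>K(\<cdot>, w)\<close> is taken relative to the image of \<open>f\<close>, so that it stays non-trivial
  when \<open>f\<close> runs inside a proper algebraic subset.\<close>

lemma (in nash_bergman_kernel) kernel_germ_algebraic:
  assumes r: "0 < r" and f: "\<And>i. (\<lambda>t. f t $ i) holomorphic_on ball 0 r" and fU: "\<And>t. t \<in> ball 0 r \<Longrightarrow> f t \<in> \<Omega>"
    and w: "w \<in> \<Omega>" and kh: "(\<lambda>t. K (f t) w) holomorphic_on ball 0 r"
  shows "algebraic_over (fam_span (curve_monomial f)) (germ (\<lambda>t. K (f t) w))"
proof (rule kernel_algebraic_in_first_variable[OF w])
  show "f ` ball 0 r \<subseteq> \<Omega>" "f ` ball 0 r \<noteq> {}" using fU r by auto
  fix d :: nat and q :: "nat \<Rightarrow> complex^'a \<Rightarrow> complex"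
  assume q: "\<And>j. polyfun (q j)" "\<exists>j\<le>d. \<exists>z\<in>f ` ball 0 r. q j z \<noteq> 0"
    and rel: "\<And>z. z \<in> f ` ball 0 r \<Longrightarrow> (\<Sum>j\<le>d. q j z * K z w ^ j) = 0"
  define Q where "Q j = germ (\<lambda>t. q j (f t))" for j
  have qh: "(\<lambda>t. q j (f t)) holomorphic_on ball 0 r" and QS: "Q j \<in> fam_span (curve_monomial f)" for j
    using polyfun_along_curve[OF r f q(1)] by (auto simp: Q_def)
  have "(\<Sum>j\<le>d. Q j * germ (\<lambda>t. K (f t) w) ^ j) = (\<Sum>j\<le>d. germ (\<lambda>t. q j (f t) * K (f t) w ^ j))"
    unfolding Q_def using germ_mult[OF r qh holomorphic_on_power[OF kh]] germ_power[OF r kh] by simp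
  also have "\<dots> = germ (\<lambda>t. \<Sum>j\<le>d. q j (f t) * K (f t) w ^ j)"
    by (rule germ_sum[OF r, symmetric]) (intro holomorphic_on_mult qh holomorphic_on_power kh)
  also have "\<dots> = germ (\<lambda>_. 0)"
    by (rule germ_cong[OF r]) (use rel in \<open>auto intro!: holomorphic_on_sum holomorphic_on_mult qh holomorphic_on_power kh\<close>)
  finally have "(\<Sum>j\<le>d. Q j * germ (\<lambda>t. K (f t) w) ^ j) = 0" by (simp add: germ_const[OF r])
  moreover have "\<exists>j\<le>d. Q j \<noteq> 0"
  proof -
    obtain j t where "j \<le> d" "t \<in> ball 0 r" "q j (f t) \<noteq> 0" using q(2) by blast
    then show ?thesis using germ_eq_0D[OF r qh[of j]] unfolding Q_def by blast
  qed
  ultimately show ?thesis unfolding algebraic_over_def using QS by blast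
qed

section \<open>No isometric curves, and the theorem\<close>

text \<open>By the exponential formula, quotients of values \<open>K(f t, f(cnj s))\<close> at different \<open>s\<close> are, up to
  constants, exponentials of \<open>\<Sum>\<^sub>i l\<^sub>i(t) (c\<^sub>i(s') - c\<^sub>i(s))\<close>. Products of such quotients realise all
  \<open>exp(\<tau> x(t))\<close> with small \<open>\<tau>\<close>, for a non-constant \<open>x\<close>. All of them would be algebraic over
  \<open>\<complex>[f\<^sub>1, \<dots>, f\<^sub>n]\<close>, a ring of countable dimension, which is impossible.\<close>

lemma (in nash_bergman_kernel) no_isometric_curve:
  fixes l l' :: "complex \<Rightarrow> complex^'N" and \<epsilon> :: "'N \<Rightarrow> complex"
  assumes \<rho>: "0 < \<rho>" and fU: "\<And>t. t \<in> ball 0 \<rho> \<Longrightarrow> f t \<in> \<Omega>"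
    and f: "\<And>t i. t \<in> ball 0 \<rho> \<Longrightarrow> ((\<lambda>t. f t $ i) has_field_derivative f' t $ i) (at t)"
    and l: "\<And>t i. t \<in> ball 0 \<rho> \<Longrightarrow> ((\<lambda>t. l t $ i) has_field_derivative l' t $ i) (at t)"
    and \<epsilon>: "\<And>i. cnj (\<epsilon> i) = \<epsilon> i"
    and iso: "\<And>t. t \<in> ball 0 \<rho> \<Longrightarrow>
       (dir_deriv (\<lambda>z. dbar_deriv K (f' t) z (f t)) (f' t) (f t) * K (f t) (f t)
        - dbar_deriv K (f' t) (f t) (f t) * dir_deriv (\<lambda>z. K z (f t)) (f' t) (f t)) / (K (f t) (f t))\<^sup>2
       = 4 * (\<Sum>i\<in>UNIV. \<epsilon> i * (l' t $ i * cnj (l' t $ i)))"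
    and f'0: "f' 0 \<noteq> 0"
  shows False
proof (rule kernel_along_isometric_curve[OF \<rho> fU f l \<epsilon> iso])
  fix r :: real and C h :: "complex \<Rightarrow> complex"
  assume r: "0 < r" "r \<le> \<rho>"
    and nz: "\<And>t s. t \<in> ball 0 r \<Longrightarrow> s \<in> ball 0 r \<Longrightarrow> K (f t) (f (cnj s)) \<noteq> 0"
    and rep0: "\<And>t s. t \<in> ball 0 r \<Longrightarrow> s \<in> ball 0 r \<Longrightarrow>
       K (f t) (f (cnj s)) = C s * exp ((\<Sum>i\<in>UNIV. l t $ i * (4 * \<epsilon> i * cnj (l (cnj s) $ i))) + h t)"
  define c where "c s = (\<chi> i. 4 * \<epsilon> i * cnj (l (cnj s) $ i))" for s
  define c' where "c' s = (\<chi> i. 4 * \<epsilon> i * cnj (l' (cnj s) $ i))" for s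
  define k where "k t s = K (f t) (f (cnj s))" for t s
  have sub: "ball 0 r \<subseteq> ball (0::complex) \<rho>" using r by auto
  have cb: "cnj s \<in> ball 0 r" if "s \<in> ball 0 r" for s using that by simp
  have r0: "(0::complex) \<in> ball 0 r" using r by simp
  have fr: "((\<lambda>t. f t $ i) has_field_derivative f' t $ i) (at t)" and lr: "((\<lambda>t. l t $ j) has_field_derivative l' t $ j) (at t)"
    and fUr: "f t \<in> \<Omega>" if "t \<in> ball 0 r" for t i j
    using f l fU that sub by auto
  have knz: "k t s \<noteq> 0" if "t \<in> ball 0 r" "s \<in> ball 0 r" for t s using nz[OF that] by (simp add: k_def)
  have rep: "k t s = C s * exp ((\<Sum>i\<in>UNIV. l t $ i * c s $ i) + h t)" if "t \<in> ball 0 r" "s \<in> ball 0 r" for t s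
    using rep0[OF that] by (simp add: k_def c_def)
  have Cnz: "C s \<noteq> 0" if "s \<in> ball 0 r" for s using rep[OF r0 that] knz[OF r0 that] by auto
  have c: "((\<lambda>s. c s $ i) has_field_derivative c' s $ i) (at s)" if s: "s \<in> ball 0 r" for s i
  proof -
    have "((\<lambda>s. cnj (l (cnj s) $ i)) has_field_derivative cnj (l' (cnj s) $ i)) (at s)"
      using has_field_derivative_cnj_cnj[OF lr[OF cb[OF s], of i]] by (simp add: o_def)
    from DERIV_cmult[OF this, of "4 * \<epsilon> i"] show ?thesis by (simp add: c_def c'_def)
  qed
  obtain B1 where B1: "B1 \<subseteq> c' ` ball 0 r" "vec.independent B1" "c' ` ball 0 r \<subseteq> vec.span B1"
    using vec.maximal_independent_subset[of "c' ` ball 0 r"] by metis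
  text \<open>Some velocity \<open>v\<close> of \<open>c\<close> gives a non-constant exponent. Otherwise the kernel would split into
    a product of functions of \<open>t\<close> and \<open>s\<close>, and equality would hold in the Cauchy--Schwarz inequality.\<close>
  have "\<exists>v\<in>B1. \<exists>t\<in>ball 0 r. (\<Sum>i\<in>UNIV. l' t $ i * v $ i) \<noteq> 0"
  proof (rule ccontr)
    assume "\<not> ?thesis"
    then have B0: "(\<Sum>i\<in>UNIV. l' t $ i * v $ i) = 0" if "v \<in> B1" "t \<in> ball 0 r" for v t using that by blast
    have span0: "(\<Sum>i\<in>UNIV. l' t $ i * v $ i) = 0" if v: "v \<in> vec.span B1" and t: "t \<in> ball 0 r" for v t
    proof -
      have "vec.subspace {v. (\<Sum>i\<in>UNIV. l' t $ i * v $ i) = 0}"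
      proof (rule vec.subspaceI)
        fix a x assume "x \<in> {v. (\<Sum>i\<in>UNIV. l' t $ i * v $ i) = 0}"
        moreover have "(\<Sum>i\<in>UNIV. l' t $ i * (a *s x) $ i) = a * (\<Sum>i\<in>UNIV. l' t $ i * x $ i)"
          by (simp add: sum_distrib_left mult_ac)
        ultimately show "a *s x \<in> {v. (\<Sum>i\<in>UNIV. l' t $ i * v $ i) = 0}" by simp
      qed (simp_all add: distrib_left sum.distrib)
      then show ?thesis using vec.span_minimal[of B1 "{v. (\<Sum>i\<in>UNIV. l' t $ i * v $ i) = 0}"] B0 t v by blast
    qed
    have const: "g t = g 0" if g: "\<And>t. t \<in> ball 0 r \<Longrightarrow> (g has_field_derivative 0) (at t)" and t: "t \<in> ball 0 r"
      for g :: "complex \<Rightarrow> complex" and t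
    proof -
      have "\<exists>a. \<forall>x\<in>ball 0 r. g x = a"
        by (rule has_field_derivative_zero_constant[OF convex_ball], rule has_field_derivative_at_within, rule g)
      then obtain a where "\<forall>x\<in>ball 0 r. g x = a" ..
      then show ?thesis using t r0 by simp
    qed
    have A: "(\<Sum>i\<in>UNIV. l' t $ i * c s $ i) = (\<Sum>i\<in>UNIV. l' t $ i * c 0 $ i)"
      if t: "t \<in> ball 0 r" and s: "s \<in> ball 0 r" for t s
    proof (rule const[OF _ s])
      fix s :: complex assume s: "s \<in> ball 0 r"
      have "((\<lambda>s. \<Sum>i\<in>UNIV. l' t $ i * c s $ i) has_field_derivative (\<Sum>i\<in>UNIV. l' t $ i * c' s $ i)) (at s)"
        by (intro DERIV_sum DERIV_cmult c s)
      then show "((\<lambda>s. \<Sum>i\<in>UNIV. l' t $ i * c s $ i) has_field_derivative 0) (at s)"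
        using span0[OF _ t, of "c' s"] B1(3) s by (simp add: image_subset_iff)
    qed
    define e where "e t s = (\<Sum>i\<in>UNIV. l t $ i * (c s $ i - c 0 $ i))" for t s
    have e: "e t s = e 0 s" if t: "t \<in> ball 0 r" and s: "s \<in> ball 0 r" for t s
    proof (rule const[of "\<lambda>t. e t s", OF _ t])
      fix t :: complex assume t: "t \<in> ball 0 r"
      have "((\<lambda>t. e t s) has_field_derivative (\<Sum>i\<in>UNIV. l' t $ i * (c s $ i - c 0 $ i))) (at t)"
        unfolding e_def by (intro DERIV_sum DERIV_cmult_right lr t)
      moreover have "(\<Sum>i\<in>UNIV. l' t $ i * (c s $ i - c 0 $ i)) = 0"
        using A[OF t s] by (simp add: right_diff_distrib sum_subtractf)
      ultimately show "((\<lambda>t. e t s) has_field_derivative 0) (at t)" by simp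
    qed
    define a where "a t = exp ((\<Sum>i\<in>UNIV. l t $ i * c 0 $ i) + h t)" for t
    have split: "k t s = (C s * exp (e 0 s)) * a t" if "t \<in> ball 0 r" "s \<in> ball 0 r" for t s
    proof -
      have "(\<Sum>i\<in>UNIV. l t $ i * c s $ i) = e t s + (\<Sum>i\<in>UNIV. l t $ i * c 0 $ i)"
        unfolding e_def by (simp add: right_diff_distrib sum_subtractf)
      then have "(\<Sum>i\<in>UNIV. l t $ i * c s $ i) = e 0 s + (\<Sum>i\<in>UNIV. l t $ i * c 0 $ i)"
        unfolding e[OF that] .
      then show ?thesis using rep[OF that] by (simp add: a_def exp_add mult_ac)
    qed
    have "f t = f 0" if t: "t \<in> ball 0 r" for t
    proof (rule cauchy_schwarz_equality)
      show "f t \<in> \<Omega>" "f 0 \<in> \<Omega>" using fUr t r0 by auto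
      have "k t (cnj t) * k 0 0 = k t 0 * k 0 (cnj t)"
        using split[OF t cb[OF t]] split[OF r0 r0] split[OF t r0] split[OF r0 cb[OF t]] by simp
      then show "K (f t) (f t) * K (f 0) (f 0) = K (f t) (f 0) * K (f 0) (f t)" by (simp add: k_def)
    qed
    then have "f' 0 $ i = 0" for i
    proof -
      have "((\<lambda>t. f 0 $ i) has_field_derivative f' 0 $ i) (at 0)"
        by (rule has_field_derivative_transform_within_open[OF fr[OF r0] open_ball r0])
           (use \<open>\<And>t. t \<in> ball 0 r \<Longrightarrow> f t = f 0\<close> in simp)
      then show ?thesis using DERIV_unique[OF _ DERIV_const] by blast
    qed
    then show False using f'0 by (simp add: vec_eq_iff)
  qed
  then obtain v t0 where v: "v \<in> B1" and t0: "t0 \<in> ball 0 r" "(\<Sum>i\<in>UNIV. l' t0 $ i * v $ i) \<noteq> 0" by blast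
  define x where "x t = (\<Sum>i\<in>UNIV. l t $ i * v $ i)" for t
  define x' where "x' t = (\<Sum>i\<in>UNIV. l' t $ i * v $ i)" for t
  have x: "(x has_field_derivative x' t) (at t)" if "t \<in> ball 0 r" for t
    unfolding x_def x'_def by (intro DERIV_sum DERIV_cmult_right lr that)
  have "x' t0 \<noteq> 0" using t0(2) by (simp add: x'_def)
  interpret X: exponential_family "\<lambda>\<tau>. germ (\<lambda>t. exp (\<tau> * x t))" "germ x'"
    by (rule germ_exponential_family[OF r(1) x t0(1)]) (assumption, fact)
  have fh: "(\<lambda>t. f t $ i) holomorphic_on ball 0 r" for i
    using fr by (intro holomorphic_onI) (meson field_differentiable_at_within field_differentiable_def)
  have kh: "(\<lambda>t. k t s) holomorphic_on ball 0 r" if "s \<in> ball 0 r" for s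
    unfolding k_def by (rule sesqui_on_curve(1)[OF sesqui_on_kernel r(1) fUr fr that])
  let ?S = "fam_span (curve_monomial f)"
  note ring = is_subring_curve[OF r(1), of f]
  have kalg: "algebraic_over ?S (germ (\<lambda>t. k t s))" if s: "s \<in> ball 0 r" for s
    unfolding k_def by (rule kernel_germ_algebraic[OF r(1) fh fUr fUr[OF cb[OF s]] kh[OF s, unfolded k_def]])
  have ih: "(\<lambda>t. inverse (k t s)) holomorphic_on ball 0 r" if s: "s \<in> ball 0 r" for s
    by (intro holomorphic_on_inverse kh s knz)
  have ialg: "algebraic_over ?S (germ (\<lambda>t. inverse (k t s)))" if s: "s \<in> ball 0 r" for s
  proof (rule algebraic_over_inverse[OF kalg[OF s]])
    have "germ (\<lambda>t. k t s) * germ (\<lambda>t. inverse (k t s)) = germ (\<lambda>t. k t s * inverse (k t s))"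
      by (rule germ_mult[OF r(1) kh[OF s] ih[OF s], symmetric])
    also have "\<dots> = germ (\<lambda>_. 1)"
    proof (rule germ_cong[OF r(1)])
      show "(\<lambda>t. k t s * inverse (k t s)) holomorphic_on ball 0 r"
        by (rule holomorphic_on_mult[OF kh[OF s] ih[OF s]])
      show "k t s * inverse (k t s) = 1" if "t \<in> ball 0 r" for t
        using knz[OF that s] by (rule right_inverse)
    qed
    finally show "germ (\<lambda>t. k t s) * germ (\<lambda>t. inverse (k t s)) = 1" by (simp add: germ_const[OF r(1)])
  qed
  obtain \<delta> where \<delta>: "0 < \<delta>" "\<And>\<tau>. cmod \<tau> < \<delta> \<Longrightarrow> \<exists>(I :: 'N set) s s'.
      (\<forall>i\<in>I. s i \<in> ball 0 r \<and> s' i \<in> ball 0 r) \<and> \<tau> *s v = (\<Sum>i\<in>I. c (s' i) - c (s i))"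
    by (rule curve_increments_fill_span[OF c r(1) B1 v]) (assumption, rule that)
  have "algebraic_over ?S (germ (\<lambda>t. exp (\<tau> * x t)))" if \<tau>: "cmod \<tau> < \<delta>" for \<tau>
  proof -
    obtain I :: "'N set" and s s' where I: "\<forall>i\<in>I. s i \<in> ball 0 r \<and> s' i \<in> ball 0 r"
        "\<tau> *s v = (\<Sum>i\<in>I. c (s' i) - c (s i))" using \<delta>(2)[OF \<tau>] by blast
    then have sI: "s i \<in> ball 0 r" "s' i \<in> ball 0 r" if "i \<in> I" for i using that by auto
    define g where "g i t = C (s i) / C (s' i) * (k t (s' i) * inverse (k t (s i)))" for i t
    have gh: "g i holomorphic_on ball 0 r" if "i \<in> I" for i
      unfolding g_def using sI[OF that] by (intro holomorphic_on_mult holomorphic_on_const kh ih)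
    have galg: "algebraic_over ?S (germ (g i))" if i: "i \<in> I" for i
    proof -
      have "germ (g i) = fps_const (C (s i) / C (s' i)) * (germ (\<lambda>t. k t (s' i)) * germ (\<lambda>t. inverse (k t (s i))))"
      proof -
        note h = kh[OF sI(2)[OF i]] ih[OF sI(1)[OF i]]
        show ?thesis
          unfolding g_def germ_mult[OF r(1) h, symmetric] germ_const[OF r(1), symmetric]
          by (rule germ_mult[OF r(1) holomorphic_on_const holomorphic_on_mult[OF h]])
      qed
      moreover have "algebraic_over ?S (fps_const (C (s i) / C (s' i)))"
        by (rule algebraic_over_member[OF ring fps_const_in_curve_ring[OF r(1)]])
      ultimately show ?thesis
        using algebraic_over_mult[OF ring _ algebraic_over_mult[OF ring kalg[OF sI(2)[OF i]] ialg[OF sI(1)[OF i]]]]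
        by simp
    qed
    have ex: "exp (\<tau> * x t) = (\<Prod>i\<in>I. g i t)" if t: "t \<in> ball 0 r" for t
    proof -
      have gi: "g i t = exp (\<Sum>j\<in>UNIV. l t $ j * (c (s' i) $ j - c (s i) $ j))" if i: "i \<in> I" for i
      proof -
        have "(\<Sum>j\<in>UNIV. l t $ j * (c (s' i) $ j - c (s i) $ j))
            = ((\<Sum>j\<in>UNIV. l t $ j * c (s' i) $ j) + h t) - ((\<Sum>j\<in>UNIV. l t $ j * c (s i) $ j) + h t)"
          by (simp add: right_diff_distrib sum_subtractf)
        then have "exp (\<Sum>j\<in>UNIV. l t $ j * (c (s' i) $ j - c (s i) $ j))
            = exp ((\<Sum>j\<in>UNIV. l t $ j * c (s' i) $ j) + h t) / exp ((\<Sum>j\<in>UNIV. l t $ j * c (s i) $ j) + h t)"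
          by (simp only: exp_diff)
        also have "\<dots> = g i t"
          unfolding g_def rep[OF t sI(1)[OF i]] rep[OF t sI(2)[OF i]]
          using Cnz[OF sI(1)[OF i]] Cnz[OF sI(2)[OF i]] by (simp add: field_simps)
        finally show ?thesis by simp
      qed
      have "\<tau> * x t = (\<Sum>j\<in>UNIV. l t $ j * (\<tau> *s v) $ j)"
        by (simp add: x_def sum_distrib_left mult_ac)
      also have "\<dots> = (\<Sum>j\<in>UNIV. \<Sum>i\<in>I. l t $ j * (c (s' i) $ j - c (s i) $ j))"
        unfolding I(2) by (simp add: sum_distrib_left)
      also have "\<dots> = (\<Sum>i\<in>I. \<Sum>j\<in>UNIV. l t $ j * (c (s' i) $ j - c (s i) $ j))"
        by (rule sum.swap)
      finally show ?thesis by (simp add: exp_sum gi)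
    qed
    have "germ (\<lambda>t. \<Prod>i\<in>I. g i t) = germ (\<lambda>t. exp (\<tau> * x t))"
      by (rule germ_cong[OF r(1)]) (use ex in \<open>auto intro!: holomorphic_on_prod gh\<close>)
    from this[symmetric] germ_prod[OF r(1) gh]
    have prd: "germ (\<lambda>t. exp (\<tau> * x t)) = (\<Prod>i\<in>I. germ (g i))" by (rule trans)
    show ?thesis unfolding prd by (rule algebraic_over_prod[OF ring galg])
  qed
  then show False using X.exponentials_not_all_algebraic[OF \<delta>(1), of "curve_monomial f"] by blast
qed

lemma holo_map_frechet:
  fixes G :: "complex^'d \<Rightarrow> complex^'n"
  assumes G: "holo_map_on G V" and y: "y \<in> V"
  shows "(G has_derivative (\<lambda>v. \<chi> i. dir_deriv (\<lambda>z. G z $ i) v y)) (at y)"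
    "frechet_derivative G (at y) v $ i = dir_deriv (\<lambda>z. G z $ i) v y"
    "frechet_derivative G (at y) (a *s v) = a *s frechet_derivative G (at y) v"
proof -
  have h: "holo_on (\<lambda>z. G z $ i) V" for i using G by (simp add: holo_map_on_def)
  show d: "(G has_derivative (\<lambda>v. \<chi> i. dir_deriv (\<lambda>z. G z $ i) v y)) (at y)"
    by (rule has_derivative_vecI) (simp add: holo_on_dir_deriv_linear(1)[OF h y])
  have fr: "frechet_derivative G (at y) = (\<lambda>v. \<chi> i. dir_deriv (\<lambda>z. G z $ i) v y)"
    using frechet_derivative_at[OF d] by simp
  show "frechet_derivative G (at y) v $ i = dir_deriv (\<lambda>z. G z $ i) v y" by (simp add: fr)
  show "frechet_derivative G (at y) (a *s v) = a *s frechet_derivative G (at y) v"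
    by (simp add: fr vec_eq_iff holo_on_dir_deriv_linear(2)[OF h y])
qed

theorem corollary3p4:
  fixes \<Omega> :: "(complex^'n) set"
    and K :: "complex^'n \<Rightarrow> complex^'n \<Rightarrow> complex"
    and \<kappa> :: nat
  assumes "open \<Omega>" and "connected \<Omega>" and "\<Omega> \<noteq> {}" and "bounded \<Omega>"
    and "is_bergman_kernel \<Omega> K"
    and "nash_algebraic_kernel \<Omega> K"
    and "\<kappa> \<le> CARD('N::{finite,linorder})"
  shows "\<not> (\<exists>(X :: 'a topology) (A :: ('a, 'd::finite) atlas).
            connected_complex_manifold X A \<and>
            isometrically_immersed_in_both X A \<Omega> (bergman_form K)
              (UNIV :: (complex^'N::{finite,linorder}) set) (indef_euclidean_form \<kappa>))"
proof (intro notI, elim exE conjE)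
  interpret nash_bergman_kernel \<Omega> K
    by unfold_locales (fact assms)+
  fix X :: "'a topology" and A :: "('a, 'd) atlas"
  assume X: "connected_complex_manifold X A"
    and iso: "isometrically_immersed_in_both X A \<Omega> (bergman_form K)
        (UNIV :: (complex^'N::{finite,linorder}) set) (indef_euclidean_form \<kappa>)"
  obtain F L where F: "F ` topspace X \<subseteq> \<Omega>" "holo_immersion A F" and L: "holo_immersion A L"
    and FL: "\<forall>(U, \<phi>)\<in>A. \<forall>x\<in>\<phi> ` U. \<forall>u v. pullback (\<lambda>y. F (inv_into U \<phi> y)) (bergman_form K) x u v
        = pullback (\<lambda>y. (L :: 'a \<Rightarrow> (complex, 'N) vec) (inv_into U \<phi> y)) (indef_euclidean_form \<kappa>) x u v"
    using iso unfolding isometrically_immersed_in_both_def by blast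
  have "topspace X \<noteq> {}" "(\<Union>(U, \<phi>)\<in>A. U) = topspace X"
    and charts: "\<forall>(U, \<phi>)\<in>A. openin X U \<and> open (\<phi> ` U) \<and>
        homeomorphic_map (subtopology X U) (top_of_set (\<phi> ` U)) \<phi>"
    using X unfolding connected_complex_manifold_def by auto
  then obtain U \<phi> a where chart: "(U, \<phi>) \<in> A" and a: "a \<in> U" by fast
  define V where "V = \<phi> ` U"
  define G where "G y = F (inv_into U \<phi> y)" for y
  define H where "H y = L (inv_into U \<phi> y)" for y
  have "openin X U" and opn: "open (\<phi> ` U)" using bspec[OF charts chart] by auto
  then have U: "U \<subseteq> topspace X" by (simp add: openin_subset)
  have V: "open V" "\<phi> a \<in> V" using opn a by (auto simp: V_def)
  have G: "holo_map_on G V" "\<And>y. y \<in> V \<Longrightarrow> inj (frechet_derivative G (at y))"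
    using F(2) chart unfolding holo_immersion_def G_def V_def by auto
  have H: "holo_map_on H V" using L chart unfolding holo_immersion_def H_def V_def by auto
  have G\<Omega>: "G y \<in> \<Omega>" if "y \<in> V" for y
    using inv_into_into[of y \<phi> U] that F(1) U unfolding G_def V_def by blast
  have pull: "pullback G (bergman_form K) y u w = pullback H (indef_euclidean_form \<kappa>) y u w" if "y \<in> V" for y u w
    using FL chart that unfolding G_def H_def V_def by blast
  obtain \<rho> where \<rho>: "0 < \<rho>" "ball (\<phi> a) \<rho> \<subseteq> V" using V openE by blast
  define e where "e = axis (undefined :: 'd) (1 :: complex)"
  have e: "norm e = 1" 
    unfolding e_def using norm_Basis[of "axis undefined 1 :: complex^'d"] by (simp add: Basis_complex_def)
  define p where "p t = \<phi> a + t *s e" for t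
  have p: "p t \<in> V" if "t \<in> ball 0 \<rho>" for t
    using \<rho>(2) that by (auto simp: p_def dist_norm norm_complex_smult e)
  show False
  proof (rule no_isometric_curve[of \<rho> "\<lambda>t. G (p t)" "\<lambda>t. frechet_derivative G (at (p t)) e"
        "\<lambda>t. H (p t)" "\<lambda>t. frechet_derivative H (at (p t)) e" "signature \<kappa>"])
    show "0 < \<rho>" by (rule \<rho>)
    show "G (p t) \<in> \<Omega>" if "t \<in> ball 0 \<rho>" for t by (rule G\<Omega>[OF p[OF that]])
    show "((\<lambda>t. G (p t) $ i) has_field_derivative frechet_derivative G (at (p t)) e $ i) (at t)"
      if "t \<in> ball 0 \<rho>" for t i
      using holo_on_line[of "\<lambda>z. G z $ i" V "\<phi> a" t e] G(1) p[OF that]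
      unfolding holo_map_frechet(2)[OF G(1) p[OF that]] by (simp add: p_def holo_map_on_def)
    show "((\<lambda>t. H (p t) $ i) has_field_derivative frechet_derivative H (at (p t)) e $ i) (at t)"
      if "t \<in> ball 0 \<rho>" for t i
      using holo_on_line[of "\<lambda>z. H z $ i" V "\<phi> a" t e] H p[OF that]
      unfolding holo_map_frechet(2)[OF H p[OF that]] by (simp add: p_def holo_map_on_def)
    show "cnj (signature \<kappa> i) = signature \<kappa> i" for i by (simp add: signature_def)
    show "frechet_derivative G (at (p 0)) e \<noteq> 0"
    proof
      have p0: "p 0 \<in> V" using p \<rho>(1) by simp
      assume "frechet_derivative G (at (p 0)) e = 0"
      moreover have "frechet_derivative G (at (p 0)) 0 = 0"
        using holo_map_frechet(3)[OF G(1) p0, of 0 0] by simp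
      ultimately have "e = 0" using G(2)[OF p0] by (metis injD)
      then show False using e by simp
    qed
    fix t :: complex assume t: "t \<in> ball 0 \<rho>"
    let ?u = "frechet_derivative G (at (p t)) e" and ?w = "frechet_derivative H (at (p t)) e"
    have "bergman_form K (G (p t)) ?u (\<i> *s ?u) = indef_euclidean_form \<kappa> (H (p t)) ?w (\<i> *s ?w)"
      using pull[OF p[OF t], of e "\<i> *s e"]
      by (simp add: pullback_def holo_map_frechet(3)[OF G(1) p[OF t]] holo_map_frechet(3)[OF H p[OF t]])
    then have eq: "2 * ((dir_deriv (\<lambda>z. dbar_deriv K ?u z (G (p t))) ?u (G (p t)) * K (G (p t)) (G (p t))
        - dbar_deriv K ?u (G (p t)) (G (p t)) * dir_deriv (\<lambda>z. K z (G (p t))) ?u (G (p t))) / (K (G (p t)) (G (p t)))\<^sup>2)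
      = 8 * (\<Sum>i\<in>UNIV. signature \<kappa> i * (?w $ i * cnj (?w $ i)))"
      unfolding bergman_levi[OF G\<Omega>[OF p[OF t]]] indef_euclidean_levi .
    have "x = 4 * y" if "2 * x = 8 * y" for x y :: complex
    proof -
      have "x = 2 * x / 2" by simp
      also have "\<dots> = 4 * y" unfolding that by simp
      finally show ?thesis .
    qed
    from this[OF eq] show "(dir_deriv (\<lambda>z. dbar_deriv K ?u z (G (p t))) ?u (G (p t)) * K (G (p t)) (G (p t))
        - dbar_deriv K ?u (G (p t)) (G (p t)) * dir_deriv (\<lambda>z. K z (G (p t))) ?u (G (p t))) / (K (G (p t)) (G (p t)))\<^sup>2
      = 4 * (\<Sum>i\<in>UNIV. signature \<kappa> i * (?w $ i * cnj (?w $ i)))"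
      .
  qed
qed

end
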